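(* Let $1 \le q_1 \le p_1<\infty$, $1 \le q_2 \le p_2<\infty$, $1 \le q \le p<\infty$, $1 \le r \le \infty$ and $s>0$. Assume that \[ \frac1p=\frac{1}{p_1}+\frac{1}{p_2}, \qquad \frac1q=\frac{1}{q_1}+\frac{1}{q_2}. \] Then there is a constant $C>0$, independent of $f$ and $g$, such that for all $f \in \mathcal{N}^{s}_{p_1q_1r}(\mathbf{R}^n)$ and $g \in \mathcal{N}^{s}_{p_2q_2r}(\mathbf{R}^n)$ the product $f\cdot g$ makes sense, belongs to $\mathcal{N}^{s}_{pqr}(\mathbf{R}^n)$, and satisfies \[ \| f \cdot g\|_{\mathcal{N}^{s}_{pqr}} \le C \|f\|_{\mathcal{N}^{s}_{p_1q_1r}} \|g\|_{\mathcal{N}^{s}_{p_2q_2r}}. \]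
   Context: Functions are complex-valued on $\mathbf{R}^n$. $B(x,\rho)=\{y\in\mathbf{R}^n: |x-y|<\rho\}$ and $B(\rho)=B(0,\rho)$. For $1\le q\le p<\infty$ the Morrey norm of a measurable function $f$ is \[ \|f\|_{\mathcal{M}^p_q}=\sup_{x\in\mathbf{R}^n,\ \rho>0}|B(x,\rho)|^{\frac1p-\frac1q}\|f\|_{L^q(B(x,\rho))}, \] and $\mathcal{M}^p_q(\mathbf{R}^n)$ is the set of measurable functions (modulo a.e. equality) with finite norm. Fix $\psi\in C^\infty_{\rm c}(\mathbf{R}^n)$ with $\chi_{B(6/5)}\le\psi\le\chi_{B(3/2)}$, and set $\varphi_0=\psi$, $\varphi_j(\xi)=\psi(2^{-j}\xi)-\psi(2^{-j+1}\xi)$ for $j\ge 1$. For $\theta\in\mathcal{S}(\mathbf{R}^n)$ and $f\in\mathcal{S}'(\mathbf{R}^n)$, $\theta(D)f=\mathcal{F}^{-1}[\theta\cdot\mathcal{F}f]$, where $\mathcal{F}f(\xi)=(2\pi)^{-n/2}\int_{\mathbf{R}^n} f(x)e^{-ix\cdot\xi}\,dx$. For $1\le q\le p<\infty$, $1\le r\le\infty$, $s\in\mathbf{R}$, the Besov--Morrey space $\mathcal{N}^s_{pqr}(\mathbf{R}^n)$ is the set of $f\in\mathcal{S}'(\mathbf{R}^n)$ with \[ \|f\|_{\mathcal{N}^s_{pqr}}=\Big(\sum_{j=0}^\infty(2^{js}\|\varphi_j(D)f\|_{\mathcal{M}^p_q})^r\Big)^{1/r}<\infty, \] with the sum replaced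 by a supremum over $j$ when $r=\infty$. For $s>0$, $\mathcal{N}^s_{pqr}(\mathbf{R}^n)\subset\mathcal{M}^p_q(\mathbf{R}^n)$, so elements of these spaces are locally integrable functions; the product $f\cdot g$ is the pointwise (a.e.) product of the functions $f$ and $g$. *)

theory Defs
  imports "HOL-Analysis.Analysis"
begin

section \<open>Smooth, compactly supported and Schwartz functions\<close>

definition partial_deriv ::
  "'n::finite \<Rightarrow> (real^'n \<Rightarrow> 'b::real_normed_vector) \<Rightarrow> real^'n \<Rightarrow> 'b" where
  "partial_deriv k f x = vector_derivative (\<lambda>t. f (x + t *\<^sub>R axis k 1)) (at 0)"

text \<open>A multi-index derivative of order $m$ is written as a list of $m$ coordinate
  indices; for smooth functions the order of the list does not matter.\<close>

primrec partial_derivs ::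
  "'n::finite list \<Rightarrow> (real^'n \<Rightarrow> 'b::real_normed_vector) \<Rightarrow> real^'n \<Rightarrow> 'b" where
  "partial_derivs [] f = f"
| "partial_derivs (k # ks) f = partial_deriv k (partial_derivs ks f)"

text \<open>Differentiability of every iterated partial derivative is the same as
  infinite continuous differentiability.\<close>

definition smooth :: "(real^'n::finite \<Rightarrow> 'b::real_normed_vector) \<Rightarrow> bool" where
  "smooth f \<longleftrightarrow> (\<forall>ks x. partial_derivs ks f differentiable (at x))"

definition test_functions :: "(real^'n::finite \<Rightarrow> 'b::real_normed_vector) set" where
  "test_functions = {f. smooth f \<and> compact (closure {x. f x \<noteq> 0})}"

definition schwartz_seminorm :: "nat \<Rightarrow> (real^'n::finite \<Rightarrow> complex) \<Rightarrow> ennreal" where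
  "schwartz_seminorm m \<phi> =
    (SUP ks\<in>{ks. length ks \<le> m}. SUP x. ennreal ((1 + norm x) ^ m * norm (partial_derivs ks \<phi> x)))"

definition schwartz :: "(real^'n::finite \<Rightarrow> complex) set" where
  "schwartz = {\<phi>. smooth \<phi> \<and> (\<forall>m. schwartz_seminorm m \<phi> < \<infinity>)}"


section \<open>Tempered distributions\<close>

text \<open>Distributions are functionals on the carrier \<^const>\<open>schwartz\<close>, made extensional so that
  they are determined by their values there. Since the seminorms increase with $m$, continuity
  of a linear functional is boundedness by a multiple of a single one of them.\<close>

definition tempered_distributions :: "((real^'n::finite \<Rightarrow> complex) \<Rightarrow> complex) set" where
  "tempered_distributions = {u \<in> extensional schwartz.
     (\<forall>\<phi>\<in>schwartz. \<forall>\<eta>\<in>schwartz. u (\<lambda>x. \<phi> x + \<eta> x) = u \<phi> + u \<eta>) \<and>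
     (\<forall>c. \<forall>\<phi>\<in>schwartz. u (\<lambda>x. c * \<phi> x) = c * u \<phi>) \<and>
     (\<exists>m. \<exists>C::real. \<forall>\<phi>\<in>schwartz. ennreal (norm (u \<phi>)) \<le> ennreal C * schwartz_seminorm m \<phi>)}"

definition fourier :: "(real^'n::finite \<Rightarrow> complex) \<Rightarrow> real^'n \<Rightarrow> complex" where
  "fourier \<phi> \<xi> = of_real ((2 * pi) powr (- real CARD('n) / 2)) *
     (LINT x|lebesgue. \<phi> x * exp (- \<i> * of_real (x \<bullet> \<xi>)))"

definition inv_fourier :: "(real^'n::finite \<Rightarrow> complex) \<Rightarrow> real^'n \<Rightarrow> complex" where
  "inv_fourier \<phi> x = of_real ((2 * pi) powr (- real CARD('n) / 2)) *
     (LINT \<xi>|lebesgue. \<phi> \<xi> * exp (\<i> * of_real (x \<bullet> \<xi>)))"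

text \<open>On distributions the two transforms and multiplication act by duality.\<close>

definition fourier_dist ::
  "((real^'n::finite \<Rightarrow> complex) \<Rightarrow> complex) \<Rightarrow> (real^'n \<Rightarrow> complex) \<Rightarrow> complex" where
  "fourier_dist u = (\<lambda>\<phi>\<in>schwartz. u (fourier \<phi>))"

definition inv_fourier_dist ::
  "((real^'n::finite \<Rightarrow> complex) \<Rightarrow> complex) \<Rightarrow> (real^'n \<Rightarrow> complex) \<Rightarrow> complex" where
  "inv_fourier_dist u = (\<lambda>\<phi>\<in>schwartz. u (inv_fourier \<phi>))"

definition mult_dist ::
  "(real^'n::finite \<Rightarrow> complex) \<Rightarrow> ((real^'n \<Rightarrow> complex) \<Rightarrow> complex)
    \<Rightarrow> (real^'n \<Rightarrow> complex) \<Rightarrow> complex" where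
  "mult_dist \<theta> u = (\<lambda>\<phi>\<in>schwartz. u (\<lambda>x. \<theta> x * \<phi> x))"

definition fourier_multiplier ::
  "(real^'n::finite \<Rightarrow> complex) \<Rightarrow> ((real^'n \<Rightarrow> complex) \<Rightarrow> complex)
    \<Rightarrow> (real^'n \<Rightarrow> complex) \<Rightarrow> complex" where
  "fourier_multiplier \<theta> u = inv_fourier_dist (mult_dist \<theta> (fourier_dist u))"

definition locally_integrable :: "(real^'n::finite \<Rightarrow> complex) \<Rightarrow> bool" where
  "locally_integrable F \<longleftrightarrow> (\<forall>K. compact K \<longrightarrow> F absolutely_integrable_on K)"

text \<open>The distribution \<open>u\<close> is the function \<open>F\<close>. Only test functions are paired with \<open>F\<close>, since
  \<open>F\<close> times a Schwartz function need not be integrable for a general locally integrable \<open>F\<close>;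
  a tempered distribution is determined by its values on test functions.\<close>

definition represents ::
  "(real^'n::finite \<Rightarrow> complex) \<Rightarrow> ((real^'n \<Rightarrow> complex) \<Rightarrow> complex) \<Rightarrow> bool" where
  "represents F u \<longleftrightarrow> locally_integrable F \<and>
     (\<forall>\<phi>\<in>test_functions. u \<phi> = (LINT x|lebesgue. F x * \<phi> x))"


section \<open>Morrey and Besov--Morrey norms\<close>

text \<open>Meant for exponents \<open>a > 0\<close>.\<close>

definition ennreal_powr :: "ennreal \<Rightarrow> real \<Rightarrow> ennreal" where
  "ennreal_powr t a = (if t = \<infinity> then \<infinity> else ennreal (enn2real t powr a))"

definition Lq_norm_on :: "real \<Rightarrow> (real^'n::finite) set \<Rightarrow> (real^'n \<Rightarrow> complex) \<Rightarrow> ennreal" where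
  "Lq_norm_on q A F = ennreal_powr (\<integral>\<^sup>+y\<in>A. ennreal (norm (F y) powr q) \<partial>lebesgue) (1 / q)"

definition morrey_norm :: "real \<Rightarrow> real \<Rightarrow> (real^'n::finite \<Rightarrow> complex) \<Rightarrow> ennreal" where
  "morrey_norm p q F = (SUP x. SUP \<rho>\<in>{0<..}.
     ennreal (measure lebesgue (ball x \<rho>) powr (1 / p - 1 / q)) * Lq_norm_on q (ball x \<rho>) F)"

text \<open>The Morrey norm of a distribution is that of the function it is. All representatives agree
  almost everywhere, so the infimum is over at most one value, and it is \<open>\<infinity>\<close> if the distribution
  is not a function.\<close>

definition morrey_norm_dist ::
  "real \<Rightarrow> real \<Rightarrow> ((real^'n::finite \<Rightarrow> complex) \<Rightarrow> complex) \<Rightarrow> ennreal" where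
  "morrey_norm_dist p q u = (INF F\<in>{F. represents F u}. morrey_norm p q F)"

definition cutoff :: "(real^'n::finite \<Rightarrow> real) \<Rightarrow> bool" where
  "cutoff \<psi> \<longleftrightarrow> \<psi> \<in> test_functions \<and>
     (\<forall>x. indicator (ball 0 (6/5)) x \<le> \<psi> x \<and> \<psi> x \<le> indicator (ball 0 (3/2)) x)"

primrec dyadic :: "(real^'n::finite \<Rightarrow> real) \<Rightarrow> nat \<Rightarrow> real^'n \<Rightarrow> real" where
  "dyadic \<psi> 0 = \<psi>"
| "dyadic \<psi> (Suc j) = (\<lambda>\<xi>. \<psi> ((1 / 2 ^ Suc j) *\<^sub>R \<xi>) - \<psi> ((1 / 2 ^ j) *\<^sub>R \<xi>))"

definition besov_morrey_norm ::
  "(real^'n::finite \<Rightarrow> real) \<Rightarrow> real \<Rightarrow> real \<Rightarrow> real \<Rightarrow> ennreal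
    \<Rightarrow> ((real^'n \<Rightarrow> complex) \<Rightarrow> complex) \<Rightarrow> ennreal" where
  "besov_morrey_norm \<psi> s p q r u =
    (let a = (\<lambda>j. ennreal (2 powr (real j * s)) *
                morrey_norm_dist p q (fourier_multiplier (\<lambda>\<xi>. of_real (dyadic \<psi> j \<xi>)) u))
     in if r = \<infinity> then (SUP j. a j)
        else ennreal_powr (\<Sum>j. ennreal_powr (a j) (enn2real r)) (1 / enn2real r))"

definition besov_morrey ::
  "(real^'n::finite \<Rightarrow> real) \<Rightarrow> real \<Rightarrow> real \<Rightarrow> real \<Rightarrow> ennreal
    \<Rightarrow> ((real^'n \<Rightarrow> complex) \<Rightarrow> complex) set" where
  "besov_morrey \<psi> s p q r =
    {u \<in> tempered_distributions. besov_morrey_norm \<psi> s p q r u < \<infinity>}"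

end

theory Submission
  imports Defs "HOL-Probability.Probability"
begin

text \<open>The elements of the Besov--Morrey spaces are absolutely convergent sums \<open>f = \<Sum> f\<^sub>k\<close> of their
  dyadic pieces in the Morrey space, since \<open>s > 0\<close>. Write \<open>S\<^sub>m\<close> for the low-pass operator
  \<open>\<psi>(2\<^sup>-\<^sup>mD)\<close>. The product \<open>S\<^sub>mf \<cdot> S\<^sub>mg\<close> has its spectrum in a ball of radius \<open>3 \<cdot> 2\<^sup>m\<close>, which the
  \<open>j\<close>-th dyadic multiplier does not see when \<open>m = j - 3\<close>. Hence \<open>\<phi>\<^sub>j(D)(fg)\<close> is \<open>\<phi>\<^sub>j(D)\<close> applied to
  \<open>(f - S\<^sub>mf) g + S\<^sub>mf (g - S\<^sub>mg)\<close>, and Young's and Hoelder's inequalities in Morrey spaces bound it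
  by the tails \<open>\<Sum>k>m. \<parallel>f\<^sub>k\<parallel>\<close> and \<open>\<Sum>k>m. \<parallel>g\<^sub>k\<parallel>\<close> times the full sums of the other factor. The
  tails are handled by Young's inequality for sequences in the weighted \<open>\<ell>\<^sup>r\<close> norm.\<close>

section \<open>Calculus of iterated partial derivatives\<close>

text \<open>Multipliers act on functionals, Hoelder's inequality on functions, and most of the work
  is to pass between the two. The bridge is the class \<open>tame\<close> of functions integrable,
  uniformly, against every translate of the weight (1 + |x|)^-(n+1): it contains all Morrey
  functions, its members define tempered distributions, and on it \<open>\<theta>(D)\<close> is a
  convolution with a Schwartz kernel. The Fourier transform of a tame function is in general only a
  distribution, so the spectrum of a product is located through the kernels and not through the
  factors. Conversely, a block of a distribution is a function only because its norm is finite, and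
  it is seen only through test functions and up to null sets; hence the uniqueness and density
  results.

  Kernels therefore enter only through their L^1 norms, which dilation keeps uniform in j.
  Minkowski's and Young's inequalities for Morrey norms, and Young's for sequences, all come from
  Jensen's inequality, which treats q = 1 and r = 1 like the other exponents.\<close>

lemma partial_deriv_eq:
  assumes "(f has_derivative D) (at x)"
  shows "partial_deriv k f x = D (axis k 1)"
proof -
  have "((\<lambda>t. x + t *\<^sub>R axis k 1) has_derivative (\<lambda>t. t *\<^sub>R axis k 1)) (at 0)"
    by (auto intro!: derivative_eq_intros)
  moreover have "(f has_derivative D) (at (x + 0 *\<^sub>R axis k 1))"
    using assms by simp
  ultimately have "((\<lambda>t. f (x + t *\<^sub>R axis k 1)) has_derivative (\<lambda>t. D (t *\<^sub>R axis k 1))) (at 0)"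
    using has_derivative_compose by fastforce
  moreover have "D (t *\<^sub>R axis k 1) = t *\<^sub>R D (axis k 1)" for t
    using assms by (simp add: has_derivative_def bounded_linear.linear linear_scale)
  ultimately have "((\<lambda>t. f (x + t *\<^sub>R axis k 1)) has_vector_derivative D (axis k 1)) (at 0)"
    by (simp add: has_vector_derivative_def)
  then show ?thesis
    unfolding partial_deriv_def by (rule vector_derivative_at)
qed

lemma has_vector_derivative_partial_deriv:
  assumes "f differentiable (at (x + t *\<^sub>R axis k 1))"
  shows "((\<lambda>t. f (x + t *\<^sub>R axis k 1)) has_vector_derivative partial_deriv k f (x + t *\<^sub>R axis k 1)) (at t)"
proof -
  obtain D where D: "(f has_derivative D) (at (x + t *\<^sub>R axis k 1))"
    using assms by (auto simp: differentiable_def)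
  have "((\<lambda>t. x + t *\<^sub>R axis k 1) has_derivative (\<lambda>t. t *\<^sub>R axis k 1)) (at t)"
    by (auto intro!: derivative_eq_intros)
  then have "((\<lambda>t. f (x + t *\<^sub>R axis k 1)) has_derivative (\<lambda>t. D (t *\<^sub>R axis k 1))) (at t)"
    using has_derivative_compose D by fastforce
  moreover have "D (s *\<^sub>R axis k 1) = s *\<^sub>R D (axis k 1)" for s
    using D by (simp add: has_derivative_def bounded_linear.linear linear_scale)
  ultimately show ?thesis
    by (simp add: has_vector_derivative_def partial_deriv_eq[OF D])
qed

lemma partial_deriv_const [simp]: "partial_deriv k (\<lambda>x. c) = (\<lambda>x. 0)"
  by (rule ext) (rule partial_deriv_eq[OF has_derivative_const])

lemma partial_deriv_add:
  assumes "f differentiable (at x)" "g differentiable (at x)"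
  shows "partial_deriv k (\<lambda>x. f x + g x) x = partial_deriv k f x + partial_deriv k g x"
proof -
  obtain D E where D: "(f has_derivative D) (at x)" and E: "(g has_derivative E) (at x)"
    using assms by (auto simp: differentiable_def)
  show ?thesis
    using partial_deriv_eq[OF has_derivative_add[OF D E], of k] partial_deriv_eq[OF D, of k]
      partial_deriv_eq[OF E, of k] by simp
qed

lemma partial_deriv_mult:
  fixes f g :: "real^'n::finite \<Rightarrow> 'b::real_normed_algebra"
  assumes "f differentiable (at x)" "g differentiable (at x)"
  shows "partial_deriv k (\<lambda>x. f x * g x) x = f x * partial_deriv k g x + partial_deriv k f x * g x"
proof -
  obtain D E where D: "(f has_derivative D) (at x)" and E: "(g has_derivative E) (at x)"
    using assms by (auto simp: differentiable_def)
  show ?thesis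
    using partial_deriv_eq[OF has_derivative_mult[OF D E], of k] partial_deriv_eq[OF D, of k]
      partial_deriv_eq[OF E, of k] by simp
qed

lemma partial_deriv_linear:
  assumes "bounded_linear L" "f differentiable (at x)"
  shows "partial_deriv k (\<lambda>x. L (f x)) x = L (partial_deriv k f x)"
proof -
  obtain D where D: "(f has_derivative D) (at x)"
    using assms by (auto simp: differentiable_def)
  show ?thesis
    using partial_deriv_eq[OF bounded_linear.has_derivative[OF assms(1) D], of k]
      partial_deriv_eq[OF D, of k] by simp
qed

lemma partial_deriv_affine:
  fixes f :: "real^'n::finite \<Rightarrow> 'b::real_normed_vector"
  assumes "f differentiable (at (a *\<^sub>R x + b))"
  shows "partial_deriv k (\<lambda>x. f (a *\<^sub>R x + b)) x = a *\<^sub>R partial_deriv k f (a *\<^sub>R x + b)"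
proof -
  obtain D where D: "(f has_derivative D) (at (a *\<^sub>R x + b))"
    using assms by (auto simp: differentiable_def)
  have "((\<lambda>x. a *\<^sub>R x + b) has_derivative (\<lambda>x. a *\<^sub>R x)) (at x)"
    by (auto intro!: derivative_eq_intros)
  then have "((\<lambda>x. f (a *\<^sub>R x + b)) has_derivative (\<lambda>x. D (a *\<^sub>R x))) (at x)"
    using has_derivative_compose D by fastforce
  moreover have "D (a *\<^sub>R axis k 1) = a *\<^sub>R D (axis k 1)"
    using D by (simp add: has_derivative_def bounded_linear.linear linear_scale)
  ultimately show ?thesis
    using partial_deriv_eq D by metis
qed

lemma partial_derivs_append:
  "partial_derivs (ks @ ls) f = partial_derivs ks (partial_derivs ls f)"
  by (induction ks) auto

lemma smooth_differentiable: "smooth f \<Longrightarrow> f differentiable (at x)"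
  unfolding smooth_def by (metis partial_derivs.simps(1))

lemma smooth_partial_derivs: "smooth f \<Longrightarrow> smooth (partial_derivs ks f)"
  unfolding smooth_def by (metis partial_derivs_append)

lemma smooth_partial_deriv: "smooth f \<Longrightarrow> smooth (partial_deriv k f)"
  using smooth_partial_derivs[of f "[k]"] by simp

lemma smooth_continuous_on: "smooth f \<Longrightarrow> continuous_on UNIV f"
  by (simp add: continuous_at_imp_continuous_on differentiable_imp_continuous_within smooth_differentiable)

lemma smooth_borel_measurable: "smooth f \<Longrightarrow> f \<in> borel_measurable borel"
  by (simp add: borel_measurable_continuous_onI smooth_continuous_on)

text \<open>Replaces infinitely many differentiability claims by closure of one set \<open>X\<close>
  under partial derivatives. Sums, products and Fourier transforms are then smooth without any
  formula for their iterated derivatives.\<close>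

lemma smooth_coinduct:
  assumes "f \<in> X"
    and "\<And>f x. f \<in> X \<Longrightarrow> f differentiable (at x)"
    and "\<And>f k. f \<in> X \<Longrightarrow> partial_deriv k f \<in> X"
  shows "smooth f"
proof -
  have "partial_derivs ks f \<in> X" for ks
    by (induction ks) (auto intro: assms)
  then show ?thesis
    unfolding smooth_def using assms(2) by blast
qed

lemma smooth_const: "smooth (\<lambda>x. c)"
  by (rule smooth_coinduct[where X = "range (\<lambda>c x. c)"]) auto

lemma smooth_add:
  assumes "smooth f" "smooth g"
  shows "smooth (\<lambda>x. f x + g x)"
proof (rule smooth_coinduct[where X = "{(\<lambda>x. f x + g x) | f g. smooth f \<and> smooth g}"])
  show "(\<lambda>x. f x + g x) \<in> {(\<lambda>x. f x + g x) | f g. smooth f \<and> smooth g}"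
    using assms by blast
next
  fix h :: "real^'n \<Rightarrow> 'b" and x
  assume "h \<in> {(\<lambda>x. f x + g x) | f g. smooth f \<and> smooth g}"
  then show "h differentiable (at x)"
    by (auto simp: smooth_differentiable intro!: derivative_intros)
next
  fix h :: "real^'n \<Rightarrow> 'b" and k
  assume "h \<in> {(\<lambda>x. f x + g x) | f g. smooth f \<and> smooth g}"
  then obtain f g where h: "h = (\<lambda>x. f x + g x)" and s: "smooth f" "smooth g"
    by blast
  have "partial_deriv k h = (\<lambda>x. partial_deriv k f x + partial_deriv k g x)"
    unfolding h by (rule ext) (simp add: partial_deriv_add s smooth_differentiable)
  then show "partial_deriv k h \<in> {(\<lambda>x. f x + g x) | f g. smooth f \<and> smooth g}"
    using s smooth_partial_deriv by blast
qed

lemma partial_derivs_add: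
  assumes "smooth f" "smooth g"
  shows "partial_derivs ks (\<lambda>x. f x + g x) = (\<lambda>x. partial_derivs ks f x + partial_derivs ks g x)"
proof (induction ks)
  case (Cons k ks)
  show ?case
    by (rule ext) (simp add: Cons partial_deriv_add assms smooth_partial_derivs smooth_differentiable)
qed simp

lemma partial_derivs_linear:
  assumes "bounded_linear L" "smooth f"
  shows "partial_derivs ks (\<lambda>x. L (f x)) = (\<lambda>x. L (partial_derivs ks f x))"
proof (induction ks)
  case (Cons k ks)
  show ?case
    by (rule ext) (simp add: Cons partial_deriv_linear assms smooth_partial_derivs smooth_differentiable)
qed simp

lemma smooth_linear:
  assumes "bounded_linear L" "smooth f"
  shows "smooth (\<lambda>x. L (f x))"
  unfolding smooth_def partial_derivs_linear[OF assms]
  by (intro allI, rule differentiable_compose[OF bounded_linear_imp_differentiable[OF assms(1)]])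
    (simp add: smooth_differentiable smooth_partial_derivs assms)

lemma partial_derivs_affine:
  fixes f :: "real^'n::finite \<Rightarrow> 'b::real_normed_vector"
  assumes "smooth f"
  shows "partial_derivs ks (\<lambda>x. f (a *\<^sub>R x + b)) = (\<lambda>x. a ^ length ks *\<^sub>R partial_derivs ks f (a *\<^sub>R x + b))"
proof (induction ks)
  case (Cons k ks)
  have d: "(\<lambda>x. partial_derivs ks f (a *\<^sub>R x + b)) differentiable (at x)" for x
    by (rule differentiable_compose)
      (auto intro!: derivative_intros smooth_differentiable smooth_partial_derivs assms)
  show ?case
    by (rule ext)
      (simp add: Cons partial_deriv_affine assms smooth_partial_derivs smooth_differentiable d
        partial_deriv_linear[OF bounded_linear_scaleR_right d] mult.commute)
qed simp

lemma smooth_affine: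
  fixes f :: "real^'n::finite \<Rightarrow> 'b::real_normed_vector"
  assumes "smooth f"
  shows "smooth (\<lambda>x. f (a *\<^sub>R x + b))"
proof -
  have "(\<lambda>x. partial_derivs ks f (a *\<^sub>R x + b)) differentiable (at x)" for x ks
    by (rule differentiable_compose)
      (auto intro!: derivative_intros smooth_differentiable smooth_partial_derivs assms)
  then show ?thesis
    unfolding smooth_def partial_derivs_affine[OF assms] by (auto intro!: derivative_intros)
qed

text \<open>The derivative of a product is a sum of two products, so a set that is to serve in
  \<open>smooth_coinduct\<close> for products must also be closed under sums.\<close>

inductive_set product_sums :: "(real^'n::finite \<Rightarrow> 'b::real_normed_algebra) set" where
  "smooth f \<Longrightarrow> smooth g \<Longrightarrow> (\<lambda>x. f x * g x) \<in> product_sums"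
| "a \<in> product_sums \<Longrightarrow> b \<in> product_sums \<Longrightarrow> (\<lambda>x. a x + b x) \<in> product_sums"

lemma smooth_mult:
  fixes f g :: "real^'n::finite \<Rightarrow> 'b::real_normed_algebra"
  assumes "smooth f" "smooth g"
  shows "smooth (\<lambda>x. f x * g x)"
proof (rule smooth_coinduct)
  show "(\<lambda>x. f x * g x) \<in> product_sums"
    using assms by (rule product_sums.intros)
  have diff: "h differentiable (at x)" if "h \<in> product_sums" for h :: "real^'n \<Rightarrow> 'b" and x
    using that by induction (auto simp: smooth_differentiable intro!: derivative_intros)
  then show "h differentiable (at x)" if "h \<in> product_sums" for h :: "real^'n \<Rightarrow> 'b" and x
    using that .
  show "partial_deriv k h \<in> product_sums" if "h \<in> product_sums" for h :: "real^'n \<Rightarrow> 'b" and k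
    using that
  proof induction
    case (1 f g)
    have "partial_deriv k (\<lambda>x. f x * g x) = (\<lambda>x. f x * partial_deriv k g x + partial_deriv k f x * g x)"
      by (rule ext) (simp add: partial_deriv_mult 1 smooth_differentiable)
    then show ?case
      using 1 by (auto intro!: product_sums.intros smooth_partial_deriv)
  next
    case (2 a b)
    have "partial_deriv k (\<lambda>x. a x + b x) = (\<lambda>x. partial_deriv k a x + partial_deriv k b x)"
      by (rule ext) (simp add: partial_deriv_add diff 2)
    then show ?case
      using 2 by (auto intro!: product_sums.intros)
  qed
qed

lemma partial_derivs_const: "ks \<noteq> [] \<Longrightarrow> partial_derivs ks (\<lambda>x. c) = (\<lambda>x. 0)"
proof (induction ks)
  case (Cons k ks)
  then show ?case by (cases "ks = []") auto
qed simp

lemma has_derivative_vec_nth_of_real: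
  "((\<lambda>x::real^'n::finite. complex_of_real (x $ l)) has_derivative (\<lambda>x. complex_of_real (x $ l))) (at x)"
  by (intro bounded_linear_imp_has_derivative bounded_linear_compose[OF bounded_linear_of_real]
      bounded_linear_vec_nth)

lemma partial_deriv_coordinate:
  "partial_deriv k (\<lambda>x::real^'n::finite. complex_of_real (x $ l)) = (\<lambda>x. if k = l then 1 else 0)"
  by (rule ext) (simp add: partial_deriv_eq[OF has_derivative_vec_nth_of_real] axis_def)

lemma smooth_coordinate: "smooth (\<lambda>x::real^'n::finite. complex_of_real (x $ l))"
proof (rule smooth_coinduct[where X = "insert (\<lambda>x::real^'n::finite. complex_of_real (x $ l)) (range (\<lambda>c x. c))"])
  fix f :: "real^'n \<Rightarrow> complex" and k
  assume "f \<in> insert (\<lambda>x. complex_of_real (x $ l)) (range (\<lambda>c x. c))"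
  then consider "f = (\<lambda>x. complex_of_real (x $ l))" | c where "f = (\<lambda>x. c)"
    by blast
  then show "partial_deriv k f \<in> insert (\<lambda>x. complex_of_real (x $ l)) (range (\<lambda>c x. c))"
    by cases (auto simp: partial_deriv_coordinate)
next
  fix f :: "real^'n \<Rightarrow> complex" and x
  assume "f \<in> insert (\<lambda>x. complex_of_real (x $ l)) (range (\<lambda>c x. c))"
  then show "f differentiable (at x)"
    using differentiableI[OF has_derivative_vec_nth_of_real] by auto
qed simp

section \<open>Families of Schwartz functions\<close>

text \<open>Schwartz bounds that are uniform in the index and proportional to
  \<open>\<epsilon> i\<close>. For a constant family with \<open>\<epsilon> = 1\<close> this is
  membership in \<open>schwartz\<close>; for \<open>\<epsilon> m = 1 / 2 ^ m\<close> it is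
  convergence to 0 in the Schwartz space at a geometric rate. Each closure property is thus proved
  once for both uses.\<close>

definition schw_fam :: "('i \<Rightarrow> real) \<Rightarrow> ('i \<Rightarrow> real^'n::finite \<Rightarrow> complex) \<Rightarrow> bool" where
  "schw_fam \<epsilon> \<eta> \<longleftrightarrow> (\<forall>i. smooth (\<eta> i)) \<and>
     (\<forall>ks N. \<exists>C. \<forall>i x. (1 + norm x) ^ N * norm (partial_derivs ks (\<eta> i) x) \<le> C * \<epsilon> i)"

text \<open>Uniform families of slowly increasing functions, the natural multipliers of Schwartz
  families. The exponent \<open>M\<close> may depend on the derivative but not on the index.\<close>

definition poly_fam :: "('i \<Rightarrow> real^'n::finite \<Rightarrow> complex) \<Rightarrow> bool" where
  "poly_fam \<mu> \<longleftrightarrow> (\<forall>i. smooth (\<mu> i)) \<and>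
     (\<forall>ks. \<exists>C M. \<forall>i x. norm (partial_derivs ks (\<mu> i) x) \<le> C * (1 + norm x) ^ M)"

lemma schw_fam_smooth: "schw_fam \<epsilon> \<eta> \<Longrightarrow> smooth (\<eta> i)"
  by (simp add: schw_fam_def)

lemma schw_famE:
  assumes "schw_fam \<epsilon> \<eta>" "\<And>i. \<epsilon> i \<ge> 0"
  obtains C where "C \<ge> 0"
    "\<And>i x. (1 + norm x) ^ N * norm (partial_derivs ks (\<eta> i) x) \<le> C * \<epsilon> i"
proof -
  obtain C where C: "\<forall>i x. (1 + norm x) ^ N * norm (partial_derivs ks (\<eta> i) x) \<le> C * \<epsilon> i"
    using assms unfolding schw_fam_def by blast
  have "C * \<epsilon> i \<le> \<bar>C\<bar> * \<epsilon> i" for i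
    using assms(2) by (simp add: mult_right_mono)
  then show ?thesis
    using C that[of "\<bar>C\<bar>"] by (meson abs_ge_zero order_trans)
qed

lemma schw_fam_partial_deriv:
  assumes "schw_fam \<epsilon> \<eta>"
  shows "schw_fam \<epsilon> (\<lambda>i. partial_deriv k (\<eta> i))"
proof -
  have "partial_derivs ks (partial_deriv k (\<eta> i)) = partial_derivs (ks @ [k]) (\<eta> i)" for ks i
    by (simp add: partial_derivs_append)
  then show ?thesis
    using assms unfolding schw_fam_def by (simp add: smooth_partial_deriv)
qed

lemma schw_fam_add:
  assumes "schw_fam \<epsilon> \<eta>" "schw_fam \<epsilon> \<zeta>"
  shows "schw_fam \<epsilon> (\<lambda>i x. \<eta> i x + \<zeta> i x)"
  unfolding schw_fam_def
proof (intro conjI allI)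
  have s: "smooth (\<eta> i)" "smooth (\<zeta> i)" for i
    by (rule assms[THEN schw_fam_smooth])+
  then show "smooth (\<lambda>x. \<eta> i x + \<zeta> i x)" for i
    by (rule smooth_add)
  fix ks N
  obtain C D where C: "\<And>i x. (1 + norm x) ^ N * norm (partial_derivs ks (\<eta> i) x) \<le> C * \<epsilon> i"
    and D: "\<And>i x. (1 + norm x) ^ N * norm (partial_derivs ks (\<zeta> i) x) \<le> D * \<epsilon> i"
    using assms unfolding schw_fam_def by meson
  have "(1 + norm x) ^ N * norm (partial_derivs ks (\<lambda>x. \<eta> i x + \<zeta> i x) x) \<le> (C + D) * \<epsilon> i" for i x
  proof -
    have "(1 + norm x) ^ N * norm (partial_derivs ks (\<lambda>x. \<eta> i x + \<zeta> i x) x)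
        \<le> (1 + norm x) ^ N * (norm (partial_derivs ks (\<eta> i) x) + norm (partial_derivs ks (\<zeta> i) x))"
      by (intro mult_left_mono) (auto simp: partial_derivs_add s norm_triangle_ineq)
    then show ?thesis
      using C[of x i] D[of x i] by (simp add: algebra_simps)
  qed
  then show "\<exists>C. \<forall>i x. (1 + norm x) ^ N * norm (partial_derivs ks (\<lambda>x. \<eta> i x + \<zeta> i x) x) \<le> C * \<epsilon> i"
    by blast
qed

lemma poly_fam_partial_deriv:
  assumes "poly_fam \<mu>"
  shows "poly_fam (\<lambda>i. partial_deriv k (\<mu> i))"
proof -
  have "partial_derivs ks (partial_deriv k (\<mu> i)) = partial_derivs (ks @ [k]) (\<mu> i)" for ks i
    by (simp add: partial_derivs_append)
  then show ?thesis
    using assms unfolding poly_fam_def by (simp add: smooth_partial_deriv)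
qed

text \<open>The Leibniz rule is avoided by generalising over all pairs of families and peeling off the
  innermost derivative.\<close>

lemma schw_fam_mult:
  assumes "poly_fam \<mu>" "schw_fam \<epsilon> \<eta>" "\<And>i. \<epsilon> i \<ge> 0"
  shows "schw_fam \<epsilon> (\<lambda>i x. \<mu> i x * \<eta> i x)"
  unfolding schw_fam_def
proof (intro conjI allI)
  fix i show "smooth (\<lambda>x. \<mu> i x * \<eta> i x)"
    using assms by (simp add: poly_fam_def schw_fam_def smooth_mult)
next
  fix ks N
  show "\<exists>C. \<forall>i x. (1 + norm x) ^ N * norm (partial_derivs ks (\<lambda>x. \<mu> i x * \<eta> i x) x) \<le> C * \<epsilon> i"
    using assms(1,2)
  proof (induction ks arbitrary: \<mu> \<eta> rule: rev_induct)
    case Nil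
    obtain C M where C: "\<And>i x. norm (\<mu> i x) \<le> C * (1 + norm x) ^ M"
      using Nil(1) unfolding poly_fam_def by (metis partial_derivs.simps(1))
    obtain D where D: "D \<ge> 0" "\<And>i x. (1 + norm x) ^ (N + M) * norm (\<eta> i x) \<le> D * \<epsilon> i"
      using schw_famE[OF Nil(2) assms(3), where ks = "[]" and N = "N + M"] by auto
    have "(1 + norm x) ^ N * norm (\<mu> i x * \<eta> i x) \<le> \<bar>C\<bar> * D * \<epsilon> i" for i x
    proof -
      have "norm (\<mu> i x) \<le> \<bar>C\<bar> * (1 + norm x) ^ M"
        using C[of i x] by (rule order_trans) (simp add: mult_right_mono)
      then have "(1 + norm x) ^ N * norm (\<mu> i x * \<eta> i x)
          \<le> (1 + norm x) ^ N * ((\<bar>C\<bar> * (1 + norm x) ^ M) * norm (\<eta> i x))"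
        by (simp add: norm_mult mult_left_mono mult_right_mono)
      also have "\<dots> = \<bar>C\<bar> * ((1 + norm x) ^ (N + M) * norm (\<eta> i x))"
        by (simp add: power_add mult_ac)
      also have "\<dots> \<le> \<bar>C\<bar> * (D * \<epsilon> i)"
        by (intro mult_left_mono D(2)) simp
      finally show ?thesis by (simp add: mult_ac)
    qed
    then show ?case by auto
  next
    case (snoc k ks)
    have s: "smooth (\<mu> i)" "smooth (\<eta> i)" for i
      using snoc.prems by (auto simp: poly_fam_def schw_fam_def)
    have eq: "partial_derivs (ks @ [k]) (\<lambda>x. \<mu> i x * \<eta> i x) =
      (\<lambda>x. partial_derivs ks (\<lambda>x. \<mu> i x * partial_deriv k (\<eta> i) x) x +
           partial_derivs ks (\<lambda>x. partial_deriv k (\<mu> i) x * \<eta> i x) x)" for i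
    proof -
      have "partial_deriv k (\<lambda>x. \<mu> i x * \<eta> i x) =
          (\<lambda>x. \<mu> i x * partial_deriv k (\<eta> i) x + partial_deriv k (\<mu> i) x * \<eta> i x)"
        by (rule ext) (simp add: partial_deriv_mult s smooth_differentiable)
      then show ?thesis
        by (simp add: partial_derivs_append partial_derivs_add smooth_mult smooth_partial_deriv s)
    qed
    obtain C where C: "\<forall>i x. (1 + norm x) ^ N *
        norm (partial_derivs ks (\<lambda>x. \<mu> i x * partial_deriv k (\<eta> i) x) x) \<le> C * \<epsilon> i"
      using snoc.IH[OF snoc.prems(1) schw_fam_partial_deriv[OF snoc.prems(2), of k]] by blast
    obtain D where D: "\<forall>i x. (1 + norm x) ^ N *
        norm (partial_derivs ks (\<lambda>x. partial_deriv k (\<mu> i) x * \<eta> i x) x) \<le> D * \<epsilon> i"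
      using snoc.IH[OF poly_fam_partial_deriv[OF snoc.prems(1), of k] snoc.prems(2)] by blast
    have "(1 + norm x) ^ N * norm (partial_derivs (ks @ [k]) (\<lambda>x. \<mu> i x * \<eta> i x) x) \<le> (C + D) * \<epsilon> i" for i x
    proof -
      have "(1 + norm x) ^ N * norm (partial_derivs (ks @ [k]) (\<lambda>x. \<mu> i x * \<eta> i x) x)
        \<le> (1 + norm x) ^ N * (norm (partial_derivs ks (\<lambda>x. \<mu> i x * partial_deriv k (\<eta> i) x) x)
           + norm (partial_derivs ks (\<lambda>x. partial_deriv k (\<mu> i) x * \<eta> i x) x))"
        unfolding eq by (intro mult_left_mono norm_triangle_ineq) simp
      then show ?thesis
        using C[rule_format, of x i] D[rule_format, of x i] by (simp add: algebra_simps)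
    qed
    then show ?case by blast
  qed
qed

lemma poly_fam_const: "bounded (range c) \<Longrightarrow> poly_fam (\<lambda>i x. c i)"
proof -
  assume "bounded (range c)"
  then obtain B where B: "\<And>i. norm (c i) \<le> B"
    by (auto simp: bounded_iff)
  have "\<exists>C M. \<forall>i x. norm (partial_derivs ks (\<lambda>x::real^'b. c i) x) \<le> C * (1 + norm x) ^ M" for ks :: "'b list"
  proof (cases "ks = []")
    case True
    then show ?thesis using B by (intro exI[of _ B] exI[of _ 0]) auto
  next
    case False
    then show ?thesis by (intro exI[of _ 0]) (auto simp: partial_derivs_const)
  qed
  then show ?thesis by (auto simp: poly_fam_def smooth_const)
qed

lemma poly_fam_coordinate: "poly_fam (\<lambda>i x. complex_of_real (x $ l))"
proof -
  have "\<exists>C M. \<forall>x. norm (partial_derivs ks (\<lambda>x::real^'b. complex_of_real (x $ l)) x) \<le> C * (1 + norm x) ^ M"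
    for ks :: "'b list" and l
  proof (cases ks rule: rev_cases)
    case Nil
    have "\<bar>x $ l\<bar> \<le> 1 + norm x" for x :: "real^'b"
      using component_le_norm_cart[of x l] by simp
    then show ?thesis by (intro exI[of _ 1]) (auto simp: Nil intro!: exI[of _ 1])
  next
    case (snoc ls k)
    show ?thesis
    proof (cases "ls = []")
      case True
      then show ?thesis
        by (intro exI[of _ 1] exI[of _ 0]) (auto simp: snoc partial_deriv_coordinate)
    next
      case False
      then show ?thesis
        by (intro exI[of _ 0])
          (simp add: snoc partial_derivs_append partial_deriv_coordinate partial_derivs_const)
    qed
  qed
  then show ?thesis by (auto simp: poly_fam_def smooth_coordinate)
qed

lemma schw_fam_cmult:
  assumes "schw_fam \<epsilon> \<eta>" "\<And>i. \<epsilon> i \<ge> 0"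
  shows "schw_fam \<epsilon> (\<lambda>i x. c * \<eta> i x)"
  by (rule schw_fam_mult[OF poly_fam_const assms]) simp

text \<open>The seminorm of order m uses the same m for the power of the weight and for the number
  of derivatives. A given pair \<open>N\<close>, \<open>ks\<close> is dominated by the order
  \<open>max N (length ks)\<close>; conversely only finitely many lists \<open>ks\<close> have
  length at most m, so their individual bounds can be added up.\<close>

lemma schwartz_iff:
  fixes \<eta> :: "real^'n::finite \<Rightarrow> complex"
  shows
  "\<eta> \<in> schwartz \<longleftrightarrow> smooth \<eta> \<and>
     (\<forall>ks N. \<exists>C. \<forall>x. (1 + norm x) ^ N * norm (partial_derivs ks \<eta> x) \<le> C)"
proof -
  have 1: "\<exists>C. \<forall>x. (1 + norm x) ^ N * norm (partial_derivs ks \<eta> x) \<le> C"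
    if fin: "\<forall>m. schwartz_seminorm m \<eta> < \<infinity>" for ks N
  proof -
    define m where "m = max N (length ks)"
    obtain C where C: "C \<ge> 0" "schwartz_seminorm m \<eta> = ennreal C"
      using fin[rule_format, of m] by (cases "schwartz_seminorm m \<eta>") auto
    have "(1 + norm x) ^ N * norm (partial_derivs ks \<eta> x) \<le> C" for x
    proof -
      have "ennreal ((1 + norm x) ^ m * norm (partial_derivs ks \<eta> x)) \<le> schwartz_seminorm m \<eta>"
        unfolding schwartz_seminorm_def
        by (rule SUP_upper2[of ks]) (auto simp: m_def intro: SUP_upper)
      then have "(1 + norm x) ^ m * norm (partial_derivs ks \<eta> x) \<le> C"
        using C by (simp add: ennreal_le_iff)
      moreover have "(1 + norm x) ^ N \<le> (1 + norm x) ^ m"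
        by (rule power_increasing) (auto simp: m_def)
      ultimately show ?thesis
        by (meson mult_right_mono norm_ge_zero order_trans)
    qed
    then show ?thesis by blast
  qed
  have 2: "schwartz_seminorm m \<eta> < \<infinity>"
    if "\<forall>ks N. \<exists>C. \<forall>x. (1 + norm x) ^ N * norm (partial_derivs ks \<eta> x) \<le> C" for m
  proof -
    have "\<exists>C. \<forall>ks N x. (1 + norm x) ^ N * norm (partial_derivs ks \<eta> x) \<le> C ks N"
      by (intro choice allI) (use that in blast)
    then obtain C where C: "\<And>ks N x. (1 + norm x) ^ N * norm (partial_derivs ks \<eta> x) \<le> C ks N"
      by blast
    have fin: "finite {ks :: 'n list. length ks \<le> m}"
      using finite_lists_length_le[of "UNIV :: 'n set" m] by simp
    have "schwartz_seminorm m \<eta> \<le> ennreal (\<Sum>ks | length ks \<le> m. \<bar>C ks m\<bar>)"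
      unfolding schwartz_seminorm_def
    proof (intro SUP_least ennreal_leI)
      fix ks :: "'n list" and x assume ks: "ks \<in> {ks. length ks \<le> m}"
      have "(1 + norm x) ^ m * norm (partial_derivs ks \<eta> x) \<le> \<bar>C ks m\<bar>"
        using C[where N = m and x = x and ks = ks] by linarith
      also have "\<dots> \<le> (\<Sum>ks | length ks \<le> m. \<bar>C ks m\<bar>)"
        by (rule member_le_sum[OF ks]) (use fin in auto)
      finally show "(1 + norm x) ^ m * norm (partial_derivs ks \<eta> x) \<le> (\<Sum>ks | length ks \<le> m. \<bar>C ks m\<bar>)" .
    qed
    then show ?thesis
      by (simp add: order_le_less_trans)
  qed
  show ?thesis
    unfolding schwartz_def using 1 2 by blast
qed

lemma schwartz_iff_schw_fam: "\<eta> \<in> schwartz \<longleftrightarrow> schw_fam (\<lambda>i::'i. 1) (\<lambda>i. \<eta>)"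
  by (simp add: schwartz_iff schw_fam_def)

lemma schw_fam_schwartz:
  assumes "schw_fam \<epsilon> \<eta>"
  shows "\<eta> i \<in> schwartz"
  using assms unfolding schwartz_iff schw_fam_def by metis

lemma schwartz_smooth: "\<eta> \<in> schwartz \<Longrightarrow> smooth \<eta>"
  by (simp add: schwartz_def)

text \<open>The form in which the continuity of a distribution is used below: finitely many of the
  family bounds add up to a bound on the one seminorm that controls \<open>u\<close>.\<close>

lemma tempered_schw_fam:
  fixes \<eta> :: "'i \<Rightarrow> real^'n::finite \<Rightarrow> complex"
  assumes u: "u \<in> tempered_distributions" and \<eta>: "schw_fam \<epsilon> \<eta>" and \<epsilon>: "\<And>i. \<epsilon> i \<ge> 0"
  obtains C where "\<And>i. norm (u (\<eta> i)) \<le> C * \<epsilon> i"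
proof -
  obtain m B where B: "\<And>\<phi>. \<phi> \<in> schwartz \<Longrightarrow>
      ennreal (norm (u \<phi>)) \<le> ennreal B * schwartz_seminorm m \<phi>"
    using u unfolding tempered_distributions_def by blast
  have "\<exists>C. \<forall>ks N. C ks N \<ge> 0 \<and>
      (\<forall>i x. (1 + norm x) ^ N * norm (partial_derivs ks (\<eta> i) x) \<le> C ks N * \<epsilon> i)"
    by (intro choice allI) (metis schw_famE[OF \<eta> \<epsilon>])
  then obtain C where C0: "\<And>ks N. C ks N \<ge> 0"
    and C: "\<And>ks N i x. (1 + norm x) ^ N * norm (partial_derivs ks (\<eta> i) x) \<le> C ks N * \<epsilon> i"
    by blast
  define D where "D = (\<Sum>ks | length ks \<le> m. C ks m)"
  have D0: "D \<ge> 0" by (simp add: D_def C0 sum_nonneg)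
  have fin: "finite {ks :: 'n list. length ks \<le> m}"
    using finite_lists_length_le[of "UNIV :: 'n set" m] by simp
  have "schwartz_seminorm m (\<eta> i) \<le> ennreal (D * \<epsilon> i)" for i
    unfolding schwartz_seminorm_def
  proof (intro SUP_least ennreal_leI)
    fix ks :: "'n list" and x assume ks: "ks \<in> {ks. length ks \<le> m}"
    have "C ks m \<le> D"
      unfolding D_def by (rule member_le_sum[OF ks]) (use fin C0 in auto)
    then show "(1 + norm x) ^ m * norm (partial_derivs ks (\<eta> i) x) \<le> D * \<epsilon> i"
      using C[where N = m and ks = ks and x = x and i = i] \<epsilon>[of i] by (meson mult_right_mono order_trans)
  qed
  then have "ennreal (norm (u (\<eta> i))) \<le> ennreal \<bar>B\<bar> * ennreal (D * \<epsilon> i)" for i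
    using B[OF schw_fam_schwartz[OF \<eta>, of i]] 
    by (meson abs_ge_self ennreal_leI mult_mono order_trans zero_le)
  then have *: "ennreal (norm (u (\<eta> i))) \<le> ennreal ((\<bar>B\<bar> * D) * \<epsilon> i)" for i
    by (metis ennreal_mult' abs_ge_zero mult.assoc)
  have "norm (u (\<eta> i)) \<le> (\<bar>B\<bar> * D) * \<epsilon> i" for i
    using *[of i] D0 \<epsilon>[of i] by (subst (asm) ennreal_le_iff) auto
  then show ?thesis using that by blast
qed

section \<open>Test functions: supports, decay and closure properties\<close>

lemma smooth_of_real:
  fixes \<psi> :: "real^'n::finite \<Rightarrow> real"
  assumes "smooth \<psi>"
  shows "smooth (\<lambda>x. complex_of_real (\<psi> x))"
  by (rule smooth_linear[OF bounded_linear_of_real assms])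

lemma test_functions_of_real:
  fixes \<psi> :: "real^'n::finite \<Rightarrow> real"
  assumes "\<psi> \<in> test_functions"
  shows "(\<lambda>x. complex_of_real (\<psi> x)) \<in> test_functions"
  using assms by (simp add: test_functions_def smooth_of_real)

lemma partial_deriv_support:
  "closure {x. partial_deriv k f x \<noteq> 0} \<subseteq> closure {x. f x \<noteq> 0}"
proof (rule closure_minimal)
  show "{x. partial_deriv k f x \<noteq> 0} \<subseteq> closure {x. f x \<noteq> 0}"
  proof (rule subsetI, rule ccontr)
    fix x assume x: "x \<in> {x. partial_deriv k f x \<noteq> 0}" "x \<notin> closure {x. f x \<noteq> 0}"
    have "(f has_derivative (\<lambda>h. 0)) (at x)"
    proof (rule has_derivative_transform_within_open)
      show "((\<lambda>x. 0) has_derivative (\<lambda>h. 0)) (at x)" by simp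
      show "open (- closure {x. f x \<noteq> 0})" "x \<in> - closure {x. f x \<noteq> 0}"
        using x by auto
      show "0 = f y" if "y \<in> - closure {x. f x \<noteq> 0}" for y
        using that closure_subset[of "{x. f x \<noteq> 0}"] by auto
    qed
    then show False
      using partial_deriv_eq x by fastforce
  qed
qed simp

lemma partial_derivs_support:
  "closure {x. partial_derivs ks f x \<noteq> 0} \<subseteq> closure {x. f x \<noteq> 0}"
proof (induction ks)
  case (Cons k ks)
  then show ?case
    using partial_deriv_support[of k "partial_derivs ks f"] by simp
qed simp

text \<open>A single constant serves both as a bound for the values and as a radius for the
  support.\<close>

lemma test_function_derivs_bounded:
  fixes f :: "real^'n::finite \<Rightarrow> 'b::real_normed_vector"
  assumes "f \<in> test_functions"
  obtains C where "C \<ge> 0" "\<And>x. norm (partial_derivs ks f x) \<le> C"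
    "\<And>x. norm (partial_derivs ks f x) \<noteq> 0 \<Longrightarrow> norm x \<le> C"
proof -
  let ?g = "partial_derivs ks f"
  let ?K = "closure {x. f x \<noteq> 0}"
  have K: "compact ?K" and s: "smooth ?g"
    using assms by (auto simp: test_functions_def smooth_partial_derivs)
  have supp: "x \<in> ?K" if "?g x \<noteq> 0" for x
    using that partial_derivs_support[of ks f] closure_subset[of "{x. ?g x \<noteq> 0}"] by blast
  have "bounded (?g ` ?K)"
    by (intro compact_imp_bounded compact_continuous_image K
        continuous_on_subset[OF smooth_continuous_on[OF s]]) simp
  then obtain C where C: "\<And>x. x \<in> ?K \<Longrightarrow> norm (?g x) \<le> C"
    by (auto simp: bounded_iff)
  obtain R where R: "\<And>x. x \<in> ?K \<Longrightarrow> norm x \<le> R"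
    using compact_imp_bounded[OF K] unfolding bounded_iff by blast
  show ?thesis
  proof
    show "norm (?g x) \<le> \<bar>C\<bar> + \<bar>R\<bar>" for x
    proof (cases "?g x = 0")
      case False then show ?thesis using C[OF supp[OF False]] by linarith
    qed simp
    show "norm x \<le> \<bar>C\<bar> + \<bar>R\<bar>" if "norm (?g x) \<noteq> 0" for x
      using R[OF supp, of x] that by force
  qed simp
qed

lemma test_functions_schwartz: "test_functions \<subseteq> schwartz"
proof
  fix f :: "real^'n \<Rightarrow> complex" assume f: "f \<in> test_functions"
  have "\<exists>C. \<forall>x. (1 + norm x) ^ N * norm (partial_derivs ks f x) \<le> C" for ks N
  proof -
    obtain C where C: "C \<ge> 0" "\<And>x. norm (partial_derivs ks f x) \<le> C"
      "\<And>x. norm (partial_derivs ks f x) \<noteq> 0 \<Longrightarrow> norm x \<le> C"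
      using test_function_derivs_bounded[OF f, of ks] by blast
    have "(1 + norm x) ^ N * norm (partial_derivs ks f x) \<le> (1 + C) ^ N * C" for x
    proof (cases "norm (partial_derivs ks f x) = 0")
      case False
      then show ?thesis
        using C by (intro mult_mono power_mono) auto
    qed (use C in simp)
    then show ?thesis by blast
  qed
  then show "f \<in> schwartz"
    using f by (simp add: schwartz_iff test_functions_def)
qed

lemma poly_fam_test_function:
  assumes "f \<in> test_functions"
  shows "poly_fam (\<lambda>i. f)"
  unfolding poly_fam_def
proof (intro conjI allI)
  fix ks
  obtain C where C: "\<And>x. norm (partial_derivs ks f x) \<le> C"
    by (rule test_function_derivs_bounded[OF assms, of ks]) (rule that)
  then show "\<exists>C M. \<forall>i x. norm (partial_derivs ks f x) \<le> C * (1 + norm x) ^ M"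
    by (intro exI[of _ C] exI[of _ 0]) auto
qed (use assms test_functions_def in auto)

lemma schwartz_mult:
  assumes "f \<in> test_functions" "\<eta> \<in> schwartz"
  shows "(\<lambda>x. f x * \<eta> x) \<in> schwartz"
  \<comment> \<open>A single function is a family indexed by \<open>unit\<close> with bound 1; the
    same device specialises the other family lemmas.\<close>
  using schw_fam_mult[OF poly_fam_test_function[OF assms(1)], of "\<lambda>i::unit. 1" "\<lambda>i. \<eta>"] assms(2)
  by (simp add: schwartz_iff_schw_fam[symmetric])

lemma schwartz_add:
  assumes "\<eta> \<in> schwartz" "\<zeta> \<in> schwartz"
  shows "(\<lambda>x. \<eta> x + \<zeta> x) \<in> schwartz"
  using schw_fam_add[of "\<lambda>i::unit. 1" "\<lambda>i. \<eta>" "\<lambda>i. \<zeta>"] assms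
  by (simp add: schwartz_iff_schw_fam[symmetric])

lemma schwartz_cmult:
  assumes "\<eta> \<in> schwartz"
  shows "(\<lambda>x. c * \<eta> x) \<in> schwartz"
  using schw_fam_cmult[of "\<lambda>i::unit. 1" "\<lambda>i. \<eta>"] assms
  by (simp add: schwartz_iff_schw_fam[symmetric])

lemma test_functions_dilation:
  fixes f :: "real^'n::finite \<Rightarrow> 'b::real_normed_vector"
  assumes "f \<in> test_functions" "a \<noteq> 0"
  shows "(\<lambda>x. f (a *\<^sub>R x + b)) \<in> test_functions"
proof -
  obtain R where R: "\<And>x. f x \<noteq> 0 \<Longrightarrow> norm x \<le> R"
    using test_function_derivs_bounded[OF assms(1), of "[]"] by (metis norm_eq_zero partial_derivs.simps(1))
  have "norm x \<le> (R + norm b) / \<bar>a\<bar>" if "f (a *\<^sub>R x + b) \<noteq> 0" for x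
  proof -
    have "norm (a *\<^sub>R x) \<le> norm (a *\<^sub>R x + b) + norm b"
      using norm_triangle_ineq4[of "a *\<^sub>R x + b" b] by simp
    then show ?thesis
      using R[OF that] assms(2) by (simp add: field_simps)
  qed
  then have "bounded {x. f (a *\<^sub>R x + b) \<noteq> 0}"
    by (auto simp: bounded_iff)
  then show ?thesis
    using assms by (simp add: test_functions_def smooth_affine compact_closure)
qed

section \<open>The cutoff and its dilations as frequency filters\<close>

lemma cutoffD:
  assumes "cutoff \<psi>"
  shows "\<psi> \<in> test_functions" "0 \<le> \<psi> x" "\<psi> x \<le> 1" "norm x < 6/5 \<Longrightarrow> \<psi> x = 1"
    "norm x \<ge> 3/2 \<Longrightarrow> \<psi> x = 0"
proof -
  have *: "indicator (ball 0 (6/5)) x \<le> \<psi> x" "\<psi> x \<le> indicator (ball 0 (3/2)) x" for x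
    using assms by (auto simp: cutoff_def)
  show "\<psi> \<in> test_functions" using assms by (simp add: cutoff_def)
  show "0 \<le> \<psi> x" using *(1)[of x] by (rule order_trans[rotated]) (simp add: indicator_def)
  show "\<psi> x \<le> 1" using *(2)[of x] by (rule order_trans) (simp add: indicator_def)
  show "norm x < 6/5 \<Longrightarrow> \<psi> x = 1" using *[of x] by (auto simp: indicator_def split: if_splits)
  show "norm x \<ge> 3/2 \<Longrightarrow> \<psi> x = 0" using *[of x] \<open>0 \<le> \<psi> x\<close> by (auto simp: indicator_def split: if_splits)
qed

text \<open>The dyadic functions telescope: \<open>low_pass \<psi> m\<close> is the sum of the
  blocks 0 to m.\<close>

definition low_pass :: "(real^'n::finite \<Rightarrow> real) \<Rightarrow> nat \<Rightarrow> real^'n \<Rightarrow> complex" where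
  "low_pass \<psi> m \<xi> = complex_of_real (\<psi> ((1 / 2 ^ m) *\<^sub>R \<xi>))"

lemma low_pass_test_function:
  assumes "cutoff \<psi>"
  shows "low_pass \<psi> m \<in> test_functions"
  using test_functions_dilation[OF test_functions_of_real[OF cutoffD(1)[OF assms]], of "1 / 2 ^ m" 0]
  by (simp add: low_pass_def[abs_def])

text \<open>Where \<open>1 - \<psi>(2\<^sup>-\<^sup>m\<xi>)\<close> does not vanish, \<open>2\<^sup>m\<close> is at most \<open>1 + |\<xi>|\<close>, so the scaled family
  is still polynomially bounded; this encodes the convergence of the low-pass multipliers to 1.\<close>

lemma poly_fam_high_pass:
  fixes \<psi> :: "real^'n::finite \<Rightarrow> real"
  assumes "cutoff \<psi>"
  shows "poly_fam (\<lambda>m \<xi>. 2 ^ m * (1 - low_pass \<psi> m \<xi>))"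
  unfolding poly_fam_def
proof (intro conjI allI)
  have s: "smooth (low_pass \<psi> m)" for m
    using low_pass_test_function[OF assms] by (simp add: test_functions_def)
  have eq: "(\<lambda>\<xi>. 2 ^ m * (1 - low_pass \<psi> m \<xi>)) = (\<lambda>\<xi>. 2 ^ m + (- (2 ^ m)) * low_pass \<psi> m \<xi>)" for m
    by (auto simp: algebra_simps)
  fix m show "smooth (\<lambda>\<xi>. 2 ^ m * (1 - low_pass \<psi> m \<xi>))"
    unfolding eq by (intro smooth_add smooth_mult smooth_const s)
next
  fix ks :: "'n list"
  have s: "smooth (low_pass \<psi> m)" for m
    using low_pass_test_function[OF assms] by (simp add: test_functions_def)
  have eq: "(\<lambda>\<xi>. 2 ^ m * (1 - low_pass \<psi> m \<xi>)) = (\<lambda>\<xi>. 2 ^ m + (- (2 ^ m)) * low_pass \<psi> m \<xi>)" for m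
    by (auto simp: algebra_simps)
  show "\<exists>C M. \<forall>m \<xi>. norm (partial_derivs ks (\<lambda>\<xi>. 2 ^ m * (1 - low_pass \<psi> m \<xi>)) \<xi>) \<le> C * (1 + norm \<xi>) ^ M"
  proof (cases "ks = []")
    case True
    have "norm (2 ^ m * (1 - low_pass \<psi> m \<xi>)) \<le> 1 + norm \<xi>" for m \<xi>
    proof (cases "norm \<xi> < 2 ^ m")
      case True
      then have "norm ((1 / 2 ^ m) *\<^sub>R \<xi>) < 1"
        by (simp add: field_simps)
      then have "norm ((1 / 2 ^ m) *\<^sub>R \<xi>) < 6/5"
        by linarith
      then show ?thesis
        using cutoffD(4)[OF assms] by (simp add: low_pass_def)
    next
      case False
      have "norm (1 - low_pass \<psi> m \<xi>) = \<bar>1 - \<psi> ((1 / 2 ^ m) *\<^sub>R \<xi>)\<bar>"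
        unfolding low_pass_def by (metis norm_of_real of_real_1 of_real_diff)
      also have "\<dots> \<le> 1"
        using cutoffD(2,3)[OF assms, of "(1 / 2 ^ m) *\<^sub>R \<xi>"] by simp
      finally have "2 ^ m * norm (1 - low_pass \<psi> m \<xi>) \<le> 2 ^ m" by simp
      then show ?thesis
        using False by (simp only: norm_mult norm_power norm_numeral not_less)
    qed
    then show ?thesis
      using True by (intro exI[of _ 1]) (auto intro!: exI[of _ 1])
  next
    case False
    have \<psi>: "smooth (\<lambda>x. complex_of_real (\<psi> x))"
      using cutoffD(1)[OF assms] by (simp add: test_functions_def smooth_of_real)
    obtain C where C: "\<And>x. norm (partial_derivs ks (\<lambda>x. complex_of_real (\<psi> x)) x) \<le> C"
      by (rule test_function_derivs_bounded[OF test_functions_of_real[OF cutoffD(1)[OF assms]], of ks]) (rule that)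
    have "norm (partial_derivs ks (\<lambda>\<xi>. 2 ^ m * (1 - low_pass \<psi> m \<xi>)) \<xi>) \<le> C" for m \<xi>
    proof -
      have "partial_derivs ks (low_pass \<psi> m) =
          (\<lambda>\<xi>. (1 / 2 ^ m) ^ length ks *\<^sub>R partial_derivs ks (\<lambda>x. complex_of_real (\<psi> x)) ((1 / 2 ^ m) *\<^sub>R \<xi>))"
        using partial_derivs_affine[OF \<psi>, of ks "1 / 2 ^ m" 0] by (simp add: low_pass_def[abs_def])
      then have "partial_derivs ks (\<lambda>\<xi>. 2 ^ m * (1 - low_pass \<psi> m \<xi>)) \<xi> =
          - (2 ^ m) * ((1 / 2 ^ m) ^ length ks *\<^sub>R partial_derivs ks (\<lambda>x. complex_of_real (\<psi> x)) ((1 / 2 ^ m) *\<^sub>R \<xi>))"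
        unfolding eq partial_derivs_add[OF smooth_const smooth_mult[OF smooth_const s]]
          partial_derivs_linear[OF bounded_linear_mult_right s] partial_derivs_const[OF False]
        by simp
      then have "norm (partial_derivs ks (\<lambda>\<xi>. 2 ^ m * (1 - low_pass \<psi> m \<xi>)) \<xi>) =
          2 ^ m * ((1 / 2 ^ m) ^ length ks * norm (partial_derivs ks (\<lambda>x. complex_of_real (\<psi> x)) ((1 / 2 ^ m) *\<^sub>R \<xi>)))"
        by (simp add: norm_mult norm_power)
      \<comment> \<open>Each derivative of the dilated cutoff gains a factor
        \<open>1 / 2 ^ m\<close>. Since \<open>ks\<close> is nonempty there is at least one, which
        pays for the factor \<open>2 ^ m\<close> in front.\<close>
      also have "\<dots> \<le> 2 ^ m * ((1 / 2 ^ m) * C)"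
      proof -
        have "(1 / 2 ^ m :: real) ^ length ks \<le> (1 / 2 ^ m) ^ 1"
          using False by (intro power_decreasing) (auto simp: Suc_le_eq)
        then show ?thesis
          using C by (intro mult_left_mono mult_mono) auto
      qed
      finally show ?thesis by simp
    qed
    then show ?thesis
      by (intro exI[of _ C] exI[of _ 0]) auto
  qed
qed

text \<open>The multiplier scaled by \<open>2 ^ m\<close> keeps Schwartz families bounded, so
  dividing by \<open>2 ^ m\<close> again leaves a family that vanishes geometrically. This is the
  convergence of the low-pass filters to the identity on the Schwartz space, with a rate.\<close>

lemma schw_fam_high_pass:
  assumes "cutoff \<psi>" "\<eta> \<in> schwartz"
  shows "schw_fam (\<lambda>m. 1 / 2 ^ m) (\<lambda>m \<xi>. (1 - low_pass \<psi> m \<xi>) * \<eta> \<xi>)"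
proof -
  have "schw_fam (\<lambda>m::nat. 1) (\<lambda>m \<xi>. 2 ^ m * (1 - low_pass \<psi> m \<xi>) * \<eta> \<xi>)"
    by (rule schw_fam_mult[OF poly_fam_high_pass[OF assms(1)]])
      (use assms(2) in \<open>auto simp: schwartz_iff_schw_fam[symmetric]\<close>)
  then have 1: "smooth (\<lambda>\<xi>. 2 ^ m * (1 - low_pass \<psi> m \<xi>) * \<eta> \<xi>)" and
    2: "\<exists>C. \<forall>m x. (1 + norm x) ^ N * norm (partial_derivs ks (\<lambda>\<xi>. 2 ^ m * (1 - low_pass \<psi> m \<xi>) * \<eta> \<xi>) x) \<le> C" for m ks N
    by (auto simp: schw_fam_def)
  have eq: "(\<lambda>\<xi>. (1 - low_pass \<psi> m \<xi>) * \<eta> \<xi>) = (\<lambda>\<xi>. (1 / 2 ^ m) * (2 ^ m * (1 - low_pass \<psi> m \<xi>) * \<eta> \<xi>))" for m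
    by auto
  have s: "smooth (\<lambda>\<xi>. (1 - low_pass \<psi> m \<xi>) * \<eta> \<xi>)" for m
    unfolding eq by (intro smooth_mult smooth_const 1)
  have d: "partial_derivs ks (\<lambda>\<xi>. (1 - low_pass \<psi> m \<xi>) * \<eta> \<xi>) x =
      (1 / 2 ^ m) * partial_derivs ks (\<lambda>\<xi>. 2 ^ m * (1 - low_pass \<psi> m \<xi>) * \<eta> \<xi>) x" for ks m x
    unfolding eq by (subst partial_derivs_linear[OF bounded_linear_mult_right 1]) simp
  have "\<exists>C. \<forall>m x. (1 + norm x) ^ N * norm (partial_derivs ks (\<lambda>\<xi>. (1 - low_pass \<psi> m \<xi>) * \<eta> \<xi>) x) \<le> C * (1 / 2 ^ m)" for ks N
  proof -
    obtain C where C: "\<And>m x. (1 + norm x) ^ N * norm (partial_derivs ks (\<lambda>\<xi>. 2 ^ m * (1 - low_pass \<psi> m \<xi>) * \<eta> \<xi>) x) \<le> C"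
      using 2 by blast
    have "(1 + norm x) ^ N * norm (partial_derivs ks (\<lambda>\<xi>. (1 - low_pass \<psi> m \<xi>) * \<eta> \<xi>) x) \<le> C * (1 / 2 ^ m)" for m x
      using C[of x m] unfolding d by (simp add: norm_mult norm_divide norm_power divide_right_mono)
    then show ?thesis by blast
  qed
  then show ?thesis
    unfolding schw_fam_def using s by blast
qed

lemma low_pass_0: "low_pass \<psi> 0 = (\<lambda>\<xi>. complex_of_real (\<psi> \<xi>))"
  by (simp add: low_pass_def[abs_def])

lemma dyadic_Suc: "complex_of_real (dyadic \<psi> (Suc j) \<xi>) = low_pass \<psi> (Suc j) \<xi> - low_pass \<psi> j \<xi>"
  by (simp add: low_pass_def)

lemma test_functions_diff:
  fixes f g :: "real^'n::finite \<Rightarrow> complex"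
  assumes "f \<in> test_functions" "g \<in> test_functions"
  shows "(\<lambda>x. f x - g x) \<in> test_functions"
proof -
  have "smooth (\<lambda>x. f x + (-1) * g x)"
    using assms by (intro smooth_add smooth_mult smooth_const) (auto simp: test_functions_def)
  moreover have "bounded {x. f x - g x \<noteq> 0}"
  proof (rule bounded_subset)
    show "bounded ({x. f x \<noteq> 0} \<union> {x. g x \<noteq> 0})"
      using assms by (auto simp: test_functions_def dest: compact_imp_bounded
          intro: bounded_subset[OF _ closure_subset])
  qed auto
  ultimately show ?thesis by (simp add: test_functions_def compact_closure)
qed

lemma dyadic_test_function:
  assumes "cutoff \<psi>"
  shows "(\<lambda>\<xi>. complex_of_real (dyadic \<psi> j \<xi>)) \<in> test_functions"
proof (cases j)
  case 0
  then show ?thesis using low_pass_test_function[OF assms, of 0] by (simp add: low_pass_0)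
next
  case (Suc i)
  show ?thesis
    unfolding Suc dyadic_Suc using low_pass_test_function[OF assms] by (intro test_functions_diff)
qed

section \<open>Integrability with respect to polynomial weights\<close>

text \<open>The exponent n + 1 is the smallest integer for which this function is integrable over
  n-dimensional space.\<close>

definition weight :: "real^'n::finite \<Rightarrow> real" where
  "weight x = inverse ((1 + norm x) ^ Suc CARD('n))"

lemma weight_pos: "weight x > 0"
  by (simp add: weight_def add_pos_nonneg)

lemma weight_nonneg [simp]: "weight x \<ge> 0"
  using weight_pos[of x] by simp

lemma weight_measurable [measurable]: "weight \<in> borel_measurable borel"
  unfolding weight_def[abs_def] by measurable

text \<open>Peetre's inequality: 1 + |x| is at most (1 + |x + y|) (1 + |y|).\<close>

lemma weight_shift:
  fixes x :: "real^'n::finite"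
  shows "weight (x + y) \<le> (1 + norm y) ^ Suc CARD('n) * weight x"
proof -
  have "1 + norm x \<le> 1 + (norm (x + y) + norm y)"
    using norm_triangle_ineq4[of "x + y" y] by simp
  also have "\<dots> \<le> (1 + norm (x + y)) * (1 + norm y)"
    by (simp add: algebra_simps)
  finally have "(1 + norm x) ^ Suc CARD('n) \<le> (1 + norm (x + y)) ^ Suc CARD('n) * (1 + norm y) ^ Suc CARD('n)"
    by (metis norm_ge_zero add_nonneg_nonneg power_mono power_mult_distrib zero_le_one)
  moreover have "(1 + norm x) ^ Suc CARD('n) > 0" "(1 + norm (x + y)) ^ Suc CARD('n) > 0"
    by (simp_all add: add_pos_nonneg)
  ultimately show ?thesis
    unfolding weight_def by (simp add: field_simps del: power_Suc)
qed

text \<open>Dyadic shells: the weight at distance about \<open>2\<^sup>k\<close> beats the volume growth \<open>2\<^sup>k\<^sup>n\<close> by a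
  factor \<open>2\<^sup>-\<^sup>k\<close>.\<close>

lemma nn_integral_weight_le:
  fixes F :: "real^'n::finite \<Rightarrow> ennreal"
  assumes [measurable]: "F \<in> borel_measurable borel"
    and F: "\<And>k. (\<integral>\<^sup>+z. F z * indicator (ball y (2 ^ k)) z \<partial>lborel) \<le> ennreal (A * 2 ^ (k * CARD('n)))"
    and A: "A \<ge> 0"
  shows "(\<integral>\<^sup>+z. F z * ennreal (weight (z - y)) \<partial>lborel) \<le> ennreal (2 ^ Suc (Suc CARD('n)) * A)"
proof -
  have [measurable]: "ball y (2 ^ k) \<in> sets borel" for k by simp
  \<comment> \<open>\<open>c k\<close> is the value of (2^k / 2)^-(n+1). It bounds the weight
    wherever \<open>2 ^ k\<close> is the first power of 2 above the distance, because this distance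
    plus 1 is then at least half of \<open>2 ^ k\<close>.\<close>
  define c :: "nat \<Rightarrow> real" where "c k = 2 ^ Suc CARD('n) / 2 ^ (k * Suc CARD('n))" for k
  have c0: "c k \<ge> 0" for k by (simp add: c_def)
  have term_le_suminf: "f k \<le> suminf f" for f :: "nat \<Rightarrow> ennreal" and k
    using sum_le_suminf[of f "{k}"] by simp
  have "ennreal (weight (z - y)) \<le> (\<Sum>k. ennreal (c k) * indicator (ball y (2 ^ k)) z)" for z
  proof -
    obtain m where "norm (z - y) < 2 ^ m"
      using real_arch_pow[of 2 "norm (z - y)"] by auto
    define k where "k = (LEAST k. norm (z - y) < 2 ^ k)"
    have k: "norm (z - y) < 2 ^ k"
      unfolding k_def by (rule LeastI) fact
    have "2 ^ k / 2 \<le> 1 + norm (z - y)"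
    proof (cases k)
      case (Suc l)
      have "\<not> norm (z - y) < 2 ^ l"
        using not_less_Least[of l "\<lambda>k. norm (z - y) < 2 ^ k"] Suc k_def by simp
      then show ?thesis using Suc by simp
    qed (simp add: add_nonneg_nonneg)
    then have "(2 ^ k / 2) ^ Suc CARD('n) \<le> (1 + norm (z - y)) ^ Suc CARD('n)"
      by (intro power_mono) auto
    then have "weight (z - y) \<le> inverse ((2 ^ k / 2) ^ Suc CARD('n))"
      unfolding weight_def by (intro le_imp_inverse_le) (auto simp del: power_Suc)
    also have "\<dots> = c k"
      by (simp add: c_def power_divide power_mult[symmetric] del: power_Suc mult_Suc_right)
    finally have "ennreal (weight (z - y)) \<le> ennreal (c k) * indicator (ball y (2 ^ k)) z"
      using k by (simp add: dist_norm norm_minus_commute ennreal_leI)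
    also have "\<dots> \<le> (\<Sum>k. ennreal (c k) * indicator (ball y (2 ^ k)) z)"
      by (rule term_le_suminf)
    finally show ?thesis .
  qed
  then have "(\<integral>\<^sup>+z. F z * ennreal (weight (z - y)) \<partial>lborel)
      \<le> (\<integral>\<^sup>+z. F z * (\<Sum>k. ennreal (c k) * indicator (ball y (2 ^ k)) z) \<partial>lborel)"
    by (intro nn_integral_mono mult_left_mono) auto
  also have "\<dots> = (\<integral>\<^sup>+z. (\<Sum>k. ennreal (c k) * (F z * indicator (ball y (2 ^ k)) z)) \<partial>lborel)"
    by (simp only: ennreal_suminf_cmult[symmetric] mult.left_commute)
  also have "\<dots> = (\<Sum>k. \<integral>\<^sup>+z. ennreal (c k) * (F z * indicator (ball y (2 ^ k)) z) \<partial>lborel)"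
    by (rule nn_integral_suminf) measurable
  also have "\<dots> = (\<Sum>k. ennreal (c k) * (\<integral>\<^sup>+z. F z * indicator (ball y (2 ^ k)) z \<partial>lborel))"
    by (intro suminf_cong nn_integral_cmult) measurable
  also have "\<dots> \<le> (\<Sum>k. ennreal (2 ^ Suc CARD('n) * A) * ennreal ((1/2) ^ k))"
  proof (intro suminf_le allI)
    fix k
    have "ennreal (c k) * (\<integral>\<^sup>+z. F z * indicator (ball y (2 ^ k)) z \<partial>lborel)
        \<le> ennreal (c k) * ennreal (A * 2 ^ (k * CARD('n)))"
      by (intro mult_left_mono F) simp
    also have "\<dots> = ennreal (2 ^ Suc CARD('n) * A * (1/2) ^ k)"
      using A c0 by (simp add: ennreal_mult'[symmetric] c_def power_add field_simps)
    finally show "ennreal (c k) * (\<integral>\<^sup>+z. F z * indicator (ball y (2 ^ k)) z \<partial>lborel)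
        \<le> ennreal (2 ^ Suc CARD('n) * A) * ennreal ((1/2) ^ k)"
      using A by (simp add: ennreal_mult')
  qed auto
  also have "\<dots> = ennreal (2 ^ Suc CARD('n) * A) * (\<Sum>k. ennreal ((1/2) ^ k))"
    by (rule ennreal_suminf_cmult)
  also have "(\<Sum>k. ennreal ((1/2) ^ k)) = ennreal 2"
    by (subst suminf_ennreal2) (auto simp: suminf_geometric)
  also have "ennreal (2 ^ Suc CARD('n) * A) * ennreal 2 = ennreal (2 ^ Suc (Suc CARD('n)) * A)"
    by (subst ennreal_mult''[symmetric]) (simp_all add: mult_ac)
  finally show ?thesis .
qed

lemma nn_integral_weight_bound:
  "(\<integral>\<^sup>+z. ennreal (weight (z - y :: real^'n::finite)) \<partial>lborel)
     \<le> ennreal (2 ^ Suc (Suc CARD('n)) * unit_ball_vol (real CARD('n)))"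
proof -
  have "(\<integral>\<^sup>+z. 1 * ennreal (weight (z - y)) \<partial>lborel)
      \<le> ennreal (2 ^ Suc (Suc CARD('n)) * unit_ball_vol (real CARD('n)))"
    by (rule nn_integral_weight_le)
      (auto simp: emeasure_ball power_mult)
  then show ?thesis by simp
qed

lemma integrable_weight: "integrable lborel (weight :: real^'n::finite \<Rightarrow> real)"
  using nn_integral_weight_bound[of 0] by (auto simp: integrable_iff_bounded intro: order_le_less_trans)

lemma integrable_dominated_by_weight:
  fixes f :: "real^'n::finite \<Rightarrow> 'b::{banach, second_countable_topology}"
  assumes "f \<in> borel_measurable borel" "\<And>x. norm (f x) \<le> C * weight x"
  shows "integrable lborel f"
  by (rule Bochner_Integration.integrable_bound[OF integrable_mult_right[OF integrable_weight, of C]])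
    (use assms in \<open>auto intro!: AE_I2 intro: order_trans[OF _ abs_ge_self]\<close>)

lemma schw_fam_weight:
  fixes \<eta> :: "'i \<Rightarrow> real^'n::finite \<Rightarrow> complex"
  assumes "schw_fam \<epsilon> \<eta>" "\<And>i. \<epsilon> i \<ge> 0"
  obtains C where "C \<ge> 0" "\<And>i x. (1 + norm x) ^ N * norm (partial_derivs ks (\<eta> i) x) \<le> C * \<epsilon> i * weight x"
proof -
  obtain C where C: "C \<ge> 0" "\<And>i x. (1 + norm x) ^ (N + Suc CARD('n)) * norm (partial_derivs ks (\<eta> i) x) \<le> C * \<epsilon> i"
    using schw_famE[OF assms] by blast
  show ?thesis
  proof (rule that[OF C(1)])
    fix i and x :: "real^'n"
    have "(1 + norm x) ^ Suc CARD('n) > 0" by (simp add: add_pos_nonneg)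
    then show "(1 + norm x) ^ N * norm (partial_derivs ks (\<eta> i) x) \<le> C * \<epsilon> i * weight x"
      using C(2)[of x i] unfolding weight_def power_add by (simp add: field_simps del: power_Suc)
  qed
qed

lemma schwartz_weight:
  assumes "\<eta> \<in> schwartz"
  obtains C where "C \<ge> 0" "\<And>x. (1 + norm x) ^ N * norm (partial_derivs ks \<eta> x) \<le> C * weight x"
  using schw_fam_weight[of "\<lambda>i::unit. 1" "\<lambda>i. \<eta>" N ks] assms
  by (auto simp: schwartz_iff_schw_fam[symmetric])

lemma schwartz_weight0:
  assumes "\<eta> \<in> schwartz"
  obtains C where "C \<ge> 0" "\<And>x. norm (\<eta> x) \<le> C * weight x"
  using schwartz_weight[OF assms, of 0 "[]"] by auto

lemma schwartz_measurable: "\<eta> \<in> schwartz \<Longrightarrow> \<eta> \<in> borel_measurable borel"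
  by (simp add: schwartz_smooth smooth_borel_measurable)

lemma schwartz_integrable:
  assumes "\<eta> \<in> schwartz"
  shows "integrable lborel \<eta>"
  by (rule schwartz_weight0[OF assms])
    (auto intro: integrable_dominated_by_weight schwartz_measurable assms)

lemma schwartz_coordinate_mult:
  assumes "\<eta> \<in> schwartz"
  shows "(\<lambda>x. complex_of_real (x $ k) * \<eta> x) \<in> schwartz"
  using schw_fam_mult[OF poly_fam_coordinate, of "\<lambda>i::unit. 1" "\<lambda>i. \<eta>"] assms
  by (simp add: schwartz_iff_schw_fam[symmetric])

lemma schwartz_partial_deriv:
  assumes "\<eta> \<in> schwartz"
  shows "partial_deriv k \<eta> \<in> schwartz"
  using schw_fam_partial_deriv[of "\<lambda>i::unit. 1" "\<lambda>i. \<eta>"] assms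
  by (simp add: schwartz_iff_schw_fam[symmetric])

section \<open>The Fourier transform on Schwartz functions\<close>

abbreviation fourier_const :: "'n::finite itself \<Rightarrow> real" where
  "fourier_const t \<equiv> (2 * pi) powr (- real CARD('n) / 2)"

lemma integral_lebesgue_lborel:
  fixes f :: "'a::euclidean_space \<Rightarrow> 'b::{banach, second_countable_topology}"
  assumes "f \<in> borel_measurable borel"
  shows "integral\<^sup>L lebesgue f = integral\<^sup>L lborel f"
  using assms by (simp add: integral_completion)

lemma fourier_lborel:
  fixes \<phi> :: "real^'n::finite \<Rightarrow> complex"
  assumes [measurable]: "\<phi> \<in> borel_measurable borel"
  shows "fourier \<phi> \<xi> = complex_of_real (fourier_const TYPE('n)) * (\<integral>x. \<phi> x * exp (- \<i> * complex_of_real (x \<bullet> \<xi>)) \<partial>lborel)"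
  unfolding fourier_def by (subst integral_lebesgue_lborel) auto

lemma norm_cis_real [simp]: "norm (exp (- \<i> * complex_of_real t)) = 1" "norm (exp (- (\<i> * complex_of_real t))) = 1"
    "norm (exp (\<i> * complex_of_real t)) = 1"
  using norm_exp_i_times[of t] norm_exp_i_times[of "- t"] by auto

lemma integrable_mult_cis:
  fixes \<phi> :: "real^'n::finite \<Rightarrow> complex"
  assumes "integrable lborel \<phi>"
  shows "integrable lborel (\<lambda>x. \<phi> x * exp (- \<i> * complex_of_real (x \<bullet> \<xi>)))"
  by (rule Bochner_Integration.integrable_bound[OF assms]) (use assms in \<open>auto simp: norm_mult\<close>)

lemma norm_fourier_le:
  fixes \<phi> :: "real^'n::finite \<Rightarrow> complex"
  assumes "integrable lborel \<phi>"
  shows "norm (fourier \<phi> \<xi>) \<le> fourier_const TYPE('n) * (\<integral>x. norm (\<phi> x) \<partial>lborel)"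
proof -
  have [measurable]: "\<phi> \<in> borel_measurable borel" using assms by auto
  have "norm (\<integral>x. \<phi> x * exp (- \<i> * complex_of_real (x \<bullet> \<xi>)) \<partial>lborel)
      \<le> (\<integral>x. norm (\<phi> x * exp (- \<i> * complex_of_real (x \<bullet> \<xi>))) \<partial>lborel)"
    by (rule integral_norm_bound)
  also have "\<dots> = (\<integral>x. norm (\<phi> x) \<partial>lborel)"
    by (simp add: norm_mult)
  finally show ?thesis
    by (simp add: fourier_lborel norm_mult mult_left_mono)
qed

lemma norm_iexp_minus_linear: "norm (exp (- \<i> * complex_of_real t) - 1 + \<i> * complex_of_real t) \<le> t\<^sup>2 / 2"
  using iexp_approx1[of "- t" 1] by (simp add: numeral_2_eq_2 algebra_simps)

lemma schwartz_norm_sq_integrable: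
  assumes "\<eta> \<in> schwartz"
  shows "integrable lborel (\<lambda>x. norm (\<eta> x) * (norm x)\<^sup>2)"
proof -
  obtain C where C: "C \<ge> 0" "\<And>x. (1 + norm x) ^ 2 * norm (\<eta> x) \<le> C * weight x"
    using schwartz_weight[OF assms, of 2 "[]"] by auto
  have [measurable]: "\<eta> \<in> borel_measurable borel" by (rule schwartz_measurable[OF assms])
  show ?thesis
  proof (rule integrable_dominated_by_weight)
    fix x
    have "(norm x)\<^sup>2 * norm (\<eta> x) \<le> (1 + norm x)\<^sup>2 * norm (\<eta> x)"
      by (intro mult_right_mono power_mono) auto
    then show "norm (norm (\<eta> x) * (norm x)\<^sup>2) \<le> C * weight x"
      using C(2)[of x] by (simp add: norm_mult mult.commute)
  qed measurable
qed

text \<open>An explicit second-order remainder instead of differentiation of a parameter integral in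
  each coordinate: |exp(-it) - 1 + it| is at most t^2 / 2, so the error is at most a multiple of
  |h|^2 times the second absolute moment of \<eta>. This gives the total derivative at once.\<close>

lemma fourier_has_derivative:
  fixes \<eta> :: "real^'n::finite \<Rightarrow> complex"
  assumes \<eta>: "\<eta> \<in> schwartz"
  shows "(fourier \<eta> has_derivative (\<lambda>h. \<Sum>k\<in>UNIV. h $ k *\<^sub>R fourier (\<lambda>x. - \<i> * (complex_of_real (x $ k) * \<eta> x)) \<xi>)) (at \<xi>)"
    (is "(_ has_derivative ?D) _")
proof -
  let ?c = "fourier_const TYPE('n)"
  let ?e = "\<lambda>x \<xi>. exp (- \<i> * complex_of_real (x \<bullet> \<xi>))"
  have [measurable]: "\<eta> \<in> borel_measurable borel" by (rule schwartz_measurable[OF \<eta>])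
  have int: "integrable lborel (\<lambda>x. \<eta> x * ?e x \<xi>)" for \<xi>
    by (rule integrable_mult_cis[OF schwartz_integrable[OF \<eta>]])
  have intk: "integrable lborel (\<lambda>x. - \<i> * (complex_of_real (x $ k) * \<eta> x) * ?e x \<xi>)" for k \<xi>
    by (intro integrable_mult_cis schwartz_integrable schwartz_cmult schwartz_coordinate_mult \<eta>)
  have mk: "(\<lambda>x. - \<i> * (complex_of_real (x $ k) * \<eta> x)) \<in> borel_measurable borel" for k
    by (intro schwartz_measurable schwartz_cmult schwartz_coordinate_mult \<eta>)
  have bound_rem_aux: "norm (\<eta> x * ?e x \<xi> * (?e x h - 1 + \<i> * complex_of_real (x \<bullet> h)))
      \<le> norm (\<eta> x) * (norm x)\<^sup>2 * ((norm h)\<^sup>2 / 2)" for x h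
  proof -
    have "norm (?e x h - 1 + \<i> * complex_of_real (x \<bullet> h)) \<le> (x \<bullet> h)\<^sup>2 / 2"
      by (rule norm_iexp_minus_linear)
    also have "(x \<bullet> h)\<^sup>2 \<le> (norm x * norm h)\<^sup>2"
      using Cauchy_Schwarz_ineq2[of x h] by (metis abs_ge_zero power2_abs power_mono)
    finally have "norm (?e x h - 1 + \<i> * complex_of_real (x \<bullet> h)) \<le> (norm x)\<^sup>2 * ((norm h)\<^sup>2 / 2)"
      by (simp add: power_mult_distrib)
    then show ?thesis
      by (simp add: norm_mult mult_left_mono mult.assoc)
  qed
  define I where "I = (\<integral>x. norm (\<eta> x) * (norm x)\<^sup>2 \<partial>lborel)"
  have rem: "norm (fourier \<eta> (\<xi> + h) - fourier \<eta> \<xi> - ?D h) \<le> ?c * (I / 2) * (norm h)\<^sup>2" for h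
  proof -
    have intD: "integrable lborel (\<lambda>x. \<Sum>k\<in>UNIV. h $ k *\<^sub>R (- \<i> * (complex_of_real (x $ k) * \<eta> x) * ?e x \<xi>))"
      by (intro Bochner_Integration.integrable_sum integrable_scaleR_right intk)
    have "?D h = complex_of_real ?c * (\<Sum>k\<in>UNIV. h $ k *\<^sub>R (\<integral>x. - \<i> * (complex_of_real (x $ k) * \<eta> x) * ?e x \<xi> \<partial>lborel))"
      by (simp only: fourier_lborel[OF mk] sum_distrib_left mult_scaleR_right)
    also have "\<dots> = complex_of_real ?c * (\<integral>x. (\<Sum>k\<in>UNIV. h $ k *\<^sub>R (- \<i> * (complex_of_real (x $ k) * \<eta> x) * ?e x \<xi>)) \<partial>lborel)"
    proof -
      have "(\<integral>x. (\<Sum>k\<in>UNIV. h $ k *\<^sub>R (- \<i> * (complex_of_real (x $ k) * \<eta> x) * ?e x \<xi>)) \<partial>lborel)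
          = (\<Sum>k\<in>UNIV. \<integral>x. h $ k *\<^sub>R (- \<i> * (complex_of_real (x $ k) * \<eta> x) * ?e x \<xi>) \<partial>lborel)"
        by (rule Bochner_Integration.integral_sum) (intro integrable_scaleR_right intk)
      also have "\<dots> = (\<Sum>k\<in>UNIV. h $ k *\<^sub>R (\<integral>x. - \<i> * (complex_of_real (x $ k) * \<eta> x) * ?e x \<xi> \<partial>lborel))"
        by (intro sum.cong refl Bochner_Integration.integral_scaleR_right intk)
      finally show ?thesis by simp
    qed
    finally have D: "?D h = complex_of_real ?c * (\<integral>x. (\<Sum>k\<in>UNIV. h $ k *\<^sub>R (- \<i> * (complex_of_real (x $ k) * \<eta> x) * ?e x \<xi>)) \<partial>lborel)" .
    have sum: "(\<Sum>k\<in>UNIV. h $ k *\<^sub>R (- \<i> * (complex_of_real (x $ k) * \<eta> x) * ?e x \<xi>)) =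
        - \<i> * complex_of_real (x \<bullet> h) * \<eta> x * ?e x \<xi>" for x
      by (simp add: inner_vec_def sum_distrib_left sum_distrib_right scaleR_conv_of_real mult_ac sum_negf)
    have "fourier \<eta> (\<xi> + h) - fourier \<eta> \<xi> - ?D h =
      complex_of_real ?c * (\<integral>x. \<eta> x * ?e x (\<xi> + h) - \<eta> x * ?e x \<xi>
        - (\<Sum>k\<in>UNIV. h $ k *\<^sub>R (- \<i> * (complex_of_real (x $ k) * \<eta> x) * ?e x \<xi>)) \<partial>lborel)"
      unfolding D fourier_lborel[OF \<open>\<eta> \<in> borel_measurable borel\<close>]
      by (simp only: Bochner_Integration.integral_diff[OF Bochner_Integration.integrable_diff[OF int int] intD]
          Bochner_Integration.integral_diff[OF int int] right_diff_distrib)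
    also have "\<dots> = complex_of_real ?c * (\<integral>x. \<eta> x * ?e x \<xi> * (?e x h - 1 + \<i> * complex_of_real (x \<bullet> h)) \<partial>lborel)"
    proof -
      have "?e x (\<xi> + h) = ?e x \<xi> * ?e x h" for x
        by (simp add: inner_add_right exp_add[symmetric] distrib_left)
      then show ?thesis
        unfolding sum by (simp add: algebra_simps)
    qed
    finally have eq: "fourier \<eta> (\<xi> + h) - fourier \<eta> \<xi> - ?D h = \<dots>" .
    have "norm (\<integral>x. \<eta> x * ?e x \<xi> * (?e x h - 1 + \<i> * complex_of_real (x \<bullet> h)) \<partial>lborel)
        \<le> (\<integral>x. norm (\<eta> x) * (norm x)\<^sup>2 * ((norm h)\<^sup>2 / 2) \<partial>lborel)"
    proof (rule Bochner_Integration.integral_norm_bound_integral)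
      show "integrable lborel (\<lambda>x. norm (\<eta> x) * (norm x)\<^sup>2 * ((norm h)\<^sup>2 / 2))"
        by (intro integrable_mult_left schwartz_norm_sq_integrable \<eta>)
      then show "integrable lborel (\<lambda>x. \<eta> x * ?e x \<xi> * (?e x h - 1 + \<i> * complex_of_real (x \<bullet> h)))"
      proof (rule Bochner_Integration.integrable_bound)
        show "AE x in lborel. norm (\<eta> x * ?e x \<xi> * (?e x h - 1 + \<i> * complex_of_real (x \<bullet> h)))
          \<le> norm (norm (\<eta> x) * (norm x)\<^sup>2 * ((norm h)\<^sup>2 / 2))"
          by (rule AE_I2, rule order_trans[OF bound_rem_aux]) (simp only: real_norm_def abs_ge_self)
      qed measurable
    qed (rule bound_rem_aux)
    also have "\<dots> = I * ((norm h)\<^sup>2 / 2)"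
      unfolding I_def by (rule integral_mult_left_zero)
    finally have "norm (complex_of_real ?c) * norm (\<integral>x. \<eta> x * ?e x \<xi> * (?e x h - 1 + \<i> * complex_of_real (x \<bullet> h)) \<partial>lborel)
        \<le> norm (complex_of_real ?c) * (I * ((norm h)\<^sup>2 / 2))"
      by (rule mult_left_mono) simp
    then show ?thesis
      unfolding eq norm_mult by (simp add: mult_ac)
  qed
  show ?thesis
  proof (rule has_derivativeI_sandwich[where e = 1])
    show "bounded_linear ?D"
      by (intro bounded_linear_sum bounded_linear_scaleR_const bounded_linear_vec_nth)
    show "((\<lambda>y. ?c * (I / 2) * norm (y - \<xi>)) \<longlongrightarrow> 0) (at \<xi>)"
      by (auto intro!: tendsto_eq_intros)
    show "norm (fourier \<eta> y - fourier \<eta> \<xi> - ?D (y - \<xi>)) / norm (y - \<xi>) \<le> ?c * (I / 2) * norm (y - \<xi>)"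
      if "y \<noteq> \<xi>" for y
      using rem[of "y - \<xi>"] that by (simp add: divide_le_eq power2_eq_square mult.assoc)
  qed simp
qed

lemma fourier_differentiable: "\<eta> \<in> schwartz \<Longrightarrow> fourier \<eta> differentiable (at \<xi>)"
  using fourier_has_derivative differentiableI by blast

lemma partial_deriv_fourier:
  fixes \<eta> :: "real^'n::finite \<Rightarrow> complex"
  assumes "\<eta> \<in> schwartz"
  shows "partial_deriv k (fourier \<eta>) = fourier (\<lambda>x. - \<i> * (complex_of_real (x $ k) * \<eta> x))"
proof
  fix \<xi>
  have "(\<Sum>l\<in>UNIV. axis k (1::real) $ l *\<^sub>R fourier (\<lambda>x. - \<i> * (complex_of_real (x $ l) * \<eta> x)) \<xi>)
      = (\<Sum>l\<in>UNIV. if l = k then fourier (\<lambda>x. - \<i> * (complex_of_real (x $ l) * \<eta> x)) \<xi> else 0)"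
    by (intro sum.cong refl) (simp add: axis_def)
  then show "partial_deriv k (fourier \<eta>) \<xi> = fourier (\<lambda>x. - \<i> * (complex_of_real (x $ k) * \<eta> x)) \<xi>"
    using partial_deriv_eq[OF fourier_has_derivative[OF assms], of k] by simp
qed

lemma smooth_fourier:
  fixes \<eta> :: "real^'n::finite \<Rightarrow> complex"
  assumes "\<eta> \<in> schwartz"
  shows "smooth (fourier \<eta>)"
proof (rule smooth_coinduct[where X = "fourier ` schwartz"])
  fix f :: "real^'n \<Rightarrow> complex" and k assume "f \<in> fourier ` schwartz"
  then obtain \<zeta> where \<zeta>: "\<zeta> \<in> schwartz" "f = fourier \<zeta>" by blast
  then show "partial_deriv k f \<in> fourier ` schwartz"
    unfolding \<zeta>(2) partial_deriv_fourier[OF \<zeta>(1)]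
    by (intro imageI schwartz_cmult schwartz_coordinate_mult)
qed (use assms fourier_differentiable in auto)

lemma lborel_integral_translation:
  fixes f :: "'a::euclidean_space \<Rightarrow> 'b::{banach, second_countable_topology}"
  assumes [measurable]: "f \<in> borel_measurable borel"
  shows "(\<integral>x. f (x + c) \<partial>lborel) = (\<integral>x. f x \<partial>lborel)"
proof -
  have "(\<integral>x. f x \<partial>lborel) = (\<integral>x. f x \<partial>distr lborel borel ((+) c))"
    by (simp add: lborel_distr_plus)
  also have "\<dots> = (\<integral>x. f (c + x) \<partial>lborel)"
    by (rule integral_distr) measurable
  finally show ?thesis by (simp add: add.commute)
qed

lemma fourier_translation:
  fixes \<eta> :: "real^'n::finite \<Rightarrow> complex"
  assumes [measurable]: "\<eta> \<in> borel_measurable borel"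
  shows "fourier (\<lambda>x. \<eta> (x + c)) \<xi> = exp (\<i> * complex_of_real (c \<bullet> \<xi>)) * fourier \<eta> \<xi>"
proof -
  let ?f = "\<lambda>x. \<eta> x * exp (- \<i> * complex_of_real (x \<bullet> \<xi>))"
  have "(\<integral>x. \<eta> (x + c) * exp (- \<i> * complex_of_real (x \<bullet> \<xi>)) \<partial>lborel) =
      (\<integral>x. exp (\<i> * complex_of_real (c \<bullet> \<xi>)) * ?f (x + c) \<partial>lborel)"
    by (intro Bochner_Integration.integral_cong refl)
      (simp add: inner_add_left exp_add[symmetric] distrib_left mult.left_commute[of "exp _" "\<eta> _"])
  also have "\<dots> = exp (\<i> * complex_of_real (c \<bullet> \<xi>)) * (\<integral>x. ?f (x + c) \<partial>lborel)"
    by simp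
  also have "(\<integral>x. ?f (x + c) \<partial>lborel) = (\<integral>x. ?f x \<partial>lborel)"
    by (rule lborel_integral_translation) measurable
  finally show ?thesis
    by (simp add: fourier_lborel mult_ac)
qed

lemma fourier_diff:
  fixes \<phi> \<eta> :: "real^'n::finite \<Rightarrow> complex"
  assumes "integrable lborel \<phi>" "integrable lborel \<eta>"
  shows "fourier (\<lambda>x. \<phi> x - \<eta> x) \<xi> = fourier \<phi> \<xi> - fourier \<eta> \<xi>"
proof -
  have [measurable]: "\<phi> \<in> borel_measurable borel" "\<eta> \<in> borel_measurable borel"
    using assms by auto
  show ?thesis
    using Bochner_Integration.integral_diff[OF assms[THEN integrable_mult_cis], of \<xi>]
    by (simp add: fourier_lborel left_diff_distrib right_diff_distrib)
qed

lemma fourier_cmult: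
  fixes \<phi> :: "real^'n::finite \<Rightarrow> complex"
  assumes [measurable]: "\<phi> \<in> borel_measurable borel"
  shows "fourier (\<lambda>x. c * \<phi> x) \<xi> = c * fourier \<phi> \<xi>"
proof -
  have [measurable]: "(\<lambda>x. c * \<phi> x) \<in> borel_measurable borel" by measurable
  have "(\<integral>x. c * \<phi> x * exp (- \<i> * complex_of_real (x \<bullet> \<xi>)) \<partial>lborel) =
      (\<integral>x. c * (\<phi> x * exp (- \<i> * complex_of_real (x \<bullet> \<xi>))) \<partial>lborel)"
    by (simp only: mult.assoc)
  also have "\<dots> = c * (\<integral>x. \<phi> x * exp (- \<i> * complex_of_real (x \<bullet> \<xi>)) \<partial>lborel)"
    by (rule integral_mult_right_zero)
  finally show ?thesis
    unfolding fourier_lborel[OF assms] fourier_lborel[OF \<open>(\<lambda>x. c * \<phi> x) \<in> borel_measurable borel\<close>]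
    by (simp only: mult.left_commute)
qed

lemma has_vector_derivative_imp_quotient_tendsto:
  assumes "(f has_vector_derivative v) (at 0)"
  shows "((\<lambda>s. (f s - f 0) /\<^sub>R s) \<longlongrightarrow> v) (at 0)"
proof -
  have "((\<lambda>s. norm (f s - f 0 - s *\<^sub>R v) / norm s) \<longlongrightarrow> 0) (at 0)"
    using assms by (simp add: has_vector_derivative_def has_derivative_iff_norm)
  moreover have "\<forall>\<^sub>F s in at 0. norm (f s - f 0 - s *\<^sub>R v) / norm s = norm ((f s - f 0) /\<^sub>R s - v)"
  proof (rule eventually_at_filter[THEN iffD2, OF always_eventually], intro allI impI)
    fix s :: real assume s: "s \<noteq> 0"
    have "(f s - f 0) /\<^sub>R s - v = (f s - f 0 - s *\<^sub>R v) /\<^sub>R s"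
      using s by (simp add: scaleR_diff_right)
    then show "norm (f s - f 0 - s *\<^sub>R v) / norm s = norm ((f s - f 0) /\<^sub>R s - v)"
      by (simp add: divide_inverse mult.commute)
  qed
  ultimately have "((\<lambda>s. norm ((f s - f 0) /\<^sub>R s - v)) \<longlongrightarrow> 0) (at 0)"
    by (rule Lim_transform_eventually)
  then show ?thesis
    by (simp add: tendsto_norm_zero_iff LIM_zero_iff)
qed

text \<open>Differentiating under translation replaces the integration by parts.\<close>

lemma fourier_partial_deriv:
  fixes \<eta> :: "real^'n::finite \<Rightarrow> complex"
  assumes \<eta>: "\<eta> \<in> schwartz"
  shows "fourier (partial_deriv k \<eta>) \<xi> = \<i> * complex_of_real (\<xi> $ k) * fourier \<eta> \<xi>"
proof -
  let ?a = "axis k (1::real) :: real^'n"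
  define t :: "nat \<Rightarrow> real" where "t m = 1 / real (Suc m)" for m
  have t: "t m > 0" "t m \<le> 1" for m by (auto simp: t_def)
  have t0: "t \<longlonglongrightarrow> 0" unfolding t_def by (rule LIMSEQ_Suc[OF lim_1_over_n])
  have t0': "filterlim t (at 0) sequentially"
    using t0 t(1) by (intro filterlim_atI) (auto simp: less_imp_neq[symmetric] intro!: always_eventually order_less_imp_not_eq2)
  define d where "d m x = (\<eta> (x + t m *\<^sub>R ?a) - \<eta> x) /\<^sub>R t m" for m x
  have [measurable]: "\<eta> \<in> borel_measurable borel" by (rule schwartz_measurable[OF \<eta>])
  have [measurable]: "partial_deriv k \<eta> \<in> borel_measurable borel"
    by (rule schwartz_measurable[OF schwartz_partial_deriv[OF \<eta>]])
  have s: "smooth \<eta>" by (rule schwartz_smooth[OF \<eta>])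
  have vd: "((\<lambda>t. \<eta> (x + t *\<^sub>R ?a)) has_vector_derivative partial_deriv k \<eta> (x + s *\<^sub>R ?a)) (at s)" for x s
    by (rule has_vector_derivative_partial_deriv) (rule smooth_differentiable[OF s])
  obtain C where C: "C \<ge> 0" "\<And>x. norm (partial_deriv k \<eta> x) \<le> C * weight x"
    using schwartz_weight0[OF schwartz_partial_deriv[OF \<eta>]] by blast
  \<comment> \<open>The difference quotient only sees points at distance at most 1 from
    \<open>x\<close>, and such a shift changes the weight by at most the factor 2^(n+1).\<close>
  define B where "B = C * 2 ^ Suc CARD('n)"
  have bd: "norm (d m x) \<le> B * weight x" for m x
  proof -
    have der: "((\<lambda>s. \<eta> (x + s *\<^sub>R ?a)) has_derivative (\<lambda>h. h *\<^sub>R partial_deriv k \<eta> (x + s *\<^sub>R ?a))) (at s within {0..t m})" for s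
      using vd[of x s] by (simp add: has_vector_derivative_def has_derivative_at_withinI)
    have on: "onorm (\<lambda>h. h *\<^sub>R partial_deriv k \<eta> (x + s *\<^sub>R ?a)) \<le> B * weight x" if "s \<in> {0..t m}" for s
    proof (rule onorm_bound)
      fix h :: real
      have "norm (s *\<^sub>R ?a) \<le> 1" using that t(2)[of m] by (simp add: norm_axis_1)
      have "weight (x + s *\<^sub>R ?a) \<le> (1 + norm (s *\<^sub>R ?a)) ^ Suc CARD('n) * weight x"
        by (rule weight_shift)
      also have "\<dots> \<le> 2 ^ Suc CARD('n) * weight x"
        using \<open>norm (s *\<^sub>R ?a) \<le> 1\<close> by (intro mult_right_mono power_mono) auto
      finally have "C * weight (x + s *\<^sub>R ?a) \<le> B * weight x"
        using mult_left_mono[OF _ C(1)] unfolding B_def by (simp only: mult.assoc)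
      then have "norm (partial_deriv k \<eta> (x + s *\<^sub>R ?a)) \<le> B * weight x"
        using C(2) order_trans by blast
      then show "norm (h *\<^sub>R partial_deriv k \<eta> (x + s *\<^sub>R ?a)) \<le> B * weight x * norm h"
        by (simp add: mult.commute mult_left_mono)
    qed (use C in \<open>simp add: B_def\<close>)
    have "norm (\<eta> (x + t m *\<^sub>R ?a) - \<eta> (x + 0 *\<^sub>R ?a)) \<le> B * weight x * norm (t m - 0)"
      by (rule differentiable_bound[where S = "{0..t m}" and f = "\<lambda>s. \<eta> (x + s *\<^sub>R ?a)", OF _ der on]) (use t(1)[of m] in auto)
    moreover have "norm (d m x) = norm (\<eta> (x + t m *\<^sub>R ?a) - \<eta> x) / t m"
      using t(1)[of m] by (simp add: d_def divide_inverse mult.commute)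
    ultimately show ?thesis
      using t(1)[of m] by (simp add: pos_divide_le_eq mult_ac)
  qed
  have md [measurable]: "d m \<in> borel_measurable borel" for m
    unfolding d_def[abs_def] by measurable
  have F1: "fourier (d m) \<xi> = (exp (\<i> * complex_of_real (t m * \<xi> $ k)) - 1) / complex_of_real (t m) * fourier \<eta> \<xi>" for m
  proof -
    have i: "integrable lborel (\<lambda>x. \<eta> (x + t m *\<^sub>R ?a))"
    proof -
      obtain D where D: "D \<ge> 0" "\<And>x. norm (\<eta> x) \<le> D * weight x"
        using schwartz_weight0[OF \<eta>] by blast
      show ?thesis
      proof (rule integrable_dominated_by_weight)
        fix x show "norm (\<eta> (x + t m *\<^sub>R ?a)) \<le> D * (1 + norm (t m *\<^sub>R ?a)) ^ Suc CARD('n) * weight x"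
          using D(2)[of "x + t m *\<^sub>R ?a"] mult_left_mono[OF weight_shift[of x "t m *\<^sub>R ?a"] D(1)]
          by (simp add: mult.assoc)
      qed measurable
    qed
    have "fourier (d m) \<xi> = fourier (\<lambda>x. complex_of_real (1 / t m) * (\<eta> (x + t m *\<^sub>R ?a) - \<eta> x)) \<xi>"
      by (simp add: d_def[abs_def] scaleR_conv_of_real divide_inverse)
    also have "\<dots> = complex_of_real (1 / t m) * (fourier (\<lambda>x. \<eta> (x + t m *\<^sub>R ?a)) \<xi> - fourier \<eta> \<xi>)"
    proof -
      have "(\<lambda>x. \<eta> (x + t m *\<^sub>R ?a) - \<eta> x) \<in> borel_measurable borel" by measurable
      from fourier_cmult[OF this] show ?thesis
        by (simp only: fourier_diff[OF i schwartz_integrable[OF \<eta>]])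
    qed
    also have "\<dots> = (exp (\<i> * complex_of_real (t m * \<xi> $ k)) - 1) / complex_of_real (t m) * fourier \<eta> \<xi>"
      by (simp add: fourier_translation inner_axis' left_diff_distrib right_diff_distrib divide_inverse mult_ac)
    finally show ?thesis .
  qed
  have lim1: "(\<lambda>m. fourier (d m) \<xi>) \<longlonglongrightarrow> \<i> * complex_of_real (\<xi> $ k) * fourier \<eta> \<xi>"
  proof -
    have "((\<lambda>s. exp (\<i> * complex_of_real (s * \<xi> $ k))) has_vector_derivative \<i> * complex_of_real (\<xi> $ k)) (at 0)"
      using exp_scaleR_has_vector_derivative_right[of "\<i> * complex_of_real (\<xi> $ k)" 0 UNIV]
      by (simp add: scaleR_conv_of_real mult.left_commute)
    then have "((\<lambda>s. (exp (\<i> * complex_of_real (s * \<xi> $ k)) - 1) /\<^sub>R s) \<longlongrightarrow> \<i> * complex_of_real (\<xi> $ k)) (at 0)"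
      using has_vector_derivative_imp_quotient_tendsto by fastforce
    from filterlim_compose[OF this t0']
    have "(\<lambda>m. (exp (\<i> * complex_of_real (t m * \<xi> $ k)) - 1) / complex_of_real (t m)) \<longlonglongrightarrow> \<i> * complex_of_real (\<xi> $ k)"
      by (simp add: scaleR_conv_of_real divide_inverse mult.commute)
    then show ?thesis
      unfolding F1 by (intro tendsto_mult tendsto_const)
  qed
  have lim2: "(\<lambda>m. fourier (d m) \<xi>) \<longlonglongrightarrow> fourier (partial_deriv k \<eta>) \<xi>"
  proof -
    have "(\<lambda>m. \<integral>x. d m x * exp (- \<i> * complex_of_real (x \<bullet> \<xi>)) \<partial>lborel)
        \<longlonglongrightarrow> (\<integral>x. partial_deriv k \<eta> x * exp (- \<i> * complex_of_real (x \<bullet> \<xi>)) \<partial>lborel)"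
    proof (rule integral_dominated_convergence[where w = "\<lambda>x. B * weight x"])
      show "integrable lborel (\<lambda>x. B * weight x :: real)"
        by (intro integrable_mult_right integrable_weight)
      show "AE x in lborel. (\<lambda>m. d m x * exp (- \<i> * complex_of_real (x \<bullet> \<xi>))) \<longlonglongrightarrow>
          partial_deriv k \<eta> x * exp (- \<i> * complex_of_real (x \<bullet> \<xi>))"
      proof (intro AE_I2 tendsto_mult tendsto_const)
        fix x
        have "((\<lambda>s. (\<eta> (x + s *\<^sub>R ?a) - \<eta> x) /\<^sub>R s) \<longlongrightarrow> partial_deriv k \<eta> x) (at 0)"
          using has_vector_derivative_imp_quotient_tendsto[OF vd[of x 0, simplified]] by simp
        from filterlim_compose[OF this t0']
        show "(\<lambda>m. d m x) \<longlonglongrightarrow> partial_deriv k \<eta> x"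
          by (simp add: d_def)
      qed
      show "AE x in lborel. norm (d m x * exp (- \<i> * complex_of_real (x \<bullet> \<xi>))) \<le> B * weight x" for m
        using bd by (simp add: norm_mult)
    qed measurable
    then show ?thesis
      by (simp only: fourier_lborel[OF md] fourier_lborel[OF \<open>partial_deriv k \<eta> \<in> borel_measurable borel\<close>] tendsto_mult tendsto_const)
  qed
  show ?thesis
    by (rule LIMSEQ_unique[OF lim2 lim1])
qed

text \<open>Trading a factor \<open>1 + |\<xi>|\<close> for one derivative at a time.\<close>

lemma fourier_family_decay:
  fixes \<eta> :: "'i \<Rightarrow> real^'n::finite \<Rightarrow> complex"
  assumes "schw_fam \<epsilon> \<eta>" "\<And>i. \<epsilon> i \<ge> 0"
  shows "\<exists>C\<ge>0. \<forall>i \<xi>. (1 + norm \<xi>) ^ N * norm (fourier (\<eta> i) \<xi>) \<le> C * \<epsilon> i"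
  using assms(1)
proof (induction N arbitrary: \<eta>)
  case 0
  obtain C where C: "C \<ge> 0" "\<And>i x. norm (\<eta> i x) \<le> C * \<epsilon> i * weight x"
    using schw_fam_weight[OF 0 assms(2), of 0 "[]"] by auto
  define I where "I = (\<integral>x. weight (x::real^'n) \<partial>lborel)"
  have "norm (fourier (\<eta> i) \<xi>) \<le> fourier_const TYPE('n) * (C * I) * \<epsilon> i" for i \<xi>
  proof -
    have "norm (fourier (\<eta> i) \<xi>) \<le> fourier_const TYPE('n) * (\<integral>x. norm (\<eta> i x) \<partial>lborel)"
      by (rule norm_fourier_le[OF schwartz_integrable[OF schw_fam_schwartz[OF 0]]])
    also have "(\<integral>x. norm (\<eta> i x) \<partial>lborel) \<le> (\<integral>x. C * \<epsilon> i * weight (x::real^'n) \<partial>lborel)"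
    proof (rule integral_mono)
      show "integrable lborel (\<lambda>x. norm (\<eta> i x))"
        by (intro integrable_norm schwartz_integrable schw_fam_schwartz[OF 0])
      show "integrable lborel (\<lambda>x::real^'n. C * \<epsilon> i * weight x)"
        by (intro integrable_mult_right integrable_weight)
    qed (rule C(2))
    also have "\<dots> = C * I * \<epsilon> i"
      by (simp add: I_def)
    finally show ?thesis
      by (simp add: mult_left_mono mult.assoc)
  qed
  moreover have "fourier_const TYPE('n) * (C * I) \<ge> 0"
    using C by (simp add: I_def)
  ultimately show ?case by auto
next
  case (Suc N)
  have "\<exists>D. \<forall>k. D k \<ge> 0 \<and> (\<forall>i \<xi>. (1 + norm \<xi>) ^ N * norm (fourier (partial_deriv k (\<eta> i)) \<xi>) \<le> D k * \<epsilon> i)"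
    by (intro choice allI) (use Suc.IH[OF schw_fam_partial_deriv[OF Suc.prems]] in blast)
  then obtain D where D: "\<And>k. D k \<ge> 0"
    "\<And>k i \<xi>. (1 + norm \<xi>) ^ N * norm (fourier (partial_deriv k (\<eta> i)) \<xi>) \<le> D k * \<epsilon> i"
    by blast
  obtain C where C: "C \<ge> 0" "\<And>i \<xi>. (1 + norm \<xi>) ^ N * norm (fourier (\<eta> i) \<xi>) \<le> C * \<epsilon> i"
    using Suc.IH[OF Suc.prems] by blast
  have "(1 + norm \<xi>) ^ Suc N * norm (fourier (\<eta> i) \<xi>) \<le> (C + (\<Sum>k\<in>UNIV. D k)) * \<epsilon> i" for i \<xi>
  proof -
    let ?a = "(1 + norm \<xi>) ^ N" and ?b = "norm (fourier (\<eta> i) \<xi>)"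
    have "norm \<xi> \<le> (\<Sum>k\<in>UNIV. \<bar>\<xi> $ k\<bar>)" by (rule norm_le_l1_cart)
    then have "(1 + norm \<xi>) * (?a * ?b) \<le> (1 + (\<Sum>k\<in>UNIV. \<bar>\<xi> $ k\<bar>)) * (?a * ?b)"
      by (intro mult_right_mono) auto
    also have "\<dots> = ?a * ?b + (\<Sum>k\<in>UNIV. ?a * (\<bar>\<xi> $ k\<bar> * ?b))"
      by (simp add: distrib_right sum_distrib_right distrib_left sum_distrib_left mult.left_commute)
    also have "\<dots> = ?a * ?b + (\<Sum>k\<in>UNIV. ?a * norm (fourier (partial_deriv k (\<eta> i)) \<xi>))"
      by (simp add: fourier_partial_deriv[OF schw_fam_schwartz[OF Suc.prems]] norm_mult)
    also have "\<dots> \<le> C * \<epsilon> i + (\<Sum>k\<in>UNIV. D k * \<epsilon> i)"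
      by (intro add_mono sum_mono C(2) D(2))
    also have "\<dots> = (C + (\<Sum>k\<in>UNIV. D k)) * \<epsilon> i"
      by (simp add: distrib_right sum_distrib_right)
    finally show ?thesis by (simp add: mult.assoc)
  qed
  moreover have "C + (\<Sum>k\<in>UNIV. D k) \<ge> 0"
    using C D by (simp add: sum_nonneg)
  ultimately show ?case by blast
qed

text \<open>The innermost derivative of the transform turns into multiplication of \<eta> by a
  coordinate, which keeps the family Schwartz; this reduces everything to the decay without
  derivatives. Uniformity in the index is what lets a vanishing family stay vanishing under the
  transform.\<close>

lemma schw_fam_fourier:
  fixes \<eta> :: "'i \<Rightarrow> real^'n::finite \<Rightarrow> complex"
  assumes "schw_fam \<epsilon> \<eta>" "\<And>i. \<epsilon> i \<ge> 0"
  shows "schw_fam \<epsilon> (\<lambda>i. fourier (\<eta> i))"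
  unfolding schw_fam_def
proof (intro conjI allI)
  show "smooth (fourier (\<eta> i))" for i
    by (rule smooth_fourier[OF schw_fam_schwartz[OF assms(1)]])
  fix ks N
  show "\<exists>C. \<forall>i x. (1 + norm x) ^ N * norm (partial_derivs ks (fourier (\<eta> i)) x) \<le> C * \<epsilon> i"
    using assms(1)
  proof (induction ks arbitrary: \<eta> rule: rev_induct)
    case Nil
    then show ?case using fourier_family_decay[OF Nil assms(2), of N] by auto
  next
    case (snoc k ks)
    have "schw_fam \<epsilon> (\<lambda>i x. - \<i> * (complex_of_real (x $ k) * \<eta> i x))"
      by (intro schw_fam_cmult schw_fam_mult poly_fam_coordinate snoc.prems assms(2))
    from snoc.IH[OF this] show ?case
      by (simp only: partial_derivs_append partial_derivs.simps
          partial_deriv_fourier[OF schw_fam_schwartz[OF snoc.prems]])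
  qed
qed

lemma schwartz_fourier:
  assumes "\<eta> \<in> schwartz"
  shows "fourier \<eta> \<in> schwartz"
  using schw_fam_fourier[of "\<lambda>i::unit. 1" "\<lambda>i. \<eta>"] assms
  by (simp add: schwartz_iff_schw_fam[symmetric])

lemma schwartz_affine:
  fixes \<eta> :: "real^'n::finite \<Rightarrow> complex"
  assumes \<eta>: "\<eta> \<in> schwartz" and a: "a \<noteq> 0"
  shows "(\<lambda>x. \<eta> (a *\<^sub>R x + b)) \<in> schwartz"
  unfolding schwartz_iff
proof (intro conjI allI)
  have s: "smooth \<eta>" by (rule schwartz_smooth[OF \<eta>])
  show "smooth (\<lambda>x. \<eta> (a *\<^sub>R x + b))" by (rule smooth_affine[OF s])
  fix ks N
  obtain C where C: "\<And>x. (1 + norm x) ^ N * norm (partial_derivs ks \<eta> x) \<le> C"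
    using \<eta> unfolding schwartz_iff by blast
  \<comment> \<open>\<open>K\<close> bounds the quotient of \<open>1 + norm x\<close> by
    \<open>1 + norm (a *\<^sub>R x + b)\<close>, so a power of the weight at \<open>x\<close> can be
    exchanged for one at the transformed point.\<close>
  define K where "K = (1 + norm b) * (1 + 1 / \<bar>a\<bar>)"
  have "(1 + norm x) ^ N * norm (partial_derivs ks (\<lambda>x. \<eta> (a *\<^sub>R x + b)) x) \<le> K ^ N * \<bar>a\<bar> ^ length ks * C" for x
  proof -
    let ?y = "a *\<^sub>R x + b"
    have "\<bar>a\<bar> * norm x \<le> norm ?y + norm b"
      using norm_triangle_ineq4[of ?y b] by simp
    then have "norm x \<le> (norm ?y + norm b) / \<bar>a\<bar>"
      using a by (simp add: field_simps)
    also have "\<dots> \<le> (1 + norm ?y) * (1 + norm b) * (1 / \<bar>a\<bar>)"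
    proof -
      have "norm ?y + norm b \<le> (1 + norm ?y) * (1 + norm b)"
        by (simp add: algebra_simps)
      then show ?thesis
        using divide_right_mono[of _ _ "\<bar>a\<bar>"] by fastforce
    qed
    also have "1 + (1 + norm ?y) * (1 + norm b) * (1 / \<bar>a\<bar>) \<le> (1 + norm ?y) * (1 + norm b) * (1 + 1 / \<bar>a\<bar>)"
      by (simp add: algebra_simps)
    finally have "1 + norm x \<le> K * (1 + norm ?y)"
      by (simp add: K_def mult_ac)
    then have "(1 + norm x) ^ N \<le> K ^ N * (1 + norm ?y) ^ N"
      by (metis norm_ge_zero add_nonneg_nonneg power_mono power_mult_distrib zero_le_one)
    then have "(1 + norm x) ^ N * norm (partial_derivs ks \<eta> ?y) \<le> K ^ N * ((1 + norm ?y) ^ N * norm (partial_derivs ks \<eta> ?y))"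
      by (metis mult.assoc mult_right_mono norm_ge_zero)
    also have "\<dots> \<le> K ^ N * C"
      using C a by (intro mult_left_mono) (auto simp: K_def)
    finally have "\<bar>a\<bar> ^ length ks * ((1 + norm x) ^ N * norm (partial_derivs ks \<eta> ?y)) \<le> \<bar>a\<bar> ^ length ks * (K ^ N * C)"
      by (rule mult_left_mono) simp
    then show ?thesis
      by (simp add: partial_derivs_affine[OF s] power_abs mult_ac)
  qed
  then show "\<exists>C. \<forall>x. (1 + norm x) ^ N * norm (partial_derivs ks (\<lambda>x. \<eta> (a *\<^sub>R x + b)) x) \<le> C"
    by blast
qed

section \<open>Fourier inversion\<close>

lemma lborel_nn_integral_affine:
  fixes f :: "'a::euclidean_space \<Rightarrow> ennreal"
  assumes [measurable]: "f \<in> borel_measurable borel" and c: "c \<noteq> 0"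
  shows "(\<integral>\<^sup>+x. f x \<partial>lborel) = ennreal (\<bar>c\<bar> ^ DIM('a)) * (\<integral>\<^sup>+x. f (t + c *\<^sub>R x) \<partial>lborel)"
  by (subst lborel_affine[OF c, of t]) (simp add: nn_integral_density nn_integral_distr nn_integral_cmult ennreal_power)

lemma lborel_integral_affine:
  fixes f :: "'a::euclidean_space \<Rightarrow> 'b::{banach, second_countable_topology}"
  assumes [measurable]: "f \<in> borel_measurable borel" and c: "c \<noteq> 0"
  shows "(\<integral>x. f x \<partial>lborel) = (\<bar>c\<bar> ^ DIM('a)) *\<^sub>R (\<integral>x. f (t + c *\<^sub>R x) \<partial>lborel)"
  by (subst lborel_affine[OF c, of t]) (simp add: integral_density integral_distr)

lemma fourier_dilation:
  fixes \<phi> :: "real^'n::finite \<Rightarrow> complex"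
  assumes [measurable]: "\<phi> \<in> borel_measurable borel" and a: "a \<noteq> 0"
  shows "fourier (\<lambda>x. \<phi> (a *\<^sub>R x)) \<xi> = fourier \<phi> ((1 / a) *\<^sub>R \<xi>) / complex_of_real (\<bar>a\<bar> ^ CARD('n))"
proof -
  have "(\<integral>x. \<phi> x * exp (- \<i> * complex_of_real (x \<bullet> ((1 / a) *\<^sub>R \<xi>))) \<partial>lborel) =
     (\<bar>a\<bar> ^ CARD('n)) *\<^sub>R (\<integral>x. \<phi> (a *\<^sub>R x) * exp (- \<i> * complex_of_real (x \<bullet> \<xi>)) \<partial>lborel)"
    using a by (subst lborel_integral_affine[OF _ a, of _ 0]) auto
  moreover have m: "(\<lambda>x. \<phi> (a *\<^sub>R x)) \<in> borel_measurable borel" by measurable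
  ultimately show ?thesis
    unfolding fourier_lborel[OF assms(1)] fourier_lborel[OF m] using a
    by (simp add: scaleR_conv_of_real[where 'a = complex])
qed

lemma fubini_swap:
  fixes f :: "'a::euclidean_space \<times> 'b::euclidean_space \<Rightarrow> 'c::{banach, second_countable_topology}"
  assumes [measurable]: "f \<in> borel_measurable (lborel \<Otimes>\<^sub>M lborel)"
    and fin: "(\<integral>\<^sup>+x. \<integral>\<^sup>+y. ennreal (norm (f (x, y))) \<partial>lborel \<partial>lborel) < \<infinity>"
  shows "(\<integral>x. \<integral>y. f (x, y) \<partial>lborel \<partial>lborel) = (\<integral>y. \<integral>x. f (x, y) \<partial>lborel \<partial>lborel)"
proof -
  have "integrable (lborel \<Otimes>\<^sub>M lborel) f"
    using fin by (simp add: integrable_iff_bounded lborel.nn_integral_fst[symmetric])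
  then show ?thesis
    using lborel_pair.Fubini_integral[of "\<lambda>x y. f (x, y)"] by simp
qed

lemma nn_integral_norm_finite:
  fixes f :: "'a \<Rightarrow> 'b::{banach, second_countable_topology}"
  assumes "integrable M f"
  shows "(\<integral>\<^sup>+x. ennreal (norm (f x)) \<partial>M) < \<infinity>"
  using assms by (simp add: integrable_iff_bounded)

text \<open>The bilinear exponential has modulus one, so Fubini applies to any two integrable functions.\<close>

lemma fubini_cis:
  fixes \<phi> \<eta> :: "real^'n::finite \<Rightarrow> complex"
  assumes \<phi>: "integrable lborel \<phi>" and \<eta>: "integrable lborel \<eta>"
    and e: "e \<in> borel_measurable (lborel \<Otimes>\<^sub>M lborel)" "\<And>p. norm (e p) = 1"
  shows "(\<integral>x. \<phi> x * (\<integral>y. \<eta> y * e (x, y) \<partial>lborel) \<partial>lborel) = (\<integral>y. \<eta> y * (\<integral>x. \<phi> x * e (x, y) \<partial>lborel) \<partial>lborel)"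
proof -
  note [measurable] = borel_measurable_integrable[OF \<phi>] borel_measurable_integrable[OF \<eta>] e(1)
  have "(\<integral>x. \<integral>y. \<phi> x * \<eta> y * e (x, y) \<partial>lborel \<partial>lborel) = (\<integral>y. \<integral>x. \<phi> x * \<eta> y * e (x, y) \<partial>lborel \<partial>lborel)"
  proof -
    have m: "(\<lambda>(x, y). \<phi> x * \<eta> y * e (x, y)) \<in> borel_measurable (lborel \<Otimes>\<^sub>M lborel)"
      by measurable
    have "(\<integral>\<^sup>+x. \<integral>\<^sup>+y. ennreal (norm (\<phi> x * \<eta> y * e (x, y))) \<partial>lborel \<partial>lborel) =
        (\<integral>\<^sup>+x. ennreal (norm (\<phi> x)) * (\<integral>\<^sup>+y. ennreal (norm (\<eta> y)) \<partial>lborel) \<partial>lborel)"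
      by (simp add: norm_mult e(2) ennreal_mult nn_integral_cmult)
    also have "\<dots> = (\<integral>\<^sup>+x. ennreal (norm (\<phi> x)) \<partial>lborel) * (\<integral>\<^sup>+y. ennreal (norm (\<eta> y)) \<partial>lborel)"
      by (rule nn_integral_multc) measurable
    also have "\<dots> < top"
      using nn_integral_norm_finite[OF \<phi>] nn_integral_norm_finite[OF \<eta>] by (simp add: ennreal_mult_less_top)
    finally show ?thesis
      using fubini_swap[OF m] by simp
  qed
  moreover have "(\<integral>y. \<phi> x * \<eta> y * e (x, y) \<partial>lborel) = \<phi> x * (\<integral>y. \<eta> y * e (x, y) \<partial>lborel)" for x
    by (simp only: mult.assoc integral_mult_right_zero)
  moreover have "(\<integral>x. \<phi> x * \<eta> y * e (x, y) \<partial>lborel) = \<eta> y * (\<integral>x. \<phi> x * e (x, y) \<partial>lborel)" for y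
    by (simp only: mult.assoc mult.left_commute[of _ "\<eta> y"] integral_mult_right_zero)
  ultimately show ?thesis by simp
qed

lemma fourier_multiplication_formula:
  fixes \<phi> \<eta> :: "real^'n::finite \<Rightarrow> complex"
  assumes "integrable lborel \<phi>" "integrable lborel \<eta>"
  shows "(\<integral>x. \<phi> x * fourier \<eta> x \<partial>lborel) = (\<integral>x. \<eta> x * fourier \<phi> x \<partial>lborel)"
proof -
  have [measurable]: "\<phi> \<in> borel_measurable borel" "\<eta> \<in> borel_measurable borel"
    using assms by auto
  have "(\<integral>x. \<phi> x * (\<integral>y. \<eta> y * exp (- \<i> * complex_of_real (x \<bullet> y)) \<partial>lborel) \<partial>lborel)
    = (\<integral>y. \<eta> y * (\<integral>x. \<phi> x * exp (- \<i> * complex_of_real (x \<bullet> y)) \<partial>lborel) \<partial>lborel)"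
    using fubini_cis[OF assms, of "\<lambda>p. exp (- \<i> * complex_of_real (fst p \<bullet> snd p))"] by simp
  then have eq: "(\<integral>x. \<phi> x * (\<integral>y. \<eta> y * exp (- \<i> * complex_of_real (y \<bullet> x)) \<partial>lborel) \<partial>lborel)
    = (\<integral>y. \<eta> y * (\<integral>x. \<phi> x * exp (- \<i> * complex_of_real (x \<bullet> y)) \<partial>lborel) \<partial>lborel)"
    by (simp only: inner_commute)
  show ?thesis
    by (simp only: fourier_lborel[OF \<open>\<phi> \<in> borel_measurable borel\<close>] fourier_lborel[OF \<open>\<eta> \<in> borel_measurable borel\<close>]
        mult.left_commute[of _ "complex_of_real (fourier_const TYPE('n))"] integral_mult_right_zero eq)
qed

section \<open>Gaussians: one dimension and products over the coordinates\<close>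

lemma lborel_integral_product:
  fixes f :: "'a::euclidean_space \<Rightarrow> real \<Rightarrow> complex"
  assumes f: "\<And>b. b \<in> Basis \<Longrightarrow> integrable lborel (f b)"
  shows "integrable lborel (\<lambda>x::'a. \<Prod>b\<in>Basis. f b (x \<bullet> b))"
    and "(\<integral>x. (\<Prod>b\<in>Basis. f b (x \<bullet> b)) \<partial>lborel) = (\<Prod>b\<in>Basis. \<integral>t. f b t \<partial>lborel)"
proof -
  interpret product_sigma_finite "\<lambda>_::'a. lborel :: real measure" by standard
  define T :: "('a \<Rightarrow> real) \<Rightarrow> 'a" where "T g = (\<Sum>b\<in>Basis. g b *\<^sub>R b)" for g
  have T [measurable]: "T \<in> (\<Pi>\<^sub>M b\<in>Basis. lborel) \<rightarrow>\<^sub>M borel"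
    unfolding T_def[abs_def] by measurable
  have l: "lborel = distr (\<Pi>\<^sub>M b\<in>Basis. lborel) borel T"
    unfolding T_def[abs_def] by (rule lborel_eq)
  have Tb: "(\<Prod>b\<in>Basis. f b (T g \<bullet> b)) = (\<Prod>b\<in>Basis. f b (g b))" for g
    by (intro prod.cong refl) (simp add: T_def)
  have m [measurable]: "(\<lambda>x::'a. \<Prod>b\<in>Basis. f b (x \<bullet> b)) \<in> borel_measurable borel"
  proof (rule borel_measurable_prod)
    fix b :: 'a assume "b \<in> Basis"
    then have [measurable]: "f b \<in> borel_measurable borel" using f by auto
    show "(\<lambda>x. f b (x \<bullet> b)) \<in> borel_measurable borel" by measurable
  qed
  show "integrable lborel (\<lambda>x::'a. \<Prod>b\<in>Basis. f b (x \<bullet> b))"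
    by (subst l, subst integrable_distr_eq[OF T m]) (simp add: Tb product_integrable_prod f)
  show "(\<integral>x. (\<Prod>b\<in>Basis. f b (x \<bullet> b)) \<partial>lborel) = (\<Prod>b\<in>Basis. \<integral>t. f b t \<partial>lborel)"
    by (subst l, subst integral_distr[OF T m]) (simp add: Tb product_integral_prod f)
qed

text \<open>Up to the factor \<open>sqrt (2 * pi)\<close> the integral is the characteristic
  function of the standard normal distribution, whose value is known from probability
  theory.\<close>

lemma gaussian_fourier_1:
  "integrable lborel (\<lambda>t. complex_of_real (exp (- t\<^sup>2 / 2)) * exp (- \<i> * complex_of_real (t * \<xi>)))"
  "(\<integral>t. complex_of_real (exp (- t\<^sup>2 / 2)) * exp (- \<i> * complex_of_real (t * \<xi>)) \<partial>lborel)
     = complex_of_real (sqrt (2 * pi) * exp (- \<xi>\<^sup>2 / 2))"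
proof -
  have eq: "complex_of_real (exp (- t\<^sup>2 / 2)) * exp (- \<i> * complex_of_real (t * \<xi>))
      = complex_of_real (sqrt (2 * pi)) * (std_normal_density t *\<^sub>R iexp (- \<xi> * t))" for t
    by (simp add: std_normal_density_def scaleR_conv_of_real mult_ac)
  have "integrable lborel (\<lambda>t. std_normal_density t *\<^sub>R iexp (- \<xi> * t))"
    by (rule Bochner_Integration.integrable_bound[of lborel std_normal_density])
      (use integrable_normal_density[of 1 0] in auto)
  then show "integrable lborel (\<lambda>t. complex_of_real (exp (- t\<^sup>2 / 2)) * exp (- \<i> * complex_of_real (t * \<xi>)))"
    unfolding eq by (rule integrable_mult_right)
  have "(\<integral>t. std_normal_density t *\<^sub>R iexp (- \<xi> * t) \<partial>lborel) = char std_normal_distribution (- \<xi>)"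
    unfolding char_def by (subst integral_density) auto
  also have "\<dots> = complex_of_real (exp (- \<xi>\<^sup>2 / 2))"
    by (simp add: char_std_normal_distribution)
  finally show "(\<integral>t. complex_of_real (exp (- t\<^sup>2 / 2)) * exp (- \<i> * complex_of_real (t * \<xi>)) \<partial>lborel)
     = complex_of_real (sqrt (2 * pi) * exp (- \<xi>\<^sup>2 / 2))"
    unfolding eq by (simp only: integral_mult_right_zero) simp
qed

definition gaussian :: "real^'n::finite \<Rightarrow> complex" where
  "gaussian x = complex_of_real (exp (- (norm x)\<^sup>2 / 2))"

lemma gaussian_measurable [measurable]: "gaussian \<in> borel_measurable borel"
  unfolding gaussian_def[abs_def] by measurable

lemma gaussian_product:
  "gaussian x * exp (- \<i> * complex_of_real (x \<bullet> \<xi>)) =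
    (\<Prod>b\<in>Basis. complex_of_real (exp (- (x \<bullet> b)\<^sup>2 / 2)) * exp (- \<i> * complex_of_real ((x \<bullet> b) * (\<xi> \<bullet> b))))"
proof -
  have "(norm x)\<^sup>2 = (\<Sum>b\<in>Basis. (x \<bullet> b)\<^sup>2)"
    by (subst power2_norm_eq_inner, subst euclidean_inner) (simp add: power2_eq_square)
  then have "- (norm x)\<^sup>2 / 2 = (\<Sum>b\<in>Basis. - (x \<bullet> b)\<^sup>2 / 2)"
    by (simp add: sum_negf sum_divide_distrib)
  then have 1: "gaussian x = (\<Prod>b\<in>Basis. complex_of_real (exp (- (x \<bullet> b)\<^sup>2 / 2)))"
    unfolding gaussian_def by (simp only: exp_sum[OF finite_Basis] of_real_prod)
  have "- \<i> * complex_of_real (x \<bullet> \<xi>) = (\<Sum>b\<in>Basis. - \<i> * complex_of_real ((x \<bullet> b) * (\<xi> \<bullet> b)))"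
    by (simp add: euclidean_inner[of x \<xi>] sum_distrib_left sum_negf)
  then have 2: "exp (- \<i> * complex_of_real (x \<bullet> \<xi>)) = (\<Prod>b\<in>Basis. exp (- \<i> * complex_of_real ((x \<bullet> b) * (\<xi> \<bullet> b))))"
    by (simp only: exp_sum[OF finite_Basis])
  show ?thesis unfolding 1 2 by (rule prod.distrib[symmetric])
qed

lemma gaussian_integrable: "integrable lborel (gaussian :: real^'n::finite \<Rightarrow> complex)"
proof -
  have "gaussian = (\<lambda>x::real^'n. \<Prod>b\<in>Basis. complex_of_real (exp (- ((x \<bullet> b)\<^sup>2 / 2))))"
    using gaussian_product[of _ 0] by (intro ext) simp
  then show ?thesis
    using lborel_integral_product(1)[OF gaussian_fourier_1(1), of "\<lambda>b::real^'n. 0 \<bullet> b"] by simp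
qed

lemma fourier_const_power: "fourier_const TYPE('n::finite) * sqrt (2 * pi) ^ CARD('n) = 1"
proof -
  have "sqrt (2 * pi) ^ CARD('n) = (2 * pi) powr (real CARD('n) / 2)"
    by (simp add: powr_half_sqrt[symmetric] powr_power)
  then show ?thesis
    by (simp add: powr_add[symmetric])
qed

lemma fourier_gaussian: "fourier gaussian = (gaussian :: real^'n::finite \<Rightarrow> complex)"
proof
  fix \<xi> :: "real^'n"
  have "(\<integral>x. gaussian x * exp (- \<i> * complex_of_real (x \<bullet> \<xi>)) \<partial>lborel)
      = (\<Prod>b\<in>Basis. complex_of_real (sqrt (2 * pi) * exp (- (\<xi> \<bullet> b)\<^sup>2 / 2)))"
    unfolding gaussian_product by (subst lborel_integral_product(2)) (simp_all only: gaussian_fourier_1)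
  also have "\<dots> = complex_of_real (sqrt (2 * pi) ^ CARD('n)) * gaussian \<xi>"
    using gaussian_product[of \<xi> 0] by (simp add: prod.distrib)
  finally have "fourier gaussian \<xi> = complex_of_real (fourier_const TYPE('n) * sqrt (2 * pi) ^ CARD('n)) * gaussian \<xi>"
    by (simp add: fourier_lborel)
  then show "fourier gaussian \<xi> = gaussian \<xi>"
    unfolding fourier_const_power by simp
qed

lemma integral_gaussian:
  "complex_of_real (fourier_const TYPE('n::finite)) * (\<integral>x. gaussian (x::real^'n) \<partial>lborel) = 1"
proof -
  have "fourier gaussian (0::real^'n) = 1"
    by (simp add: fourier_gaussian gaussian_def)
  then show ?thesis by (simp add: fourier_lborel)
qed

text \<open>Gaussian regularisation. The transform of \<theta> is integrated against a Gaussian that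
  flattens to 1. By the multiplication formula, and because the Gaussian is its own transform, this
  equals the integral of \<theta> against a Gaussian that concentrates at 0. Both sides converge by
  dominated convergence. Inversion at other points follows by translating \<theta>.\<close>

lemma fourier_inversion_at_0:
  fixes \<theta> :: "real^'n::finite \<Rightarrow> complex"
  assumes \<theta>: "\<theta> \<in> schwartz"
  shows "complex_of_real (fourier_const TYPE('n)) * (\<integral>\<xi>. fourier \<theta> \<xi> \<partial>lborel) = \<theta> 0"
proof -
  define t :: "nat \<Rightarrow> real" where "t m = 1 / real (Suc m)" for m
  have t: "t m > 0" "t m \<noteq> 0" for m by (auto simp: t_def)
  have t0: "t \<longlonglongrightarrow> 0" unfolding t_def by (rule LIMSEQ_Suc[OF lim_1_over_n])
  have [measurable]: "\<theta> \<in> borel_measurable borel" "fourier \<theta> \<in> borel_measurable borel"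
    by (auto intro!: schwartz_measurable schwartz_fourier \<theta>)
  have iF: "integrable lborel (fourier \<theta>)"
    by (intro schwartz_integrable schwartz_fourier \<theta>)
  obtain C where C: "\<And>x. norm (\<theta> x) \<le> C"
    using \<theta> unfolding schwartz_iff by (metis (no_types) mult_1 partial_derivs.simps(1) power_0)
  have ig: "integrable lborel (\<lambda>\<xi>::real^'n. gaussian (t m *\<^sub>R \<xi>))" for m
  proof -
    have "(\<integral>\<^sup>+\<xi>. ennreal (norm (gaussian (\<xi>::real^'n))) \<partial>lborel)
        = ennreal (\<bar>t m\<bar> ^ CARD('n)) * (\<integral>\<^sup>+\<xi>. ennreal (norm (gaussian (t m *\<^sub>R (\<xi>::real^'n)))) \<partial>lborel)"
      using lborel_nn_integral_affine[OF _ t(2), of "\<lambda>\<xi>::real^'n. ennreal (norm (gaussian \<xi>))" m 0] by simp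
    then have "ennreal (\<bar>t m\<bar> ^ CARD('n)) * (\<integral>\<^sup>+\<xi>. ennreal (norm (gaussian (t m *\<^sub>R (\<xi>::real^'n)))) \<partial>lborel) < \<infinity>"
      using nn_integral_norm_finite[OF gaussian_integrable] by metis
    then have "(\<integral>\<^sup>+\<xi>. ennreal (norm (gaussian (t m *\<^sub>R (\<xi>::real^'n)))) \<partial>lborel) < \<infinity>"
      using t(1)[of m] by (auto simp: ennreal_mult_less_top)
    then show ?thesis by (simp add: integrable_iff_bounded)
  qed
  have eq: "(\<integral>\<xi>. fourier \<theta> \<xi> * gaussian (t m *\<^sub>R \<xi>) \<partial>lborel) = (\<integral>x. \<theta> (t m *\<^sub>R x) * gaussian x \<partial>lborel)" for m
  proof -
    have "(\<integral>\<xi>. fourier \<theta> \<xi> * gaussian (t m *\<^sub>R \<xi>) \<partial>lborel) = (\<integral>x. \<theta> x * fourier (\<lambda>\<xi>. gaussian (t m *\<^sub>R \<xi>)) x \<partial>lborel)"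
      using fourier_multiplication_formula[OF schwartz_integrable[OF \<theta>] ig[of m]] by (simp add: mult.commute)
    also have "\<dots> = (\<integral>x. \<theta> x * (gaussian ((1 / t m) *\<^sub>R x) / complex_of_real (\<bar>t m\<bar> ^ CARD('n))) \<partial>lborel)"
      by (simp only: fourier_dilation[OF gaussian_measurable t(2)] fourier_gaussian)
    also have "\<dots> = (\<bar>t m\<bar> ^ CARD('n)) *\<^sub>R
        (\<integral>x. \<theta> (0 + t m *\<^sub>R x) * (gaussian ((1 / t m) *\<^sub>R (0 + t m *\<^sub>R x)) / complex_of_real (\<bar>t m\<bar> ^ CARD('n))) \<partial>lborel)"
      by (subst lborel_integral_affine[OF _ t(2), of _ m 0]) auto
    also have "\<dots> = (\<integral>x. \<theta> (t m *\<^sub>R x) * gaussian x \<partial>lborel)"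
      using t(2)[of m] by (simp add: scaleR_conv_of_real[where 'a = complex])
    finally show ?thesis .
  qed
  have lim1: "(\<lambda>m. \<integral>\<xi>. fourier \<theta> \<xi> * gaussian (t m *\<^sub>R \<xi>) \<partial>lborel) \<longlonglongrightarrow> (\<integral>\<xi>. fourier \<theta> \<xi> \<partial>lborel)"
  proof (rule integral_dominated_convergence[where w = "\<lambda>\<xi>. norm (fourier \<theta> \<xi>)"])
    show "integrable lborel (\<lambda>\<xi>. norm (fourier \<theta> \<xi>))" by (rule integrable_norm[OF iF])
    show "AE \<xi> in lborel. (\<lambda>m. fourier \<theta> \<xi> * gaussian (t m *\<^sub>R \<xi>)) \<longlonglongrightarrow> fourier \<theta> \<xi>"
    proof (rule AE_I2)
      fix \<xi> :: "real^'n"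
      have "(\<lambda>m. gaussian (t m *\<^sub>R \<xi>)) \<longlonglongrightarrow> complex_of_real (exp (- (norm (0 *\<^sub>R \<xi>))\<^sup>2 / 2))"
        unfolding gaussian_def by (intro tendsto_intros t0) auto
      then show "(\<lambda>m. fourier \<theta> \<xi> * gaussian (t m *\<^sub>R \<xi>)) \<longlonglongrightarrow> fourier \<theta> \<xi>"
        using tendsto_mult[OF tendsto_const, of _ 1 sequentially "fourier \<theta> \<xi>"] by simp
    qed
    show "AE \<xi> in lborel. norm (fourier \<theta> \<xi> * gaussian (t m *\<^sub>R \<xi>)) \<le> norm (fourier \<theta> \<xi>)" for m
      by (rule AE_I2) (simp add: norm_mult gaussian_def mult_left_le)
  qed measurable
  have lim2: "(\<lambda>m. \<integral>x. \<theta> (t m *\<^sub>R x) * gaussian x \<partial>lborel) \<longlonglongrightarrow> (\<integral>x. \<theta> 0 * gaussian (x::real^'n) \<partial>lborel)"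
  proof (rule integral_dominated_convergence[where w = "\<lambda>x. C * norm (gaussian x)"])
    show "integrable lborel (\<lambda>x::real^'n. C * norm (gaussian x))"
      by (intro integrable_mult_right integrable_norm gaussian_integrable)
    show "AE x in lborel. (\<lambda>m. \<theta> (t m *\<^sub>R x) * gaussian x) \<longlonglongrightarrow> \<theta> 0 * gaussian x"
    proof (intro AE_I2 tendsto_mult tendsto_const)
      fix x :: "real^'n"
      have "(\<lambda>m. t m *\<^sub>R x) \<longlonglongrightarrow> 0 *\<^sub>R x" by (intro tendsto_intros t0)
      moreover have "isCont \<theta> (0 *\<^sub>R x)"
        using smooth_continuous_on[OF schwartz_smooth[OF \<theta>]] continuous_on_eq_continuous_at by blast
      ultimately show "(\<lambda>m. \<theta> (t m *\<^sub>R x)) \<longlonglongrightarrow> \<theta> 0"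
        using isCont_tendsto_compose by fastforce
    qed
    show "AE x in lborel. norm (\<theta> (t m *\<^sub>R x) * gaussian x) \<le> C * norm (gaussian x)" for m
      by (rule AE_I2) (simp add: norm_mult mult_right_mono C)
  qed measurable
  have "(\<integral>\<xi>. fourier \<theta> \<xi> \<partial>lborel) = (\<integral>x. \<theta> 0 * gaussian (x::real^'n) \<partial>lborel)"
    using LIMSEQ_unique[OF lim1[unfolded eq] lim2] .
  then show ?thesis
    using integral_gaussian[where 'n = 'n] by (simp add: mult.left_commute)
qed

lemma inv_fourier_eq: "inv_fourier \<phi> x = fourier \<phi> (- x)"
  by (simp add: inv_fourier_def fourier_def inner_commute)

lemma schwartz_inv_fourier:
  assumes "\<phi> \<in> schwartz"
  shows "inv_fourier \<phi> \<in> schwartz"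
  using schwartz_affine[OF schwartz_fourier[OF assms], of "-1" 0]
  by (simp add: inv_fourier_eq[abs_def])

lemma inv_fourier_lborel:
  fixes \<phi> :: "real^'n::finite \<Rightarrow> complex"
  assumes "\<phi> \<in> borel_measurable borel"
  shows "inv_fourier \<phi> x = complex_of_real (fourier_const TYPE('n)) * (\<integral>\<xi>. \<phi> \<xi> * exp (\<i> * complex_of_real (x \<bullet> \<xi>)) \<partial>lborel)"
  unfolding inv_fourier_eq fourier_lborel[OF assms] by (simp add: inner_commute)

lemma inv_fourier_fourier:
  fixes \<theta> :: "real^'n::finite \<Rightarrow> complex"
  assumes \<theta>: "\<theta> \<in> schwartz"
  shows "inv_fourier (fourier \<theta>) x = \<theta> x"
proof -
  have m: "\<theta> \<in> borel_measurable borel" "fourier \<theta> \<in> borel_measurable borel"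
    by (auto intro!: schwartz_measurable schwartz_fourier \<theta>)
  have "(\<lambda>y. \<theta> (y + x)) \<in> schwartz"
    using schwartz_affine[OF \<theta>, of 1 x] by simp
  from fourier_inversion_at_0[OF this] show ?thesis
    by (simp add: fourier_translation[OF m(1)] inv_fourier_lborel[OF m(2)] mult.commute)
qed

lemma fourier_inv_fourier:
  fixes \<theta> :: "real^'n::finite \<Rightarrow> complex"
  assumes \<theta>: "\<theta> \<in> schwartz"
  shows "fourier (inv_fourier \<theta>) x = \<theta> x"
proof -
  have m: "fourier \<theta> \<in> borel_measurable borel"
    by (auto intro!: schwartz_measurable schwartz_fourier \<theta>)
  have "fourier (\<lambda>\<xi>. fourier \<theta> ((-1) *\<^sub>R \<xi>)) x = fourier (fourier \<theta>) (- x)"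
    using fourier_dilation[OF m, of "-1" x] by simp
  then show ?thesis
    using inv_fourier_fourier[OF \<theta>, of x] by (simp add: inv_fourier_eq[abs_def])
qed

section \<open>Convolution kernels of Fourier multipliers\<close>

text \<open>The use of \<open>fourier\<close> instead of \<open>inv_fourier\<close> makes this the
  reflection of the usual convolution kernel of \<open>\<theta>(D)\<close>; \<open>conv\<close>
  undoes the reflection. The constant is the one that the convolution theorem acquires under the
  symmetric normalisation of the transform.\<close>

definition multiplier_kernel :: "(real^'n::finite \<Rightarrow> complex) \<Rightarrow> real^'n \<Rightarrow> complex" where
  "multiplier_kernel \<theta> x = complex_of_real (fourier_const TYPE('n)) * fourier \<theta> x"

lemma kernel_schwartz: "\<theta> \<in> schwartz \<Longrightarrow> multiplier_kernel \<theta> \<in> schwartz"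
  unfolding multiplier_kernel_def[abs_def] by (intro schwartz_cmult schwartz_fourier)

text \<open>The convolution theorem for the transposed multiplier, that is, for what
  \<open>fourier_multiplier\<close> does to a test function before the distribution is
  applied.\<close>

lemma fourier_mult_inv_fourier:
  fixes \<theta> \<phi> :: "real^'n::finite \<Rightarrow> complex"
  assumes \<theta>: "\<theta> \<in> schwartz" and \<phi>: "\<phi> \<in> schwartz"
  shows "fourier (\<lambda>\<xi>. \<theta> \<xi> * inv_fourier \<phi> \<xi>) x = (\<integral>y. \<phi> y * multiplier_kernel \<theta> (x - y) \<partial>lborel)"
proof -
  let ?c = "complex_of_real (fourier_const TYPE('n))"
  have [measurable]: "\<theta> \<in> borel_measurable borel" "\<phi> \<in> borel_measurable borel" "inv_fourier \<phi> \<in> borel_measurable borel"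
    by (auto intro!: schwartz_measurable schwartz_inv_fourier \<theta> \<phi>)
  have "(\<integral>\<xi>. \<theta> \<xi> * (\<integral>y. \<phi> y * exp (\<i> * complex_of_real ((y - x) \<bullet> \<xi>)) \<partial>lborel) \<partial>lborel)
    = (\<integral>y. \<phi> y * (\<integral>\<xi>. \<theta> \<xi> * exp (\<i> * complex_of_real ((y - x) \<bullet> \<xi>)) \<partial>lborel) \<partial>lborel)"
    using fubini_cis[OF schwartz_integrable[OF \<theta>] schwartz_integrable[OF \<phi>],
        of "\<lambda>p. exp (\<i> * complex_of_real ((snd p - x) \<bullet> fst p))"] by simp
  note swap = this
  have k: "?c * (\<integral>\<xi>. \<theta> \<xi> * exp (\<i> * complex_of_real ((y - x) \<bullet> \<xi>)) \<partial>lborel) = fourier \<theta> (x - y)" for y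
    by (simp add: fourier_lborel inner_commute[of _ "x - y"]) (simp add: inner_diff_left algebra_simps)
  have e: "\<theta> \<xi> * (?c * (\<integral>y. \<phi> y * exp (\<i> * complex_of_real ((y - x) \<bullet> \<xi>)) \<partial>lborel))
     = \<theta> \<xi> * inv_fourier \<phi> \<xi> * exp (- \<i> * complex_of_real (x \<bullet> \<xi>))" for \<xi>
  proof -
    have "\<phi> y * exp (\<i> * complex_of_real ((y - x) \<bullet> \<xi>)) =
        \<phi> y * exp (\<i> * complex_of_real (\<xi> \<bullet> y)) * exp (- \<i> * complex_of_real (x \<bullet> \<xi>))" for y
      by (simp add: inner_diff_left inner_commute[of \<xi>] exp_add[symmetric] algebra_simps)
    then have "(\<integral>y. \<phi> y * exp (\<i> * complex_of_real ((y - x) \<bullet> \<xi>)) \<partial>lborel) =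
        (\<integral>y. \<phi> y * exp (\<i> * complex_of_real (\<xi> \<bullet> y)) \<partial>lborel) * exp (- \<i> * complex_of_real (x \<bullet> \<xi>))"
      by (simp only: integral_mult_left_zero)
    then show ?thesis
      by (simp only: inv_fourier_lborel[OF \<open>\<phi> \<in> borel_measurable borel\<close>] mult.assoc)
  qed
  have "fourier (\<lambda>\<xi>. \<theta> \<xi> * inv_fourier \<phi> \<xi>) x = ?c * (\<integral>\<xi>. \<theta> \<xi> * inv_fourier \<phi> \<xi> * exp (- \<i> * complex_of_real (x \<bullet> \<xi>)) \<partial>lborel)"
    by (subst fourier_lborel, measurable) (simp only: inner_commute)
  also have "\<dots> = ?c * (?c * (\<integral>\<xi>. \<theta> \<xi> * (\<integral>y. \<phi> y * exp (\<i> * complex_of_real ((y - x) \<bullet> \<xi>)) \<partial>lborel) \<partial>lborel))"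
  proof -
    have "\<theta> \<xi> * inv_fourier \<phi> \<xi> * exp (- \<i> * complex_of_real (x \<bullet> \<xi>)) =
        ?c * (\<theta> \<xi> * (\<integral>y. \<phi> y * exp (\<i> * complex_of_real ((y - x) \<bullet> \<xi>)) \<partial>lborel))" for \<xi>
      by (rule trans[OF e[symmetric] mult.left_commute])
    then show ?thesis
      by (simp only: integral_mult_right_zero)
  qed
  also have "\<dots> = (\<integral>y. \<phi> y * (?c * (?c * (\<integral>\<xi>. \<theta> \<xi> * exp (\<i> * complex_of_real ((y - x) \<bullet> \<xi>)) \<partial>lborel))) \<partial>lborel)"
    unfolding swap by (simp only: mult.left_commute[of "\<phi> _"] integral_mult_right_zero)
  finally show ?thesis
    unfolding k multiplier_kernel_def .
qed

section \<open>Locally integrable functions are determined by test functions\<close>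

text \<open>The positive and the negative part of \<open>h\<close> are densities of two measures
  that agree on boxes and are finite there. Boxes are stable under intersection and generate the
  Borel sets, so the measures and hence the densities agree. As \<open>ennreal\<close> sends
  negative numbers to 0, the two densities can only agree where \<open>h\<close> is 0.\<close>

lemma AE_zero_if_box_integrals_zero_real:
  fixes h :: "'a::euclidean_space \<Rightarrow> real"
  assumes [measurable]: "h \<in> borel_measurable borel"
    and int: "\<And>a b. integrable lborel (\<lambda>x. indicator (box a b) x *\<^sub>R h x)"
    and zero: "\<And>a b. (\<integral>x. indicator (box a b) x *\<^sub>R h x \<partial>lborel) = 0"
  shows "AE x in lborel. h x = 0"
proof -
  let ?f = "\<lambda>x. ennreal (h x)" and ?g = "\<lambda>x. ennreal (- h x)"
  have eq: "(\<integral>\<^sup>+x. ?f x * indicator (box a b) x \<partial>lborel) = (\<integral>\<^sup>+x. ?g x * indicator (box a b) x \<partial>lborel)"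
    and fin: "(\<integral>\<^sup>+x. ?f x * indicator (box a b) x \<partial>lborel) < \<infinity>" for a b
  proof -
    let ?k = "\<lambda>x. indicator (box a b) x *\<^sub>R h x"
    have 1: "(\<integral>\<^sup>+x. ennreal (?k x) \<partial>lborel) \<noteq> \<infinity>" "(\<integral>\<^sup>+x. ennreal (- ?k x) \<partial>lborel) \<noteq> \<infinity>"
      using int[of a b] unfolding real_integrable_def by auto
    have "enn2real (\<integral>\<^sup>+x. ennreal (?k x) \<partial>lborel) = enn2real (\<integral>\<^sup>+x. ennreal (- ?k x) \<partial>lborel)"
      using real_lebesgue_integral_def[OF int[of a b]] zero[of a b] by simp
    then have 2: "(\<integral>\<^sup>+x. ennreal (?k x) \<partial>lborel) = (\<integral>\<^sup>+x. ennreal (- ?k x) \<partial>lborel)"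
      using 1 by (auto dest!: arg_cong[where f = ennreal] simp: less_top)
    have 3: "ennreal (?k x) = ?f x * indicator (box a b) x" "ennreal (- ?k x) = ?g x * indicator (box a b) x" for x
      by (auto simp: indicator_def)
    show "(\<integral>\<^sup>+x. ?f x * indicator (box a b) x \<partial>lborel) = (\<integral>\<^sup>+x. ?g x * indicator (box a b) x \<partial>lborel)"
      "(\<integral>\<^sup>+x. ?f x * indicator (box a b) x \<partial>lborel) < \<infinity>"
      using 1 2 unfolding 3 by (simp_all add: less_top)
  qed
  have "density lborel ?f = density lborel ?g"
  proof (rule measure_eqI_generator_eq)
    let ?E = "range (\<lambda>(a, b). box a b :: 'a set)"
    show "Int_stable ?E"
      by (auto simp: Int_stable_def box_Int_box)
    show "?E \<subseteq> Pow UNIV" "sets (density lborel ?f) = sigma_sets UNIV ?E" "sets (density lborel ?g) = sigma_sets UNIV ?E"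
      by (simp_all add: borel_eq_box)
    let ?A = "\<lambda>n::nat. box (- (real n *\<^sub>R One)) (real n *\<^sub>R One) :: 'a set"
    show "range ?A \<subseteq> ?E" "(\<Union>i. ?A i) = UNIV"
      unfolding UN_box_eq_UNIV by auto
    show "emeasure (density lborel ?f) (?A i) \<noteq> \<infinity>" for i
      using fin by (simp add: emeasure_density less_top)
    show "emeasure (density lborel ?f) X = emeasure (density lborel ?g) X" if "X \<in> ?E" for X
      using that eq by (auto simp: emeasure_density)
  qed
  then have "AE x in lborel. ?f x = ?g x"
    by (intro sigma_finite_measure.density_unique[OF sigma_finite_lborel]) auto
  then show ?thesis
  proof (rule AE_mp, intro AE_I2 impI)
    fix x assume "ennreal (h x) = ennreal (- h x)"
    then show "h x = 0"
      by (cases "h x \<ge> 0") (auto simp: ennreal_neg)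
  qed
qed

lemma AE_zero_if_box_integrals_zero:
  fixes H :: "'a::euclidean_space \<Rightarrow> complex"
  assumes [measurable]: "H \<in> borel_measurable borel"
    and int: "\<And>a b. integrable lborel (\<lambda>x. indicator (box a b) x *\<^sub>R H x)"
    and zero: "\<And>a b. (\<integral>x. indicator (box a b) x *\<^sub>R H x \<partial>lborel) = 0"
  shows "AE x in lborel. H x = 0"
proof -
  have "AE x in lborel. Re (H x) = 0"
  proof (rule AE_zero_if_box_integrals_zero_real)
    fix a b :: 'a
    have *: "(\<lambda>x. indicator (box a b) x *\<^sub>R Re (H x)) = (\<lambda>x. Re (indicator (box a b) x *\<^sub>R H x))"
      by auto
    show "integrable lborel (\<lambda>x. indicator (box a b) x *\<^sub>R Re (H x))"
      unfolding * by (intro integrable_Re int)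
    show "(\<integral>x. indicator (box a b) x *\<^sub>R Re (H x) \<partial>lborel) = 0"
      unfolding * by (subst integral_Re[OF int]) (simp add: zero)
  qed measurable
  moreover have "AE x in lborel. Im (H x) = 0"
  proof (rule AE_zero_if_box_integrals_zero_real)
    fix a b :: 'a
    have *: "(\<lambda>x. indicator (box a b) x *\<^sub>R Im (H x)) = (\<lambda>x. Im (indicator (box a b) x *\<^sub>R H x))"
      by auto
    show "integrable lborel (\<lambda>x. indicator (box a b) x *\<^sub>R Im (H x))"
      unfolding * by (intro integrable_Im int)
    show "(\<integral>x. indicator (box a b) x *\<^sub>R Im (H x) \<partial>lborel) = 0"
      unfolding * by (subst integral_Im[OF int]) (simp add: zero)
  qed measurable
  ultimately show ?thesis
    by eventually_elim (simp add: complex_eq_iff)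
qed

lemma cutoff_integrable:
  assumes "cutoff \<psi>"
  shows "integrable lborel \<psi>"
proof -
  have "integrable lborel (\<lambda>x. complex_of_real (\<psi> x))"
    using schwartz_integrable test_functions_of_real[OF cutoffD(1)[OF assms]] test_functions_schwartz by blast
  then show ?thesis
    using integrable_Re by fastforce
qed

lemma cutoff_integral_pos:
  fixes \<psi> :: "real^'n::finite \<Rightarrow> real"
  assumes "cutoff \<psi>"
  shows "(\<integral>x. \<psi> x \<partial>lborel) > 0"
proof -
  have "0 < measure lborel (ball (0::real^'n) (6/5))" by simp
  also have "\<dots> = (\<integral>x. indicator (ball (0::real^'n) (6/5)) x \<partial>lborel)"
    by simp
  also have "\<dots> \<le> (\<integral>x. \<psi> x \<partial>lborel)"
  proof (rule integral_mono[OF _ cutoff_integrable[OF assms]])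
    show "indicator (ball 0 (6/5)) x \<le> \<psi> x" for x
      using assms by (simp add: cutoff_def)
  qed (rule integrable_real_indicator, simp_all add: emeasure_lborel_ball_finite[unfolded infinity_ennreal_def])
  finally show ?thesis .
qed

text \<open>Testing against \<open>\<psi>((y - a) / \<epsilon>)\<close> and integrating over \<open>a\<close> in a box gives, as \<open>\<epsilon> \<rightarrow> 0\<close>, the
  integral over the box; no smoothness of convolutions is needed.\<close>

lemma du_Bois_Reymond:
  fixes \<psi> :: "real^'n::finite \<Rightarrow> real" and H :: "real^'n::finite \<Rightarrow> complex"
  assumes \<psi>: "cutoff \<psi>"
    and [measurable]: "H \<in> borel_measurable borel"
    and loc: "\<And>R. integrable lborel (\<lambda>x. indicator (cball 0 R) x *\<^sub>R H x)"
    and zero: "\<And>\<phi>. \<phi> \<in> test_functions \<Longrightarrow> (\<integral>x. H x * \<phi> x \<partial>lborel) = 0"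
  shows "AE x in lborel. H x = 0"
proof -
  have [measurable]: "\<psi> \<in> borel_measurable borel"
    using cutoff_integrable[OF \<psi>] by auto
  define t :: "nat \<Rightarrow> real" where "t m = 1 / real (Suc m)" for m
  have t: "t m > 0" "t m \<le> 1" for m by (auto simp: t_def)
  have t0: "t \<longlonglongrightarrow> 0" unfolding t_def by (rule LIMSEQ_Suc[OF lim_1_over_n])
  define P where "P = (\<integral>x. \<psi> x \<partial>lborel)"
  have P: "P > 0" unfolding P_def by (rule cutoff_integral_pos[OF \<psi>])
  have main: "integrable lborel (\<lambda>x. indicator (box a b) x *\<^sub>R H x) \<and> (\<integral>x. indicator (box a b) x *\<^sub>R H x \<partial>lborel) = 0" for a b
  proof -
    let ?B = "box a b"
    obtain R where R: "\<And>x. x \<in> ?B \<Longrightarrow> norm x \<le> R"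
      using bounded_box[of a b] by (auto simp: bounded_iff)
    \<comment> \<open>The cutoff vanishes outside radius 3/2 and the scales \<open>t m\<close> are
      at most 1, so this one ball contains the supports of all the mollified indicators.\<close>
    let ?D = "cball (0::real^'n) (R + 2)"
    have [measurable]: "?D \<in> sets borel" by simp
    have near: "x \<in> ?D" if "x - t m *\<^sub>R z \<in> ?B" "\<psi> z \<noteq> 0" for x z m
    proof -
      have "norm z \<le> 2" using cutoffD(5)[OF \<psi>, of z] that(2) by linarith
      then have "norm (t m *\<^sub>R z) \<le> 1 * 2"
        unfolding norm_scaleR using t[of m] by (intro mult_mono) auto
      then show ?thesis
        using R[OF that(1)] norm_triangle_ineq[of "x - t m *\<^sub>R z" "t m *\<^sub>R z"] by simp
    qed
    \<comment> \<open>The indicator of the box mollified at scale \<open>t m\<close>, with the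
      mollifier rescaled to unit size. Up to the factor \<open>t m\<close> to the power n it is the
      integral over the centres \<open>c\<close> in the box of the test functions below.\<close>
    define J where "J m y = (\<integral>z. indicator ?B (y - t m *\<^sub>R z) * \<psi> z \<partial>lborel)" for m y
    have [measurable]: "J m \<in> borel_measurable borel" for m
      unfolding J_def[abs_def] by measurable
    have Jint: "integrable lborel (\<lambda>z. indicator ?B (y - t m *\<^sub>R z) * \<psi> z)" for m y
      by (rule Bochner_Integration.integrable_bound[OF cutoff_integrable[OF \<psi>]])
        (auto simp: indicator_def)
    have Jbound: "norm (J m y) \<le> P * indicator ?D y" for m y
    proof (cases "y \<in> ?D")
      case True
      have "J m y \<le> P" "J m y \<ge> 0"
        unfolding J_def P_def
        by (rule integral_mono[OF Jint cutoff_integrable[OF \<psi>]], simp add: indicator_def cutoffD(2)[OF \<psi>])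
          (simp add: cutoffD(2)[OF \<psi>])
      then show ?thesis using True by simp
    next
      case False
      have z0: "indicator ?B (y - t m *\<^sub>R z) * \<psi> z = 0" for z
        using near[of y m z] False by (auto simp: indicator_def)
      have "J m y = 0" by (simp only: J_def z0 Bochner_Integration.integral_zero)
      then show ?thesis using P by simp
    qed
    have Jzero: "(\<integral>y. H y * complex_of_real (J m y) \<partial>lborel) = 0" for m
    proof -
      let ?f = "\<lambda>(c, y). indicator ?B c *\<^sub>R (H y * complex_of_real (\<psi> ((1 / t m) *\<^sub>R (y - c))))"
      have meas: "?f \<in> borel_measurable (lborel \<Otimes>\<^sub>M lborel)"
        by measurable
      have bd: "norm (?f (c, y)) \<le> indicator ?B c * norm (indicator ?D y *\<^sub>R H y)" for c y
      proof (cases "c \<in> ?B \<and> \<psi> ((1 / t m) *\<^sub>R (y - c)) \<noteq> 0")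
        case True
        have "y - t m *\<^sub>R ((1 / t m) *\<^sub>R (y - c)) \<in> ?B"
          using True t(1)[of m] by simp
        then have "y \<in> ?D" using near True by blast
        then show ?thesis
          using True cutoffD(2,3)[OF \<psi>, of "(1 / t m) *\<^sub>R (y - c)"]
          by (simp add: norm_mult mult_left_le)
      next
        case False
        then show ?thesis by (auto simp: indicator_def norm_mult)
      qed
      have fin: "(\<integral>\<^sup>+c. \<integral>\<^sup>+y. ennreal (norm (?f (c, y))) \<partial>lborel \<partial>lborel) < \<infinity>"
      proof -
        have "(\<integral>\<^sup>+c. \<integral>\<^sup>+y. ennreal (norm (?f (c, y))) \<partial>lborel \<partial>lborel)
            \<le> (\<integral>\<^sup>+c. \<integral>\<^sup>+y. indicator ?B c * ennreal (norm (indicator ?D y *\<^sub>R H y)) \<partial>lborel \<partial>lborel)"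
        proof (intro nn_integral_mono)
          fix c y
          have "ennreal (norm (?f (c, y))) \<le> ennreal (indicator ?B c * norm (indicator ?D y *\<^sub>R H y))"
            by (rule ennreal_leI[OF bd])
          also have "\<dots> = indicator ?B c * ennreal (norm (indicator ?D y *\<^sub>R H y))"
            by (simp only: ennreal_mult' indicator_pos_le ennreal_indicator)
          finally show "ennreal (norm (?f (c, y))) \<le> indicator ?B c * ennreal (norm (indicator ?D y *\<^sub>R H y))" .
        qed
        also have "\<dots> = (\<integral>\<^sup>+c. indicator ?B c * (\<integral>\<^sup>+y. ennreal (norm (indicator ?D y *\<^sub>R H y)) \<partial>lborel) \<partial>lborel)"
          by (rule nn_integral_cong, rule nn_integral_cmult) measurable
        also have "\<dots> = (\<integral>\<^sup>+c. indicator ?B c \<partial>lborel) * (\<integral>\<^sup>+y. ennreal (norm (indicator ?D y *\<^sub>R H y)) \<partial>lborel)"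
          by (rule nn_integral_multc) measurable
        also have "\<dots> < \<infinity>"
          using nn_integral_norm_finite[OF loc[of "R + 2"]] emeasure_lborel_box_finite[of a b]
          by (simp add: ennreal_mult_less_top)
        finally show ?thesis .
      qed
      have 0: "(\<integral>y. ?f (c, y) \<partial>lborel) = 0" for c
      proof -
        have "(\<lambda>y. complex_of_real (\<psi> ((1 / t m) *\<^sub>R y + (- (1 / t m) *\<^sub>R c)))) \<in> test_functions"
          using t(1)[of m] by (intro test_functions_dilation test_functions_of_real cutoffD(1)[OF \<psi>]) simp
        then have "(\<lambda>y. complex_of_real (\<psi> ((1 / t m) *\<^sub>R (y - c)))) \<in> test_functions"
          by (simp add: scaleR_diff_right)
        from zero[OF this] show ?thesis by simp
      qed
      have J: "(\<integral>c. ?f (c, y) \<partial>lborel) = H y * complex_of_real (t m ^ CARD('n) * J m y)" for y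
      proof -
        have "(\<integral>c. indicator ?B c * \<psi> ((1 / t m) *\<^sub>R (y - c)) \<partial>lborel) =
          (\<bar>- t m\<bar> ^ DIM(real^'n)) *\<^sub>R (\<integral>z. indicator ?B (y + (- t m) *\<^sub>R z) * \<psi> ((1 / t m) *\<^sub>R (y - (y + (- t m) *\<^sub>R z))) \<partial>lborel)"
          using t(1)[of m] by (intro lborel_integral_affine) (measurable, auto)
        also have "\<dots> = t m ^ CARD('n) * J m y"
          using t(1)[of m] by (simp add: J_def)
        finally have "(\<integral>c. indicator ?B c * \<psi> ((1 / t m) *\<^sub>R (y - c)) \<partial>lborel) = t m ^ CARD('n) * J m y" .
        moreover have "?f (c, y) = H y * complex_of_real (indicator ?B c * \<psi> ((1 / t m) *\<^sub>R (y - c)))" for c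
          by (simp add: scaleR_conv_of_real)
        ultimately show ?thesis
          by (simp only: integral_mult_right_zero integral_complex_of_real)
      qed
      have "(\<integral>y. H y * complex_of_real (t m ^ CARD('n) * J m y) \<partial>lborel) = 0"
        using fubini_swap[OF meas fin] unfolding 0 J by simp
      then have "complex_of_real (t m ^ CARD('n)) * (\<integral>y. H y * complex_of_real (J m y) \<partial>lborel) = 0"
        by (simp only: of_real_mult mult.left_commute[of "H _"] integral_mult_right_zero)
      then show ?thesis using t(1)[of m] by simp
    qed
    have lim: "(\<lambda>m. \<integral>y. H y * complex_of_real (J m y) \<partial>lborel) \<longlonglongrightarrow> (\<integral>y. H y * complex_of_real (indicator ?B y * P) \<partial>lborel)"
    proof (rule integral_dominated_convergence[where w = "\<lambda>y. P * norm (indicator ?D y *\<^sub>R H y)"])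
      show "integrable lborel (\<lambda>y. P * norm (indicator ?D y *\<^sub>R H y))"
        by (intro integrable_mult_right integrable_norm loc)
      show "AE y in lborel. norm (H y * complex_of_real (J m y)) \<le> P * norm (indicator ?D y *\<^sub>R H y)" for m
      proof (rule AE_I2)
        fix y
        have "norm (H y) * norm (J m y) \<le> norm (H y) * (P * indicator ?D y)"
          by (rule mult_left_mono[OF Jbound]) simp
        then show "norm (H y * complex_of_real (J m y)) \<le> P * norm (indicator ?D y *\<^sub>R H y)"
          by (simp add: norm_mult mult_ac)
      qed
      \<comment> \<open>Mollifications of the indicator converge at its points of continuity, which
        are all points off the boundary of the box, a null set.\<close>
      have "AE y in lborel. y \<notin> cbox a b - ?B"
        by (rule AE_not_in[OF null_sets_cbox_Diff_box])
      then show "AE y in lborel. (\<lambda>m. H y * complex_of_real (J m y)) \<longlonglongrightarrow> H y * complex_of_real (indicator ?B y * P)"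
      proof eventually_elim
        case (elim y)
        have "(\<lambda>m. J m y) \<longlonglongrightarrow> (\<integral>z. indicator ?B y * \<psi> z \<partial>lborel)"
          unfolding J_def
        proof (rule integral_dominated_convergence[where w = \<psi>])
          show "AE z in lborel. norm (indicator ?B (y - t m *\<^sub>R z) * \<psi> z) \<le> \<psi> z" for m
            using cutoffD(2)[OF \<psi>] by (intro AE_I2) (auto simp: indicator_def)
          show "AE z in lborel. (\<lambda>m. indicator ?B (y - t m *\<^sub>R z) * \<psi> z) \<longlonglongrightarrow> indicator ?B y * \<psi> z"
          proof (intro AE_I2 tendsto_mult tendsto_const)
            fix z
            have "(\<lambda>m. y - t m *\<^sub>R z) \<longlonglongrightarrow> y - 0 *\<^sub>R z"
              by (intro tendsto_intros t0)
            then have l: "(\<lambda>m. y - t m *\<^sub>R z) \<longlonglongrightarrow> y" by simp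
            have "\<forall>\<^sub>F m in sequentially. indicator ?B (y - t m *\<^sub>R z) = (indicator ?B y :: real)"
            proof (cases "y \<in> ?B")
              case True
              show ?thesis
                using topological_tendstoD[OF l open_box True] by eventually_elim (use True in simp)
            next
              case False
              then have "y \<in> - cbox a b" using elim by auto
              from topological_tendstoD[OF l _ this] show ?thesis
                using False box_subset_cbox[of a b] closed_cbox[of a b]
                by (auto simp: open_Compl indicator_def elim!: eventually_mono)
            qed
            then show "(\<lambda>m. indicator ?B (y - t m *\<^sub>R z) :: real) \<longlonglongrightarrow> indicator ?B y"
              by (rule tendsto_eventually)
          qed
        qed (use cutoff_integrable[OF \<psi>] in auto)
        then have "(\<lambda>m. J m y) \<longlonglongrightarrow> indicator ?B y * P"
          by (simp add: P_def)
        then show ?case by (intro tendsto_intros)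
      qed
    qed measurable
    have "(\<integral>y. H y * complex_of_real (indicator ?B y * P) \<partial>lborel) = 0"
      using lim unfolding Jzero by (simp add: LIMSEQ_const_iff)
    moreover have "H y * complex_of_real (indicator ?B y * P) = complex_of_real P * (indicator ?B y *\<^sub>R H y)" for y
      by (simp add: scaleR_conv_of_real)
    ultimately have "complex_of_real P * (\<integral>y. indicator ?B y *\<^sub>R H y \<partial>lborel) = 0"
      by (simp only: integral_mult_right_zero)
    moreover have "integrable lborel (\<lambda>y. indicator ?B y *\<^sub>R H y)"
      by (rule Bochner_Integration.integrable_bound[OF loc[of "R + 2"]])
        (use R in \<open>force simp: indicator_def\<close>)+
    ultimately show ?thesis using P by simp
  qed
  show ?thesis
    by (rule AE_zero_if_box_integrals_zero) (use main in auto)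
qed

section \<open>Borel representatives and their uniqueness almost everywhere\<close>

lemma borel_version:
  fixes F :: "'a::euclidean_space \<Rightarrow> complex"
  assumes F: "F \<in> borel_measurable lebesgue"
  obtains F' where "F' \<in> borel_measurable borel" "AE x in lborel. F x = F' x"
proof -
  have "(\<lambda>x. Re (F x)) \<in> borel_measurable lebesgue" "(\<lambda>x. Im (F x)) \<in> borel_measurable lebesgue"
    using F by measurable
  then obtain g h where g: "g \<in> borel_measurable lborel" "AE x in lborel. Re (F x) = g x"
    and h: "h \<in> borel_measurable lborel" "AE x in lborel. Im (F x) = h x"
    using completion_ex_borel_measurable_real by metis
  note [measurable] = g(1) h(1)
  show ?thesis
  proof (rule that)
    show "(\<lambda>x. Complex (g x) (h x)) \<in> borel_measurable borel"
      unfolding Complex_eq using g(1) h(1) by simp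
    show "AE x in lborel. F x = Complex (g x) (h x)"
      using g(2) h(2) by eventually_elim (simp add: complex_eq_iff)
  qed
qed

lemma locally_integrable_set_integrable:
  assumes "locally_integrable F" "compact K"
  shows "integrable lebesgue (\<lambda>x. indicator K x *\<^sub>R F x)"
  using assms by (simp add: locally_integrable_def set_integrable_def)

lemma locally_integrable_measurable:
  fixes F :: "real^'n::finite \<Rightarrow> complex"
  assumes "locally_integrable F"
  shows "F \<in> borel_measurable lebesgue"
proof (rule borel_measurable_LIMSEQ_metric)
  show "(\<lambda>x. indicator (cball 0 (real m)) x *\<^sub>R F x) \<in> borel_measurable lebesgue" for m
    using locally_integrable_set_integrable[OF assms compact_cball] by (rule borel_measurable_integrable)
  fix x :: "real^'n"
  obtain N :: nat where N: "norm x \<le> real N"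
    using real_arch_simple by blast
  have "\<forall>\<^sub>F m in sequentially. indicator (cball 0 (real m)) x *\<^sub>R F x = F x"
    using eventually_ge_at_top[of N] by eventually_elim (use N in auto)
  then show "(\<lambda>m. indicator (cball 0 (real m)) x *\<^sub>R F x) \<longlonglongrightarrow> F x"
    by (rule tendsto_eventually)
qed

lemma represents_measurable: "represents F u \<Longrightarrow> F \<in> borel_measurable lebesgue"
  by (simp add: represents_def locally_integrable_measurable)

lemma test_functions_borel:
  fixes \<phi> :: "real^'n::finite \<Rightarrow> complex"
  shows "\<phi> \<in> test_functions \<Longrightarrow> \<phi> \<in> borel_measurable borel"
  using test_functions_schwartz schwartz_measurable by blast

lemma represents_cong_AE:
  assumes F: "represents F u" and G: "G \<in> borel_measurable lebesgue" and eq: "AE x in lborel. F x = G x"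
  shows "represents G u"
proof -
  have eq': "AE x in lebesgue. F x = G x"
    using eq by (rule AE_completion)
  note Fm = represents_measurable[OF F]
  have "G absolutely_integrable_on K" if K: "compact K" for K
  proof -
    have "K \<in> sets lebesgue" using K by (simp add: compact_imp_closed)
    then have m: "(\<lambda>x. indicator K x *\<^sub>R F x) \<in> borel_measurable lebesgue" "(\<lambda>x. indicator K x *\<^sub>R G x) \<in> borel_measurable lebesgue"
      using Fm G by measurable
    have "integrable lebesgue (\<lambda>x. indicator K x *\<^sub>R F x)"
      using F K unfolding represents_def by (intro locally_integrable_set_integrable) auto
    then have "integrable lebesgue (\<lambda>x. indicator K x *\<^sub>R G x)"
      by (rule integrable_cong_AE_imp[OF _ m(2)]) (use eq' in eventually_elim, auto)
    then show ?thesis by (simp add: set_integrable_def)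
  qed
  moreover have "(LINT x|lebesgue. F x * \<phi> x) = (LINT x|lebesgue. G x * \<phi> x)" if "\<phi> \<in> test_functions" for \<phi>
  proof (rule integral_cong_AE)
    have "\<phi> \<in> borel_measurable lebesgue"
      using test_functions_borel[OF that] by (simp add: measurable_completion)
    then show "(\<lambda>x. F x * \<phi> x) \<in> borel_measurable lebesgue" "(\<lambda>x. G x * \<phi> x) \<in> borel_measurable lebesgue"
      using Fm G by measurable
    show "AE x in lebesgue. F x * \<phi> x = G x * \<phi> x"
      using eq' by eventually_elim simp
  qed
  ultimately show ?thesis
    using F by (simp add: represents_def locally_integrable_def)
qed

lemma represents_borel_version:
  assumes "represents F u"
  obtains F' where "represents F' u" "F' \<in> borel_measurable borel" "AE x in lborel. F x = F' x"
proof -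
  obtain F' where F': "F' \<in> borel_measurable borel" "AE x in lborel. F x = F' x"
    using borel_version[OF represents_measurable[OF assms]] by blast
  then have "represents F' u"
    using represents_cong_AE[OF assms] by (simp add: measurable_completion)
  then show ?thesis using that F' by blast
qed

text \<open>For Borel functions the completion of the measure can be forgotten, and closed balls
  around 0 can stand for all compact sets. All later work with representatives takes place in this
  setting.\<close>

lemma represents_borel:
  fixes F :: "real^'n::finite \<Rightarrow> complex"
  assumes F: "F \<in> borel_measurable borel"
  shows "represents F u \<longleftrightarrow> (\<forall>R. integrable lborel (\<lambda>x. indicator (cball 0 R) x *\<^sub>R F x)) \<and>
     (\<forall>\<phi>\<in>test_functions. u \<phi> = (\<integral>x. F x * \<phi> x \<partial>lborel))"
proof -
  have 1: "(LINT x|lebesgue. F x * \<phi> x) = (\<integral>x. F x * \<phi> x \<partial>lborel)" if "\<phi> \<in> test_functions" for \<phi>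
    using F test_functions_borel[OF that] by (intro integral_lebesgue_lborel) measurable
  have 2: "integrable lebesgue (\<lambda>x. indicator K x *\<^sub>R F x) \<longleftrightarrow> integrable lborel (\<lambda>x. indicator K x *\<^sub>R F x)"
    if "compact K" for K
  proof (rule integrable_completion)
    have [measurable]: "K \<in> sets borel" using that by (simp add: borel_compact)
    show "(\<lambda>x. indicator K x *\<^sub>R F x) \<in> borel_measurable lborel"
      using F by measurable
  qed
  have "locally_integrable F \<longleftrightarrow> (\<forall>R. integrable lborel (\<lambda>x. indicator (cball 0 R) x *\<^sub>R F x))"
  proof
    assume "locally_integrable F"
    then show "\<forall>R. integrable lborel (\<lambda>x. indicator (cball 0 R) x *\<^sub>R F x)"
      using locally_integrable_set_integrable 2 compact_cball by blast
  next
    assume *: "\<forall>R. integrable lborel (\<lambda>x. indicator (cball 0 R) x *\<^sub>R F x)"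
    show "locally_integrable F"
      unfolding locally_integrable_def set_integrable_def
    proof (intro allI impI)
      fix K :: "(real^'n) set" assume K: "compact K"
      have [measurable]: "K \<in> sets borel" using K by (simp add: borel_compact)
      obtain R where R: "\<And>x. x \<in> K \<Longrightarrow> norm x \<le> R"
        using compact_imp_bounded[OF K] unfolding bounded_iff by blast
      have "integrable lborel (\<lambda>x. indicator K x *\<^sub>R F x)"
        by (rule Bochner_Integration.integrable_bound[OF *[rule_format, of R]])
          (use F R in \<open>auto simp: indicator_def intro!: AE_I2\<close>)
      then show "integrable lebesgue (\<lambda>x. indicator K x *\<^sub>R F x)"
        using 2[OF K] by simp
    qed
  qed
  then show ?thesis
    unfolding represents_def using 1 by simp
qed

lemma represents_unique_borel:
  fixes \<psi> :: "real^'n::finite \<Rightarrow> real" and F G :: "real^'n::finite \<Rightarrow> complex"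
  assumes \<psi>: "cutoff \<psi>" and F: "represents F u" "F \<in> borel_measurable borel"
    and G: "represents G u" "G \<in> borel_measurable borel"
  shows "AE x in lborel. F x = G x"
proof -
  note [measurable] = F(2) G(2)
  have F': "\<And>R. integrable lborel (\<lambda>x. indicator (cball 0 R) x *\<^sub>R F x)" "\<And>\<phi>. \<phi> \<in> test_functions \<Longrightarrow> u \<phi> = (\<integral>x. F x * \<phi> x \<partial>lborel)"
    and G': "\<And>R. integrable lborel (\<lambda>x. indicator (cball 0 R) x *\<^sub>R G x)" "\<And>\<phi>. \<phi> \<in> test_functions \<Longrightarrow> u \<phi> = (\<integral>x. G x * \<phi> x \<partial>lborel)"
    using F G represents_borel by blast+
  have prod: "integrable lborel (\<lambda>x. E x * \<phi> x)"
    if E: "\<And>R. integrable lborel (\<lambda>x. indicator (cball 0 R) x *\<^sub>R E x)" "E \<in> borel_measurable borel" and \<phi>: "\<phi> \<in> test_functions" for E \<phi> :: "real^'n \<Rightarrow> complex"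
  proof -
    have [measurable]: "E \<in> borel_measurable borel" "\<phi> \<in> borel_measurable borel"
      using E(2) test_functions_borel[OF \<phi>] by auto
    obtain C where C: "C \<ge> 0" "\<And>x. norm (\<phi> x) \<le> C" "\<And>x. \<phi> x \<noteq> 0 \<Longrightarrow> norm x \<le> C"
      using test_function_derivs_bounded[OF \<phi>, of "[]"] by (metis norm_eq_zero partial_derivs.simps(1))
    show ?thesis
    proof (rule Bochner_Integration.integrable_bound[OF integrable_mult_right[OF E(1)[of C], of "complex_of_real C"]])
      show "AE x in lborel. norm (E x * \<phi> x) \<le> norm (complex_of_real C * (indicator (cball 0 C) x *\<^sub>R E x))"
      proof (rule AE_I2)
        fix x
        show "norm (E x * \<phi> x) \<le> norm (complex_of_real C * (indicator (cball 0 C) x *\<^sub>R E x))"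
          using C(1) C(2)[of x] C(3)[of x]
          by (cases "\<phi> x = 0") (auto simp: norm_mult mult.commute[of C] mult_left_mono)
      qed
    qed measurable
  qed
  have "AE x in lborel. F x - G x = 0"
  proof (rule du_Bois_Reymond[OF \<psi>])
    show "integrable lborel (\<lambda>x. indicator (cball 0 R) x *\<^sub>R (F x - G x))" for R
      using F'(1)[of R] G'(1)[of R] by (simp add: scaleR_diff_right)
    show "(\<integral>x. (F x - G x) * \<phi> x \<partial>lborel) = 0" if "\<phi> \<in> test_functions" for \<phi>
      using prod[OF F'(1) F(2) that] prod[OF G'(1) G(2) that] F'(2)[OF that] G'(2)[OF that]
      by (simp add: left_diff_distrib)
  qed measurable
  then show ?thesis by simp
qed

lemma represents_unique:
  fixes \<psi> :: "real^'n::finite \<Rightarrow> real" and F G :: "real^'n \<Rightarrow> complex"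
  assumes \<psi>: "cutoff \<psi>" and F: "represents F u" and G: "represents G u"
  shows "AE x in lborel. F x = G x"
proof -
  obtain F' where F': "represents F' u" "F' \<in> borel_measurable borel" "AE x in lborel. F x = F' x"
    using represents_borel_version[OF F] by blast
  obtain G' where G': "represents G' u" "G' \<in> borel_measurable borel" "AE x in lborel. G x = G' x"
    using represents_borel_version[OF G] by blast
  have "AE x in lborel. F' x = G' x"
    by (rule represents_unique_borel[OF \<psi> F'(1,2) G'(1,2)])
  then show ?thesis
    using F'(3) G'(3) by eventually_elim simp
qed

section \<open>Functions of tempered growth and their convolutions\<close>

text \<open>The centre \<open>y = 0\<close> alone makes pairings with Schwartz functions converge.
  Uniformity in \<open>y\<close> makes convolutions with Schwartz kernels bounded, and bounded
  functions are tame again.\<close>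

definition tame :: "(real^'n::finite \<Rightarrow> complex) \<Rightarrow> bool" where
  "tame F \<longleftrightarrow> F \<in> borel_measurable borel \<and>
     (\<exists>C\<ge>0. \<forall>y. (\<integral>\<^sup>+z. ennreal (norm (F z)) * ennreal (weight (z - y)) \<partial>lborel) \<le> ennreal C)"

text \<open>The kernel is reflected because multipliers act on a distribution through the test function;
  \<open>conv (multiplier_kernel \<theta>) F\<close> is \<open>\<theta>(D)F\<close>.\<close>

definition conv :: "(real^'n::finite \<Rightarrow> complex) \<Rightarrow> (real^'n \<Rightarrow> complex) \<Rightarrow> real^'n \<Rightarrow> complex" where
  "conv \<kappa> F y = (\<integral>z. F z * \<kappa> (z - y) \<partial>lborel)"

lemma tame_measurable: "tame F \<Longrightarrow> F \<in> borel_measurable borel"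
  by (simp add: tame_def)

lemma tameE:
  assumes "tame F"
  obtains C where "C \<ge> 0" "\<And>y. (\<integral>\<^sup>+z. ennreal (norm (F z)) * ennreal (weight (z - y)) \<partial>lborel) \<le> ennreal C"
  using assms unfolding tame_def by blast

lemma tame_nn_integral_le:
  fixes F K :: "real^'n::finite \<Rightarrow> complex"
  assumes C: "\<And>y. (\<integral>\<^sup>+z. ennreal (norm (F z)) * ennreal (weight (z - y)) \<partial>lborel) \<le> ennreal C"
    and [measurable]: "F \<in> borel_measurable borel"
    and D: "D \<ge> 0" "\<And>x. norm (K x) \<le> D * weight (x - y)"
  shows "(\<integral>\<^sup>+x. ennreal (norm (F x * K x)) \<partial>lborel) \<le> ennreal (D * C)"
proof -
  have "(\<integral>\<^sup>+x. ennreal (norm (F x * K x)) \<partial>lborel)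
      \<le> (\<integral>\<^sup>+x. ennreal D * (ennreal (norm (F x)) * ennreal (weight (x - y))) \<partial>lborel)"
  proof (rule nn_integral_mono)
    fix x
    have "norm (F x * K x) \<le> D * (norm (F x) * weight (x - y))"
      using mult_left_mono[OF D(2)[of x], of "norm (F x)"] by (simp add: norm_mult mult_ac)
    then show "ennreal (norm (F x * K x)) \<le> ennreal D * (ennreal (norm (F x)) * ennreal (weight (x - y)))"
      using D(1) by (simp add: ennreal_mult'[symmetric] ennreal_leI)
  qed
  also have "\<dots> = ennreal D * (\<integral>\<^sup>+x. ennreal (norm (F x)) * ennreal (weight (x - y)) \<partial>lborel)"
    by (rule nn_integral_cmult) measurable
  also have "\<dots> \<le> ennreal D * ennreal C"
    by (intro mult_left_mono C) simp
  finally show ?thesis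
    using D(1) by (simp add: ennreal_mult')
qed

lemma tame_mult_integrable:
  fixes F K :: "real^'n::finite \<Rightarrow> complex"
  assumes F: "tame F" and [measurable]: "K \<in> borel_measurable borel"
    and D: "D \<ge> 0" "\<And>x. norm (K x) \<le> D * weight (x - y)"
  shows "integrable lborel (\<lambda>x. F x * K x)"
proof -
  note [measurable] = tame_measurable[OF F]
  obtain C where "\<And>y. (\<integral>\<^sup>+z. ennreal (norm (F z)) * ennreal (weight (z - y)) \<partial>lborel) \<le> ennreal C"
    using tameE[OF F] by blast
  from tame_nn_integral_le[OF this tame_measurable[OF F] D] show ?thesis
    by (simp add: integrable_iff_bounded order_le_less_trans)
qed

lemma tame_schwartz_integrable:
  assumes F: "tame F" and \<eta>: "\<eta> \<in> schwartz"
  shows "integrable lborel (\<lambda>x. F x * \<eta> x)"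
proof -
  obtain D where "D \<ge> 0" "\<And>x. norm (\<eta> x) \<le> D * weight x"
    using schwartz_weight0[OF \<eta>] by blast
  then show ?thesis
    using tame_mult_integrable[OF F schwartz_measurable[OF \<eta>], of D 0] by simp
qed

lemma conv_measurable:
  assumes "tame F" "\<kappa> \<in> schwartz"
  shows "conv \<kappa> F \<in> borel_measurable borel"
proof -
  note [measurable] = tame_measurable[OF assms(1)] schwartz_measurable[OF assms(2)]
  show ?thesis unfolding conv_def[abs_def] by measurable
qed

lemma conv_bounded:
  assumes F: "tame F" and \<kappa>: "\<kappa> \<in> schwartz"
  obtains M where "M \<ge> 0" "\<And>y. norm (conv \<kappa> F y) \<le> M"
    "\<And>y. (\<integral>\<^sup>+z. ennreal (norm (F z * \<kappa> (z - y))) \<partial>lborel) \<le> ennreal M"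
proof -
  obtain C where C: "C \<ge> 0" "\<And>y. (\<integral>\<^sup>+z. ennreal (norm (F z)) * ennreal (weight (z - y)) \<partial>lborel) \<le> ennreal C"
    using tameE[OF F] by blast
  obtain D where D: "D \<ge> 0" "\<And>x. norm (\<kappa> x) \<le> D * weight x"
    using schwartz_weight0[OF \<kappa>] by blast
  have 1: "(\<integral>\<^sup>+z. ennreal (norm (F z * \<kappa> (z - y))) \<partial>lborel) \<le> ennreal (D * C)" for y
    by (rule tame_nn_integral_le[OF C(2) tame_measurable[OF F] D(1)]) (rule D(2))
  note [measurable] = tame_measurable[OF F] schwartz_measurable[OF \<kappa>]
  have "norm (conv \<kappa> F y) \<le> D * C" for y
  proof -
    have "integrable lborel (\<lambda>z. F z * \<kappa> (z - y))"
      by (rule tame_mult_integrable[OF F _ D(1)]) (measurable, rule D(2))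
    then have "ennreal (norm (conv \<kappa> F y)) \<le> (\<integral>\<^sup>+z. ennreal (norm (F z * \<kappa> (z - y))) \<partial>lborel)"
      unfolding conv_def by (rule integral_norm_bound_ennreal)
    then have "ennreal (norm (conv \<kappa> F y)) \<le> ennreal (D * C)"
      using 1[of y] by (rule order_trans)
    then show ?thesis
      using C(1) D(1) by (subst (asm) ennreal_le_iff) auto
  qed
  with 1 show ?thesis
    using C(1) D(1) that[of "D * C"] by simp
qed

lemma bounded_tame:
  fixes F :: "real^'n::finite \<Rightarrow> complex"
  assumes [measurable]: "F \<in> borel_measurable borel" and M: "M \<ge> 0" "\<And>x. norm (F x) \<le> M"
  shows "tame F"
proof -
  let ?W = "2 ^ Suc (Suc CARD('n)) * unit_ball_vol (real CARD('n))"
  have "(\<integral>\<^sup>+z. ennreal (norm (F z)) * ennreal (weight (z - y)) \<partial>lborel) \<le> ennreal (M * ?W)" for y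
  proof -
    have "(\<integral>\<^sup>+z. ennreal (norm (F z)) * ennreal (weight (z - y)) \<partial>lborel)
        \<le> (\<integral>\<^sup>+z. ennreal M * ennreal (weight (z - y)) \<partial>lborel)"
      by (intro nn_integral_mono mult_right_mono ennreal_leI M(2)) simp
    also have "\<dots> = ennreal M * (\<integral>\<^sup>+z. ennreal (weight (z - y)) \<partial>lborel)"
      by (rule nn_integral_cmult) measurable
    also have "\<dots> \<le> ennreal M * ennreal ?W"
      by (intro mult_left_mono nn_integral_weight_bound) simp
    finally show ?thesis using M(1) by (simp add: ennreal_mult' del: power_Suc)
  qed
  moreover have "M * ?W \<ge> 0" using M(1) by simp
  ultimately show ?thesis
    unfolding tame_def using assms(1) by (intro conjI exI[of _ "M * ?W"] allI)
qed

lemma conv_tame: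
  assumes "tame F" "\<kappa> \<in> schwartz"
  shows "tame (conv \<kappa> F)"
  by (rule conv_bounded[OF assms], rule bounded_tame[OF conv_measurable[OF assms]])

text \<open>Absolute integrability of the double integral holds because the inner integral of
  absolute values is bounded uniformly in \<open>y\<close>, by tameness, while \<Phi> is integrable.
  With \<Phi> a test function this moves the convolution from the function to the test
  function.\<close>

lemma tame_fubini:
  fixes \<Phi> F \<kappa> :: "real^'n::finite \<Rightarrow> complex"
  assumes \<Phi>: "integrable lborel \<Phi>" and F: "tame F" and \<kappa>: "\<kappa> \<in> schwartz"
  shows "(\<integral>y. \<Phi> y * conv \<kappa> F y \<partial>lborel) = (\<integral>z. F z * (\<integral>y. \<Phi> y * \<kappa> (z - y) \<partial>lborel) \<partial>lborel)"
proof -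
  note [measurable] = tame_measurable[OF F] schwartz_measurable[OF \<kappa>] borel_measurable_integrable[OF \<Phi>]
  obtain M where M: "M \<ge> 0" "\<And>y. (\<integral>\<^sup>+z. ennreal (norm (F z * \<kappa> (z - y))) \<partial>lborel) \<le> ennreal M"
    using conv_bounded[OF F \<kappa>] by metis
  let ?f = "\<lambda>(y, z). \<Phi> y * (F z * \<kappa> (z - y))"
  have m: "?f \<in> borel_measurable (lborel \<Otimes>\<^sub>M lborel)" by measurable
  have "(\<integral>\<^sup>+y. \<integral>\<^sup>+z. ennreal (norm (?f (y, z))) \<partial>lborel \<partial>lborel)
     = (\<integral>\<^sup>+y. ennreal (norm (\<Phi> y)) * (\<integral>\<^sup>+z. ennreal (norm (F z * \<kappa> (z - y))) \<partial>lborel) \<partial>lborel)"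
  proof (rule nn_integral_cong)
    fix y
    show "(\<integral>\<^sup>+z. ennreal (norm (?f (y, z))) \<partial>lborel) = ennreal (norm (\<Phi> y)) * (\<integral>\<^sup>+z. ennreal (norm (F z * \<kappa> (z - y))) \<partial>lborel)"
      by (subst nn_integral_cmult[symmetric]) (measurable, simp only: prod.case norm_mult[of "\<Phi> y"] ennreal_mult'[OF norm_ge_zero])
  qed
  also have "\<dots> \<le> (\<integral>\<^sup>+y. ennreal (norm (\<Phi> y)) * ennreal M \<partial>lborel)"
    by (intro nn_integral_mono mult_left_mono M(2)) simp
  also have "\<dots> = (\<integral>\<^sup>+y. ennreal (norm (\<Phi> y)) \<partial>lborel) * ennreal M"
    by (rule nn_integral_multc) measurable
  also have "\<dots> < \<infinity>"
    using nn_integral_norm_finite[OF \<Phi>] by (simp add: ennreal_mult_less_top)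
  finally have "(\<integral>y. \<integral>z. ?f (y, z) \<partial>lborel \<partial>lborel) = (\<integral>z. \<integral>y. ?f (y, z) \<partial>lborel \<partial>lborel)"
    by (rule fubini_swap[OF m])
  then have swap: "(\<integral>y. \<integral>z. \<Phi> y * (F z * \<kappa> (z - y)) \<partial>lborel \<partial>lborel) = (\<integral>z. \<integral>y. \<Phi> y * (F z * \<kappa> (z - y)) \<partial>lborel \<partial>lborel)"
    by simp
  have a: "(\<integral>z. \<Phi> y * (F z * \<kappa> (z - y)) \<partial>lborel) = \<Phi> y * conv \<kappa> F y" for y
    by (simp only: conv_def integral_mult_right_zero)
  have b: "(\<integral>y. \<Phi> y * (F z * \<kappa> (z - y)) \<partial>lborel) = F z * (\<integral>y. \<Phi> y * \<kappa> (z - y) \<partial>lborel)" for z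
    by (simp only: mult.left_commute[of "\<Phi> _"] integral_mult_right_zero)
  show ?thesis using swap unfolding a b .
qed

section \<open>Function distributions\<close>

definition dist_of :: "(real^'n::finite \<Rightarrow> complex) \<Rightarrow> (real^'n \<Rightarrow> complex) \<Rightarrow> complex" where
  "dist_of F = (\<lambda>\<phi>\<in>schwartz. \<integral>x. F x * \<phi> x \<partial>lborel)"

lemma dist_of_apply: "\<phi> \<in> schwartz \<Longrightarrow> dist_of F \<phi> = (\<integral>x. F x * \<phi> x \<partial>lborel)"
  by (simp add: dist_of_def)

lemma dist_of_tempered:
  fixes F :: "real^'n::finite \<Rightarrow> complex"
  assumes F: "tame F"
  shows "dist_of F \<in> tempered_distributions"
  unfolding tempered_distributions_def
proof (intro CollectI conjI ballI allI)
  show "dist_of F \<in> extensional schwartz" by (simp add: dist_of_def)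
  show "dist_of F (\<lambda>x. \<phi> x + \<eta> x) = dist_of F \<phi> + dist_of F \<eta>"
    if "\<phi> \<in> schwartz" "\<eta> \<in> schwartz" for \<phi> \<eta>
    using that tame_schwartz_integrable[OF F]
    by (simp add: dist_of_apply schwartz_add distrib_left)
  show "dist_of F (\<lambda>x. c * \<phi> x) = c * dist_of F \<phi>" if "\<phi> \<in> schwartz" for c \<phi>
    using that by (simp add: dist_of_apply schwartz_cmult mult.left_commute)
  obtain C where C: "C \<ge> 0" "\<And>y. (\<integral>\<^sup>+z. ennreal (norm (F z)) * ennreal (weight (z - y)) \<partial>lborel) \<le> ennreal C"
    using tameE[OF F] by blast
  show "\<exists>m. \<exists>C. \<forall>\<phi>\<in>schwartz. ennreal (norm (dist_of F \<phi>)) \<le> ennreal C * schwartz_seminorm m \<phi>"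
  proof (intro exI ballI)
    fix \<phi> :: "real^'n \<Rightarrow> complex" assume \<phi>: "\<phi> \<in> schwartz"
    \<comment> \<open>The order of the distribution is the exponent of the weight: the seminorm of
      this order bounds a Schwartz function by a multiple of \<open>weight\<close>.\<close>
    define m where "m = Suc CARD('n)"
    obtain s where s: "s \<ge> 0" "schwartz_seminorm m \<phi> = ennreal s"
      using \<phi> unfolding schwartz_def by (cases "schwartz_seminorm m \<phi>") (auto simp: less_le)
    have bd: "norm (\<phi> x) \<le> s * weight (x - 0)" for x
    proof -
      have "ennreal ((1 + norm x) ^ m * norm (partial_derivs [] \<phi> x)) \<le> schwartz_seminorm m \<phi>"
        unfolding schwartz_seminorm_def by (rule SUP_upper2[of "[]"]) (auto intro: SUP_upper)
      then have "(1 + norm x) ^ m * norm (\<phi> x) \<le> s"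
        using s by (simp add: ennreal_le_iff)
      moreover have "(1 + norm x) ^ m > 0" by (simp add: add_pos_nonneg)
      ultimately show ?thesis
        unfolding weight_def m_def by (simp add: field_simps del: power_Suc)
    qed
    have "ennreal (norm (dist_of F \<phi>)) \<le> (\<integral>\<^sup>+x. ennreal (norm (F x * \<phi> x)) \<partial>lborel)"
      unfolding dist_of_apply[OF \<phi>] by (rule integral_norm_bound_ennreal[OF tame_schwartz_integrable[OF F \<phi>]])
    also have "\<dots> \<le> ennreal (s * C)"
      by (rule tame_nn_integral_le[OF C(2) tame_measurable[OF F] s(1) bd])
    finally show "ennreal (norm (dist_of F \<phi>)) \<le> ennreal C * schwartz_seminorm (Suc CARD('n)) \<phi>"
      using s C(1) by (simp add: m_def[symmetric] ennreal_mult' mult.commute)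
  qed
qed

lemma tame_locally_integrable:
  fixes F :: "real^'n::finite \<Rightarrow> complex"
  assumes F: "tame F"
  shows "integrable lborel (\<lambda>x. indicator (cball 0 R) x *\<^sub>R F x)"
proof -
  have [measurable]: "cball (0::real^'n) R \<in> sets borel" by simp
  have "integrable lborel (\<lambda>x. F x * complex_of_real (indicator (cball 0 R) x))"
  proof (rule tame_mult_integrable[OF F])
    fix x :: "real^'n"
    show "norm (complex_of_real (indicator (cball 0 R) x)) \<le> (1 + \<bar>R\<bar>) ^ Suc CARD('n) * weight (x - 0)"
    proof (cases "norm x \<le> R")
      case True
      then have "(1 + norm x) ^ Suc CARD('n) \<le> (1 + \<bar>R\<bar>) ^ Suc CARD('n)"
        by (intro power_mono) auto
      moreover have "(1 + norm x) ^ Suc CARD('n) > 0" by (simp add: add_pos_nonneg)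
      ultimately show ?thesis
        using True unfolding weight_def by (simp add: field_simps del: power_Suc)
    qed simp
    show "(1 + \<bar>R\<bar>) ^ Suc CARD('n) \<ge> 0" by (intro zero_le_power) simp
  qed measurable
  then show ?thesis by (simp add: scaleR_conv_of_real mult.commute)
qed

lemma represents_tame:
  assumes "tame F"
  shows "represents F u \<longleftrightarrow> (\<forall>\<phi>\<in>test_functions. u \<phi> = (\<integral>x. F x * \<phi> x \<partial>lborel))"
  using represents_borel[OF tame_measurable[OF assms]] tame_locally_integrable[OF assms] by blast

lemma represents_dist_of:
  assumes "tame F"
  shows "represents F (dist_of F)"
  using test_functions_schwartz by (auto simp: represents_tame[OF assms] dist_of_apply)

lemma fourier_multiplier_apply:
  assumes "\<theta> \<in> test_functions" "\<phi> \<in> schwartz"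
  shows "fourier_multiplier \<theta> u \<phi> = u (fourier (\<lambda>\<xi>. \<theta> \<xi> * inv_fourier \<phi> \<xi>))"
  using assms by (simp add: fourier_multiplier_def inv_fourier_dist_def mult_dist_def fourier_dist_def
      schwartz_inv_fourier schwartz_mult)

text \<open>Here the multiplier on functionals becomes a convolution of functions. The assumption on
  \<open>u\<close> must range over all Schwartz functions, because the multiplier turns a test
  function into a Schwartz function that in general has no compact support.\<close>

lemma represents_fourier_multiplier:
  assumes F: "tame F" and u: "\<And>\<eta>. \<eta> \<in> schwartz \<Longrightarrow> u \<eta> = (\<integral>x. F x * \<eta> x \<partial>lborel)"
    and \<theta>: "\<theta> \<in> test_functions"
  shows "represents (conv (multiplier_kernel \<theta>) F) (fourier_multiplier \<theta> u)"
proof -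
  have \<theta>S: "\<theta> \<in> schwartz" using \<theta> test_functions_schwartz by blast
  note k = kernel_schwartz[OF \<theta>S]
  show ?thesis
    unfolding represents_tame[OF conv_tame[OF F k]]
  proof
    fix \<phi> :: "real^'a \<Rightarrow> complex" assume "\<phi> \<in> test_functions"
    then have \<phi>: "\<phi> \<in> schwartz" using test_functions_schwartz by blast
    have "fourier_multiplier \<theta> u \<phi> = u (fourier (\<lambda>\<xi>. \<theta> \<xi> * inv_fourier \<phi> \<xi>))"
      by (rule fourier_multiplier_apply[OF \<theta> \<phi>])
    also have "\<dots> = (\<integral>x. F x * (\<integral>y. \<phi> y * multiplier_kernel \<theta> (x - y) \<partial>lborel) \<partial>lborel)"
      by (simp add: u schwartz_fourier schwartz_mult[OF \<theta>] schwartz_inv_fourier \<phi> fourier_mult_inv_fourier[OF \<theta>S \<phi>])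
    also have "\<dots> = (\<integral>x. \<phi> x * conv (multiplier_kernel \<theta>) F x \<partial>lborel)"
      by (rule tame_fubini[OF schwartz_integrable[OF \<phi>] F k, symmetric])
    finally show "fourier_multiplier \<theta> u \<phi> = (\<integral>x. conv (multiplier_kernel \<theta>) F x * \<phi> x \<partial>lborel)"
      by (simp add: mult.commute)
  qed
qed

section \<open>Approximation of distributions by their low-pass parts\<close>

lemma tempered_add: "u \<in> tempered_distributions \<Longrightarrow> \<phi> \<in> schwartz \<Longrightarrow> \<eta> \<in> schwartz \<Longrightarrow>
    u (\<lambda>x. \<phi> x + \<eta> x) = u \<phi> + u \<eta>"
  by (simp add: tempered_distributions_def)

lemma tempered_vanishing:
  assumes u: "u \<in> tempered_distributions" and \<eta>: "schw_fam (\<lambda>m. 1 / 2 ^ m) \<eta>"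
  shows "(\<lambda>m. u (\<eta> m)) \<longlonglongrightarrow> 0"
proof -
  obtain C where C: "\<And>m. norm (u (\<eta> m)) \<le> C * (1 / 2 ^ m)"
    using tempered_schw_fam[OF u \<eta>] by auto
  have "(\<lambda>m. C * (1 / 2) ^ m) \<longlonglongrightarrow> C * 0"
    by (intro tendsto_intros LIMSEQ_power_zero) simp
  then have lim: "(\<lambda>m. C * (1 / 2) ^ m) \<longlonglongrightarrow> 0" by simp
  have "\<forall>m. norm (u (\<eta> m)) \<le> C * (1 / 2) ^ m"
    using C by (simp add: power_one_over)
  then show ?thesis
    by (rule Lim_null_comparison[OF always_eventually lim])
qed

lemma test_functions_mult:
  fixes f :: "real^'n::finite \<Rightarrow> complex"
  assumes f: "f \<in> test_functions" and g: "smooth g"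
  shows "(\<lambda>x. f x * g x) \<in> test_functions"
proof -
  have "bounded {x. f x \<noteq> 0}"
    using f bounded_subset[OF compact_imp_bounded closure_subset] by (simp add: test_functions_def)
  then have "bounded {x. f x * g x \<noteq> 0}"
    by (rule bounded_subset) auto
  moreover have "smooth (\<lambda>x. f x * g x)"
    by (rule smooth_mult[OF _ g]) (use f in \<open>simp add: test_functions_def\<close>)
  ultimately show ?thesis
    unfolding test_functions_def compact_closure by blast
qed

text \<open>Test functions are dense, because the high-pass parts of a Schwartz function form a
  vanishing family.\<close>

lemma tempered_eq_on_schwartz:
  fixes \<psi> :: "real^'n::finite \<Rightarrow> real" and \<eta> :: "real^'n \<Rightarrow> complex"
  assumes \<psi>: "cutoff \<psi>" and u: "u \<in> tempered_distributions" and v: "v \<in> tempered_distributions"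
    and eq: "\<And>\<phi>. \<phi> \<in> test_functions \<Longrightarrow> u \<phi> = v \<phi>" and \<eta>: "\<eta> \<in> schwartz"
  shows "u \<eta> = v \<eta>"
proof -
  let ?h = "\<lambda>m \<xi>. (1 - low_pass \<psi> m \<xi>) * \<eta> \<xi>" and ?l = "\<lambda>m \<xi>. low_pass \<psi> m \<xi> * \<eta> \<xi>"
  note h = schw_fam_high_pass[OF \<psi> \<eta>]
  have l: "?l m \<in> test_functions" for m
    by (rule test_functions_mult[OF low_pass_test_function[OF \<psi>] schwartz_smooth[OF \<eta>]])
  have split: "w \<eta> = w (?l m) + w (?h m)" if "w \<in> tempered_distributions" for w m
  proof -
    have "w (\<lambda>\<xi>. ?l m \<xi> + ?h m \<xi>) = w (?l m) + w (?h m)"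
      using tempered_add[OF that] l test_functions_schwartz schw_fam_schwartz[OF h] by blast
    then show ?thesis by (simp add: algebra_simps)
  qed
  have "u \<eta> - v \<eta> = u (?h m) - v (?h m)" for m
    using split[OF u, of m] split[OF v, of m] eq[OF l, of m] by simp
  moreover have "(\<lambda>m. u (?h m) - v (?h m)) \<longlonglongrightarrow> 0 - 0"
    by (intro tendsto_diff tempered_vanishing u v h)
  ultimately show ?thesis
    by (simp add: LIMSEQ_const_iff)
qed

text \<open>Convergence of \<open>\<psi>(2\<^sup>-\<^sup>mD)u\<close> to \<open>u\<close> in the
  sense of distributions. The filter is moved to the Schwartz function, where the remaining
  high-pass part is a family that vanishes geometrically and stays so after the transform.\<close>

lemma low_pass_tendsto:
  fixes \<psi> :: "real^'n::finite \<Rightarrow> real" and \<eta> :: "real^'n \<Rightarrow> complex"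
  assumes \<psi>: "cutoff \<psi>" and u: "u \<in> tempered_distributions" and \<eta>: "\<eta> \<in> schwartz"
  shows "(\<lambda>m. u (fourier (\<lambda>\<xi>. low_pass \<psi> m \<xi> * inv_fourier \<eta> \<xi>))) \<longlonglongrightarrow> u \<eta>"
proof -
  let ?h = "\<lambda>m \<xi>. (1 - low_pass \<psi> m \<xi>) * inv_fourier \<eta> \<xi>" and ?l = "\<lambda>m \<xi>. low_pass \<psi> m \<xi> * inv_fourier \<eta> \<xi>"
  have i: "inv_fourier \<eta> \<in> schwartz" by (rule schwartz_inv_fourier[OF \<eta>])
  have h: "schw_fam (\<lambda>m. 1 / 2 ^ m) (\<lambda>m. fourier (?h m))"
    by (intro schw_fam_fourier schw_fam_high_pass \<psi> i) simp
  have hS: "?h m \<in> schwartz" for m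
    using schw_fam_schwartz[OF schw_fam_high_pass[OF \<psi> i]] .
  have l: "?l m \<in> schwartz" for m
    by (rule schwartz_mult[OF low_pass_test_function[OF \<psi>] i])
  have "u \<eta> = u (fourier (?l m)) + u (fourier (?h m))" for m
  proof -
    have "fourier (?h m) x = \<eta> x - fourier (?l m) x" for x
      using fourier_diff[OF schwartz_integrable[OF i] schwartz_integrable[OF l], of m x]
      by (simp add: fourier_inv_fourier[OF \<eta>] left_diff_distrib)
    then have "u (\<lambda>x. fourier (?l m) x + fourier (?h m) x) = u \<eta>" by simp
    then show ?thesis
      using tempered_add[OF u schwartz_fourier[OF l] schwartz_fourier[OF hS], of m m] by simp
  qed
  then have "u (fourier (?l m)) = u \<eta> - u (fourier (?h m))" for m
    by (simp add: algebra_simps)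
  moreover have "(\<lambda>m. u \<eta> - u (fourier (?h m))) \<longlonglongrightarrow> u \<eta> - 0"
    by (intro tendsto_intros tempered_vanishing u h)
  ultimately show ?thesis by simp
qed

lemma sum_dyadic_multipliers:
  fixes \<psi> :: "real^'n::finite \<Rightarrow> real" and \<eta> :: "real^'n \<Rightarrow> complex"
  assumes \<psi>: "cutoff \<psi>" and u: "u \<in> tempered_distributions" and \<eta>: "\<eta> \<in> schwartz"
  shows "(\<Sum>j\<le>m. fourier_multiplier (\<lambda>\<xi>. complex_of_real (dyadic \<psi> j \<xi>)) u \<eta>) =
    u (fourier (\<lambda>\<xi>. low_pass \<psi> m \<xi> * inv_fourier \<eta> \<xi>))"
proof (induction m)
  case 0
  show ?case
    using fourier_multiplier_apply[OF dyadic_test_function[OF \<psi>] \<eta>, of 0 u] by (simp add: low_pass_0)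
next
  case (Suc m)
  let ?d = "\<lambda>\<xi>. complex_of_real (dyadic \<psi> (Suc m) \<xi>) * inv_fourier \<eta> \<xi>"
    and ?l = "\<lambda>m \<xi>. low_pass \<psi> m \<xi> * inv_fourier \<eta> \<xi>"
  have i: "inv_fourier \<eta> \<in> schwartz" by (rule schwartz_inv_fourier[OF \<eta>])
  have l: "?l m \<in> schwartz" for m
    by (rule schwartz_mult[OF low_pass_test_function[OF \<psi>] i])
  have d: "?d \<in> schwartz" by (rule schwartz_mult[OF dyadic_test_function[OF \<psi>] i])
  have "fourier ?d x = fourier (?l (Suc m)) x - fourier (?l m) x" for x
    using fourier_diff[OF schwartz_integrable[OF l] schwartz_integrable[OF l], of "Suc m" m x]
    by (simp add: dyadic_Suc left_diff_distrib del: dyadic.simps)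
  then have "u (\<lambda>x. fourier (?l m) x + fourier ?d x) = u (fourier (?l (Suc m)))" by simp
  then have "u (fourier (?l m)) + u (fourier ?d) = u (fourier (?l (Suc m)))"
    using tempered_add[OF u schwartz_fourier[OF l] schwartz_fourier[OF d], of m] by simp
  then show ?case
    using Suc fourier_multiplier_apply[OF dyadic_test_function[OF \<psi>] \<eta>, of "Suc m" u]
    by (simp del: dyadic.simps)
qed

section \<open>Spectral localisation of products\<close>

text \<open>Plane waves are eigenfunctions of \<open>\<theta>(D)\<close>, with eigenvalue \<theta>
  at the frequency. For this kernel it is Fourier inversion for \<theta>, shifted to
  \<open>x\<close>.\<close>

lemma kernel_modulation:
  fixes \<theta> :: "real^'n::finite \<Rightarrow> complex"
  assumes \<theta>: "\<theta> \<in> schwartz"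
  shows "(\<integral>y. multiplier_kernel \<theta> (y - x) * exp (\<i> * complex_of_real (y \<bullet> \<zeta>)) \<partial>lborel) = exp (\<i> * complex_of_real (x \<bullet> \<zeta>)) * \<theta> \<zeta>"
proof -
  note k = kernel_schwartz[OF \<theta>]
  note [measurable] = schwartz_measurable[OF k] schwartz_measurable[OF schwartz_fourier[OF \<theta>]]
  let ?g = "\<lambda>y. multiplier_kernel \<theta> (y - x) * exp (\<i> * complex_of_real (y \<bullet> \<zeta>))"
  have "(\<integral>y. ?g y \<partial>lborel) = (\<integral>y. ?g (y + x) \<partial>lborel)"
    by (rule lborel_integral_translation[symmetric]) measurable
  also have "\<dots> = (\<integral>y. exp (\<i> * complex_of_real (x \<bullet> \<zeta>)) * (complex_of_real (fourier_const TYPE('n)) * (fourier \<theta> y * exp (\<i> * complex_of_real (\<zeta> \<bullet> y)))) \<partial>lborel)"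
    by (intro Bochner_Integration.integral_cong refl)
      (simp add: multiplier_kernel_def inner_add_left inner_commute[of \<zeta>] distrib_left exp_add)
  also have "\<dots> = exp (\<i> * complex_of_real (x \<bullet> \<zeta>)) * inv_fourier (fourier \<theta>) \<zeta>"
    by (simp only: integral_mult_right_zero inv_fourier_lborel[OF schwartz_measurable[OF schwartz_fourier[OF \<theta>]]])
  finally show ?thesis
    by (simp add: inv_fourier_fourier[OF \<theta>])
qed

lemma kernel_lborel:
  fixes \<theta> :: "real^'n::finite \<Rightarrow> complex"
  assumes "\<theta> \<in> schwartz"
  shows "multiplier_kernel \<theta> x = complex_of_real ((fourier_const TYPE('n))\<^sup>2) * (\<integral>\<xi>. \<theta> \<xi> * exp (- \<i> * complex_of_real (\<xi> \<bullet> x)) \<partial>lborel)"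
  unfolding multiplier_kernel_def fourier_lborel[OF schwartz_measurable[OF assms]]
  by (simp only: of_real_mult power2_eq_square mult.assoc)

lemma integrable_kernel_shift:
  fixes \<theta> :: "real^'n::finite \<Rightarrow> complex"
  assumes "\<kappa> \<in> schwartz" "e \<in> borel_measurable borel" "\<And>y. norm (e y) \<le> M"
  shows "integrable lborel (\<lambda>y::real^'n. \<kappa> (y - x) * e y)"
proof -
  note [measurable] = schwartz_measurable[OF assms(1)] assms(2)
  have "(\<lambda>y. \<kappa> (1 *\<^sub>R y + (- x))) \<in> schwartz"
    by (rule schwartz_affine[OF assms(1)]) simp
  then have "integrable lborel (\<lambda>y. \<kappa> (y - x))"
    using schwartz_integrable by simp
  then have "integrable lborel (\<lambda>y. \<kappa> (y - x) * complex_of_real M)" by simp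
  then show ?thesis
  proof (rule Bochner_Integration.integrable_bound)
    show "AE y in lborel. norm (\<kappa> (y - x) * e y) \<le> norm (\<kappa> (y - x) * complex_of_real M)"
    proof (rule AE_I2)
      fix y
      show "norm (\<kappa> (y - x) * e y) \<le> norm (\<kappa> (y - x) * complex_of_real M)"
        using assms(3)[of y] by (simp add: norm_mult mult_left_mono)
    qed
  qed measurable
qed

text \<open>The spectrum of a product lies in the sum of the spectra: expanding two of the kernels into
  exponentials, the integral over \<open>y\<close> produces the multiplier \<open>\<theta>\<close> at the sum of the frequencies.\<close>

lemma kernel_triple_integral_zero:
  fixes \<theta> \<alpha> \<beta> :: "real^'n::finite \<Rightarrow> complex"
  assumes \<theta>: "\<theta> \<in> schwartz" and \<alpha>: "\<alpha> \<in> schwartz" and \<beta>: "\<beta> \<in> schwartz"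
    and zero: "\<And>\<xi> \<eta>. \<alpha> \<xi> * \<beta> \<eta> * \<theta> (\<xi> + \<eta>) = 0"
  shows "(\<integral>y. multiplier_kernel \<theta> (y - x) * multiplier_kernel \<alpha> (z - y) * multiplier_kernel \<beta> (w - y) \<partial>lborel) = 0"
proof -
  let ?c = "complex_of_real ((fourier_const TYPE('n))\<^sup>2)"
  let ?e = "\<lambda>\<xi> x. exp (- \<i> * complex_of_real (\<xi> \<bullet> x))"
  note [measurable] = schwartz_measurable[OF \<alpha>] schwartz_measurable[OF \<beta>]
    schwartz_measurable[OF kernel_schwartz[OF \<theta>]] schwartz_measurable[OF kernel_schwartz[OF \<alpha>]]
  \<comment> \<open>One frequency \<eta> of \<beta> is frozen first, so that each of the two
    applications of Fubini expands only a single kernel.\<close>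
  have inner: "\<beta> \<eta> * (\<integral>y. multiplier_kernel \<theta> (y - x) * multiplier_kernel \<alpha> (z - y) * ?e \<eta> (w - y) \<partial>lborel) = 0" for \<eta>
  proof -
    let ?g = "\<lambda>y. multiplier_kernel \<theta> (y - x) * ?e \<eta> (w - y)"
    have [measurable]: "(\<lambda>y. ?e \<eta> (w - y)) \<in> borel_measurable borel"
      by (intro borel_measurable_continuous_onI continuous_intros)
    have g: "integrable lborel ?g"
      by (rule integrable_kernel_shift[OF kernel_schwartz[OF \<theta>], where M = 1]) simp_all
    have phase: "(\<integral>y. ?g y * ?e \<xi> (z - y) \<partial>lborel) =
        ?e \<eta> w * ?e \<xi> z * (exp (\<i> * complex_of_real (x \<bullet> (\<xi> + \<eta>))) * \<theta> (\<xi> + \<eta>))" for \<xi>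
    proof -
      have "?g y * ?e \<xi> (z - y) = ?e \<eta> w * ?e \<xi> z * (multiplier_kernel \<theta> (y - x) * exp (\<i> * complex_of_real (y \<bullet> (\<xi> + \<eta>))))" for y
      proof -
        have "?e \<eta> (w - y) * ?e \<xi> (z - y) = ?e \<eta> w * ?e \<xi> z * exp (\<i> * complex_of_real (y \<bullet> (\<xi> + \<eta>)))"
          by (simp add: exp_add[symmetric] inner_diff_right inner_add_right inner_commute[of y] algebra_simps)
        then show ?thesis by (simp add: mult_ac)
      qed
      then show ?thesis
        by (simp only: integral_mult_right_zero kernel_modulation[OF \<theta>])
    qed
    have "(\<integral>y. multiplier_kernel \<theta> (y - x) * multiplier_kernel \<alpha> (z - y) * ?e \<eta> (w - y) \<partial>lborel) =
        (\<integral>y. ?c * (?g y * (\<integral>\<xi>. \<alpha> \<xi> * ?e \<xi> (z - y) \<partial>lborel)) \<partial>lborel)"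
      by (intro Bochner_Integration.integral_cong refl) (simp only: kernel_lborel[OF \<alpha>] mult_ac)
    also have "\<dots> = ?c * (\<integral>y. ?g y * (\<integral>\<xi>. \<alpha> \<xi> * ?e \<xi> (z - y) \<partial>lborel) \<partial>lborel)"
      by (rule integral_mult_right_zero)
    also have "(\<integral>y. ?g y * (\<integral>\<xi>. \<alpha> \<xi> * ?e \<xi> (z - y) \<partial>lborel) \<partial>lborel) =
        (\<integral>\<xi>. \<alpha> \<xi> * (\<integral>y. ?g y * ?e \<xi> (z - y) \<partial>lborel) \<partial>lborel)"
      using fubini_cis[OF g schwartz_integrable[OF \<alpha>], of "\<lambda>p. ?e (snd p) (z - fst p)"] by simp
    finally have eq: "(\<integral>y. multiplier_kernel \<theta> (y - x) * multiplier_kernel \<alpha> (z - y) * ?e \<eta> (w - y) \<partial>lborel) =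
      ?c * (\<integral>\<xi>. \<alpha> \<xi> * (?e \<eta> w * ?e \<xi> z * (exp (\<i> * complex_of_real (x \<bullet> (\<xi> + \<eta>))) * \<theta> (\<xi> + \<eta>))) \<partial>lborel)"
      unfolding phase .
    show ?thesis
    proof (cases "\<beta> \<eta> = 0")
      case False
      then have "\<alpha> \<xi> * (?e \<eta> w * ?e \<xi> z * (exp (\<i> * complex_of_real (x \<bullet> (\<xi> + \<eta>))) * \<theta> (\<xi> + \<eta>))) = 0" for \<xi>
        using zero[of \<xi> \<eta>] by auto
      then show ?thesis
        by (simp only: eq Bochner_Integration.integral_zero mult_zero_right)
    qed simp
  qed
  let ?h = "\<lambda>y. multiplier_kernel \<theta> (y - x) * multiplier_kernel \<alpha> (z - y)"
  obtain M where M: "\<And>x. norm (multiplier_kernel \<alpha> x) \<le> M"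
    using kernel_schwartz[OF \<alpha>] unfolding schwartz_iff by (metis (no_types) mult_1 partial_derivs.simps(1) power_0)
  have h: "integrable lborel ?h"
    by (rule integrable_kernel_shift[OF kernel_schwartz[OF \<theta>], where M = M]) (measurable, rule M)
  have "(\<integral>y. ?h y * multiplier_kernel \<beta> (w - y) \<partial>lborel) = (\<integral>y. ?c * (?h y * (\<integral>\<eta>. \<beta> \<eta> * ?e \<eta> (w - y) \<partial>lborel)) \<partial>lborel)"
    by (intro Bochner_Integration.integral_cong refl) (simp only: kernel_lborel[OF \<beta>] mult_ac)
  also have "\<dots> = ?c * (\<integral>y. ?h y * (\<integral>\<eta>. \<beta> \<eta> * ?e \<eta> (w - y) \<partial>lborel) \<partial>lborel)"
    by (rule integral_mult_right_zero)
  also have "(\<integral>y. ?h y * (\<integral>\<eta>. \<beta> \<eta> * ?e \<eta> (w - y) \<partial>lborel) \<partial>lborel) =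
      (\<integral>\<eta>. \<beta> \<eta> * (\<integral>y. ?h y * ?e \<eta> (w - y) \<partial>lborel) \<partial>lborel)"
    using fubini_cis[OF h schwartz_integrable[OF \<beta>], of "\<lambda>p. ?e (snd p) (w - fst p)"] by simp
  also have "\<dots> = 0" unfolding inner by simp
  finally show ?thesis by simp
qed

text \<open>The factors \<open>F\<close> and \<open>G\<close> are moved outside one at a time by
  \<open>tame_fubini\<close>, each time against an integrable product of a kernel with a bounded
  function. What remains inside is an integral of three kernels, which no longer involves
  \<open>F\<close> and \<open>G\<close> and vanishes for spectral reasons.\<close>

lemma conv_product_zero:
  fixes \<theta> \<alpha> \<beta> F G :: "real^'n::finite \<Rightarrow> complex"
  assumes \<theta>: "\<theta> \<in> schwartz" and \<alpha>: "\<alpha> \<in> schwartz" and \<beta>: "\<beta> \<in> schwartz"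
    and zero: "\<And>\<xi> \<eta>. \<alpha> \<xi> * \<beta> \<eta> * \<theta> (\<xi> + \<eta>) = 0"
    and F: "tame F" and G: "tame G"
  shows "conv (multiplier_kernel \<theta>) (\<lambda>y. conv (multiplier_kernel \<alpha>) F y * conv (multiplier_kernel \<beta>) G y) x = 0"
proof -
  note k = kernel_schwartz[OF \<theta>] kernel_schwartz[OF \<alpha>] kernel_schwartz[OF \<beta>]
  note [measurable] = k[THEN schwartz_measurable] conv_measurable[OF G k(3)]
  obtain M where M: "\<And>y. norm (conv (multiplier_kernel \<beta>) G y) \<le> M"
    using conv_bounded[OF G k(3)] by metis
  obtain A where A: "\<And>x. norm (multiplier_kernel \<alpha> x) \<le> A"
    using k(2) unfolding schwartz_iff by (metis (no_types) mult_1 partial_derivs.simps(1) power_0)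
  have i1: "integrable lborel (\<lambda>y. multiplier_kernel \<theta> (y - x) * conv (multiplier_kernel \<beta>) G y)"
    by (rule integrable_kernel_shift[OF k(1) _ M]) measurable
  have i2: "integrable lborel (\<lambda>y. multiplier_kernel \<theta> (y - x) * multiplier_kernel \<alpha> (z - y))" for z
    by (rule integrable_kernel_shift[OF k(1), where M = A]) (measurable, rule A)
  have "conv (multiplier_kernel \<theta>) (\<lambda>y. conv (multiplier_kernel \<alpha>) F y * conv (multiplier_kernel \<beta>) G y) x =
      (\<integral>y. multiplier_kernel \<theta> (y - x) * conv (multiplier_kernel \<beta>) G y * conv (multiplier_kernel \<alpha>) F y \<partial>lborel)"
    unfolding conv_def[of "multiplier_kernel \<theta>"] by (simp only: mult_ac)
  also have "\<dots> = (\<integral>z. F z * (\<integral>y. multiplier_kernel \<theta> (y - x) * conv (multiplier_kernel \<beta>) G y * multiplier_kernel \<alpha> (z - y) \<partial>lborel) \<partial>lborel)"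
    by (rule tame_fubini[OF i1 F k(2)])
  also have "\<dots> = (\<integral>z. F z * (\<integral>y. multiplier_kernel \<theta> (y - x) * multiplier_kernel \<alpha> (z - y) * conv (multiplier_kernel \<beta>) G y \<partial>lborel) \<partial>lborel)"
    by (simp only: mult_ac)
  also have "\<dots> = 0"
    by (simp add: tame_fubini[OF i2 G k(3)] kernel_triple_integral_zero[OF \<theta> \<alpha> \<beta> zero])
  finally show ?thesis .
qed

section \<open>Morrey bounds\<close>

text \<open>Real-valued form of the bound on the Morrey norm by \<open>A\<close>, without roots of extended reals.\<close>

definition morrey_le :: "real \<Rightarrow> real \<Rightarrow> (real^'n::finite \<Rightarrow> complex) \<Rightarrow> real \<Rightarrow> bool" where
  "morrey_le p q F A \<longleftrightarrow> F \<in> borel_measurable borel \<and> 0 \<le> A \<and>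
     (\<forall>x. \<forall>\<rho>>0. (\<integral>\<^sup>+y. ennreal (norm (F y) powr q) * indicator (ball x \<rho>) y \<partial>lborel)
        \<le> ennreal ((A * measure lborel (ball x \<rho>) powr (1 / q - 1 / p)) powr q))"

lemma morrey_leI:
  assumes "F \<in> borel_measurable borel" "0 \<le> A"
    "\<And>x \<rho>. \<rho> > 0 \<Longrightarrow> (\<integral>\<^sup>+y. ennreal (norm (F y) powr q) * indicator (ball x \<rho>) y \<partial>lborel)
        \<le> ennreal ((A * measure lborel (ball x \<rho>) powr (1 / q - 1 / p)) powr q)"
  shows "morrey_le p q F A"
  using assms by (simp add: morrey_le_def)

lemma morrey_leD:
  assumes "morrey_le p q F A"
  shows "F \<in> borel_measurable borel" "0 \<le> A"
    "\<rho> > 0 \<Longrightarrow> (\<integral>\<^sup>+y. ennreal (norm (F y) powr q) * indicator (ball x \<rho>) y \<partial>lborel)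
        \<le> ennreal ((A * measure lborel (ball x \<rho>) powr (1 / q - 1 / p)) powr q)"
  using assms by (auto simp: morrey_le_def)

lemma powr_root_le_iff:
  fixes i V A q a :: real
  assumes "i \<ge> 0" "V > 0" "A \<ge> 0" "q > 0"
  shows "V powr (- a) * i powr (1 / q) \<le> A \<longleftrightarrow> i \<le> (A * V powr a) powr q"
proof -
  have W: "V powr a > 0" using assms by simp
  have "V powr (- a) * i powr (1 / q) \<le> A \<longleftrightarrow> i powr (1 / q) \<le> A * V powr a"
    using W by (simp add: powr_minus field_simps)
  also have "\<dots> \<longleftrightarrow> i \<le> (A * V powr a) powr q"
  proof
    assume "i powr (1 / q) \<le> A * V powr a"
    then have "(i powr (1 / q)) powr q \<le> (A * V powr a) powr q"
      using assms by (intro powr_mono2) auto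
    then show "i \<le> (A * V powr a) powr q"
      using assms by (simp add: powr_powr)
  next
    assume "i \<le> (A * V powr a) powr q"
    then have "i powr (1 / q) \<le> ((A * V powr a) powr q) powr (1 / q)"
      using assms by (intro powr_mono2) auto
    then show "i powr (1 / q) \<le> A * V powr a"
      using assms by (simp add: powr_powr)
  qed
  finally show ?thesis .
qed

lemma ennreal_powr_le_iff:
  assumes "V > 0" "A \<ge> 0" "q > 0"
  shows "ennreal (V powr (- a)) * ennreal_powr I (1 / q) \<le> ennreal A \<longleftrightarrow> I \<le> ennreal ((A * V powr a) powr q)"
proof (cases I)
  case (real i)
  have "ennreal (V powr (- a)) * ennreal_powr I (1 / q) = ennreal (V powr (- a) * i powr (1 / q))"
    using real by (simp add: ennreal_powr_def ennreal_mult'[symmetric])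
  then show ?thesis
    using powr_root_le_iff[OF real(1) assms, of a] real assms by (simp add: ennreal_le_iff)
next
  case top
  then show ?thesis
    using assms by (simp add: ennreal_powr_def ennreal_mult_top top_unique)
qed

lemma morrey_le_iff:
  fixes F :: "real^'n::finite \<Rightarrow> complex"
  assumes [measurable]: "F \<in> borel_measurable borel" and A: "0 \<le> A" and q: "q > 0"
  shows "morrey_norm p q F \<le> ennreal A \<longleftrightarrow> morrey_le p q F A"
proof -
  have "ennreal (measure lebesgue (ball x \<rho>) powr (1 / p - 1 / q)) * Lq_norm_on q (ball x \<rho>) F \<le> ennreal A \<longleftrightarrow>
    (\<integral>\<^sup>+y. ennreal (norm (F y) powr q) * indicator (ball x \<rho>) y \<partial>lborel)
        \<le> ennreal ((A * measure lborel (ball x \<rho>) powr (1 / q - 1 / p)) powr q)" if "\<rho> > 0" for x \<rho>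
  proof -
    have "measure lborel (ball x \<rho>) > 0" using that by simp
    from ennreal_powr_le_iff[OF this A q, of "1 / q - 1 / p"] show ?thesis
      unfolding Lq_norm_on_def nn_integral_completion by (simp add: measure_completion)
  qed
  then show ?thesis
    using assms by (auto simp: morrey_norm_def morrey_le_def SUP_le_iff)
qed

lemma morrey_norm_cong_AE:
  assumes "AE x in lborel. F x = G x"
  shows "morrey_norm p q F = morrey_norm p q G"
proof -
  have "Lq_norm_on q B F = Lq_norm_on q B G" for B
    unfolding Lq_norm_on_def nn_integral_completion
    by (intro arg_cong2[where f = ennreal_powr] nn_integral_cong_AE refl)
      (use assms in eventually_elim, simp)
  then show ?thesis by (simp add: morrey_norm_def)
qed

lemma morrey_norm_dist_eq:
  fixes \<psi> :: "real^'n::finite \<Rightarrow> real" and F :: "real^'n \<Rightarrow> complex"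
  assumes \<psi>: "cutoff \<psi>" and F: "represents F u"
  shows "morrey_norm_dist p q u = morrey_norm p q F"
proof -
  have "(\<lambda>G. morrey_norm p q G) ` {G. represents G u} = (\<lambda>G. morrey_norm p q F) ` {G. represents G u}"
    by (rule image_cong[OF refl], rule morrey_norm_cong_AE, rule represents_unique[OF \<psi> _ F]) simp
  also have "\<dots> = {morrey_norm p q F}"
    by (rule image_constant[of F]) (simp add: F)
  finally have *: "(\<lambda>G. morrey_norm p q G) ` {G. represents G u} = {morrey_norm p q F}" .
  show ?thesis unfolding morrey_norm_dist_def * by (rule cInf_singleton)
qed

lemma morrey_le_mono:
  assumes "morrey_le p q F A" "A \<le> B" "q > 0"
  shows "morrey_le p q F B"
proof (rule morrey_leI)
  show "F \<in> borel_measurable borel" "0 \<le> B"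
    using assms(1,2) morrey_leD(1,2)[OF assms(1)] by auto
  fix x :: "real^'a" and \<rho> :: real assume "\<rho> > 0"
  let ?W = "measure lborel (ball x \<rho>) powr (1 / q - 1 / p)"
  have "(A * ?W) powr q \<le> (B * ?W) powr q"
    by (rule powr_mono2) (use assms(2,3) morrey_leD(2)[OF assms(1)] in \<open>simp_all add: mult_right_mono\<close>)
  then show "(\<integral>\<^sup>+y. ennreal (norm (F y) powr q) * indicator (ball x \<rho>) y \<partial>lborel) \<le> ennreal ((B * ?W) powr q)"
    using morrey_leD(3)[OF assms(1) \<open>\<rho> > 0\<close>, of x] ennreal_leI order_trans by blast
qed

lemma morrey_le_cong_AE:
  assumes F: "morrey_le p q F A" and G: "G \<in> borel_measurable borel" and eq: "AE x in lborel. F x = G x"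
  shows "morrey_le p q G A"
proof (rule morrey_leI[OF G morrey_leD(2)[OF F]])
  fix x :: "real^'a" and \<rho> :: real assume "\<rho> > 0"
  have "(\<integral>\<^sup>+y. ennreal (norm (G y) powr q) * indicator (ball x \<rho>) y \<partial>lborel)
      = (\<integral>\<^sup>+y. ennreal (norm (F y) powr q) * indicator (ball x \<rho>) y \<partial>lborel)"
    by (rule nn_integral_cong_AE) (use eq in eventually_elim, simp)
  then show "(\<integral>\<^sup>+y. ennreal (norm (G y) powr q) * indicator (ball x \<rho>) y \<partial>lborel)
        \<le> ennreal ((A * measure lborel (ball x \<rho>) powr (1 / q - 1 / p)) powr q)"
    using morrey_leD(3)[OF F \<open>\<rho> > 0\<close>] by simp
qed

text \<open>Several estimates below normalise by the bound and hence need it positive; this settles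
  their degenerate case.\<close>

lemma morrey_le_zero:
  fixes F :: "real^'n::finite \<Rightarrow> complex"
  assumes F: "morrey_le p q F 0" and q: "q > 0"
  shows "AE x in lborel. F x = 0"
proof -
  note [measurable] = morrey_leD(1)[OF F]
  have [measurable]: "ball (0::real^'n) r \<in> sets borel" for r by simp
  have "AE x in lborel. x \<in> ball 0 (real (Suc m)) \<longrightarrow> F x = 0" for m
  proof -
    have "(\<integral>\<^sup>+y. ennreal (norm (F y) powr q) * indicator (ball 0 (real (Suc m))) y \<partial>lborel) = 0"
      using morrey_leD(3)[OF F, of "real (Suc m)" 0] q by simp
    then have "AE y in lborel. ennreal (norm (F y) powr q) * indicator (ball 0 (real (Suc m))) y = 0"
      by (subst (asm) nn_integral_0_iff_AE) auto
    then show ?thesis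
    proof eventually_elim
      case (elim y)
      then show ?case by (auto simp: indicator_def split: if_splits)
    qed
  qed
  then have "AE x in lborel. \<forall>m. x \<in> ball 0 (real (Suc m)) \<longrightarrow> F x = 0"
    by (subst AE_all_countable) blast
  then show ?thesis
  proof eventually_elim
    case (elim x)
    obtain m :: nat where "norm x \<le> real m" using real_arch_simple by blast
    then show ?case using elim[rule_format, of m] by simp
  qed
qed

lemma morrey_le_0_function:
  assumes "0 \<le> A" "q > 0"
  shows "morrey_le p q (\<lambda>x. 0) A"
  using assms by (intro morrey_leI) auto

lemma morrey_le_AE_zero:
  fixes F :: "real^'n::finite \<Rightarrow> complex"
  assumes "F \<in> borel_measurable borel" "AE x in lborel. F x = 0" "0 \<le> A" "q > 0"
  shows "morrey_le p q F A"
  by (rule morrey_le_cong_AE[OF morrey_le_0_function[OF assms(3,4)] assms(1)])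
    (use assms(2) in eventually_elim, simp)

text \<open>Young's inequality with the conjugate exponents \<open>q1 / q\<close> and
  \<open>q2 / q\<close>, applied pointwise to \<open>u / a\<close> and \<open>v / b\<close> and then
  integrated. Working with bounds \<open>a\<close> and \<open>b\<close> in place of norms avoids
  roots of extended reals.\<close>

lemma Holder_nn_integral:
  fixes u v :: "'a \<Rightarrow> real"
  assumes [measurable]: "u \<in> borel_measurable M" "v \<in> borel_measurable M"
    and nn: "\<And>x. u x \<ge> 0" "\<And>x. v x \<ge> 0" and ab: "a > 0" "b > 0"
    and q: "q > 0" "q1 > 0" "q2 > 0" "1 / q = 1 / q1 + 1 / q2"
    and u: "(\<integral>\<^sup>+x. ennreal (u x powr q1) \<partial>M) \<le> ennreal (a powr q1)"
    and v: "(\<integral>\<^sup>+x. ennreal (v x powr q2) \<partial>M) \<le> ennreal (b powr q2)"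
  shows "(\<integral>\<^sup>+x. ennreal ((u x * v x) powr q) \<partial>M) \<le> ennreal ((a * b) powr q)"
proof -
  have sum1: "q / q1 + q / q2 = 1"
    using arg_cong[OF q(4), of "\<lambda>t. q * t"] q(1) by (simp add: distrib_left)
  have lt: "q1 / q > 1" "q2 / q > 1"
  proof -
    have "q / q1 > 0" "q / q2 > 0" using q by simp_all
    then have "q / q1 < 1" "q / q2 < 1" using sum1 by linarith+
    then show "q1 / q > 1" "q2 / q > 1" using q by (simp_all add: divide_less_eq less_divide_eq)
  qed
  \<comment> \<open>The two coefficients are chosen so that, after integration, the terms contribute
    the shares \<open>q / q1\<close> and \<open>q / q2\<close> of \<open>(a * b) powr q\<close>; the
    shares add up to 1.\<close>
  define c1 where "c1 = (a * b) powr q * (q / q1) / a powr q1"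
  define c2 where "c2 = (a * b) powr q * (q / q2) / b powr q2"
  have c: "c1 \<ge> 0" "c2 \<ge> 0" using q by (auto simp: c1_def c2_def)
  have point: "(u x * v x) powr q \<le> c1 * u x powr q1 + c2 * v x powr q2" for x
  proof -
    have "(u x / a) powr q * (v x / b) powr q
        \<le> ((u x / a) powr q) powr (q1 / q) / (q1 / q) + ((v x / b) powr q) powr (q2 / q) / (q2 / q)"
      using lt sum1 by (intro Youngs_inequality) auto
    also have "\<dots> = (q / q1) * (u x powr q1 / a powr q1) + (q / q2) * (v x powr q2 / b powr q2)"
      using q ab nn by (simp add: powr_powr powr_divide mult_ac)
    finally have "(a * b) powr q * ((u x / a) powr q * (v x / b) powr q)
      \<le> (a * b) powr q * ((q / q1) * (u x powr q1 / a powr q1) + (q / q2) * (v x powr q2 / b powr q2))"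
      by (rule mult_left_mono) simp
    moreover have "(a * b) powr q * ((u x / a) powr q * (v x / b) powr q) = (u x * v x) powr q"
      using ab nn by (simp add: powr_mult powr_divide)
    ultimately show ?thesis
      by (simp add: c1_def c2_def distrib_left)
  qed
  have "(\<integral>\<^sup>+x. ennreal ((u x * v x) powr q) \<partial>M)
      \<le> (\<integral>\<^sup>+x. ennreal c1 * ennreal (u x powr q1) + ennreal c2 * ennreal (v x powr q2) \<partial>M)"
    using point c by (intro nn_integral_mono)
      (simp add: ennreal_mult'[symmetric] ennreal_plus[symmetric] ennreal_leI del: ennreal_plus)
  also have "\<dots> = ennreal c1 * (\<integral>\<^sup>+x. ennreal (u x powr q1) \<partial>M) + ennreal c2 * (\<integral>\<^sup>+x. ennreal (v x powr q2) \<partial>M)"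
    by (subst nn_integral_add) (auto simp: nn_integral_cmult)
  also have "\<dots> \<le> ennreal c1 * ennreal (a powr q1) + ennreal c2 * ennreal (b powr q2)"
    by (intro add_mono mult_left_mono u v) auto
  also have "\<dots> = ennreal (c1 * a powr q1 + c2 * b powr q2)"
    using c by (simp add: ennreal_mult'[symmetric] ennreal_plus[symmetric] del: ennreal_plus)
  also have "c1 * a powr q1 + c2 * b powr q2 = (a * b) powr q * (q / q1 + q / q2)"
    using ab by (simp add: c1_def c2_def distrib_left)
  finally show ?thesis
    by (simp add: sum1)
qed

text \<open>Hoelder's inequality on each ball. The powers of the volume multiply correctly because
  the relations for p and for q subtract to
  \<open>(1 / q1 - 1 / p1) + (1 / q2 - 1 / p2) = 1 / q - 1 / p\<close>.\<close>

lemma morrey_le_mult: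
  fixes F G :: "real^'n::finite \<Rightarrow> complex"
  assumes F: "morrey_le p1 q1 F A" and G: "morrey_le p2 q2 G B"
    and q: "q > 0" "q1 > 0" "q2 > 0" "1 / q = 1 / q1 + 1 / q2" and p: "1 / p = 1 / p1 + 1 / p2"
  shows "morrey_le p q (\<lambda>x. F x * G x) (A * B)"
proof -
  note [measurable] = morrey_leD(1)[OF F] morrey_leD(1)[OF G]
  have nn: "A \<ge> 0" "B \<ge> 0" using morrey_leD(2) F G by blast+
  show ?thesis
  proof (cases "A = 0 \<or> B = 0")
    case True
    have "AE x in lborel. F x * G x = 0"
    proof (cases "A = 0")
      case True
      then have "AE x in lborel. F x = 0" using morrey_le_zero[of p1 q1 F] F q(2) by blast
      then show ?thesis by eventually_elim simp
    next
      case False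
      then have "B = 0" using True by blast
      then have "AE x in lborel. G x = 0" using morrey_le_zero[of p2 q2 G] G q(3) by blast
      then show ?thesis by eventually_elim simp
    qed
    then show ?thesis using nn q(1) by (intro morrey_le_AE_zero) auto
  next
    case False
    then have pos: "A > 0" "B > 0" using nn by auto
    show ?thesis
    proof (rule morrey_leI)
      fix x :: "real^'n" and \<rho> :: real assume \<rho>: "\<rho> > 0"
      let ?V = "measure lborel (ball x \<rho>)"
      have V: "?V > 0" using \<rho> by simp
      have [measurable]: "ball x \<rho> \<in> sets borel" by simp
      have ind: "ennreal (norm (E y) powr e) * indicator (ball x \<rho>) y = ennreal ((norm (E y) * indicator (ball x \<rho>) y) powr e)"
        for E :: "real^'n \<Rightarrow> complex" and e y
        by (auto simp: indicator_def)
      have "(\<integral>\<^sup>+y. ennreal (((norm (F y) * indicator (ball x \<rho>) y) * (norm (G y) * indicator (ball x \<rho>) y)) powr q) \<partial>lborel)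
         \<le> ennreal (((A * ?V powr (1 / q1 - 1 / p1)) * (B * ?V powr (1 / q2 - 1 / p2))) powr q)"
      proof (rule Holder_nn_integral[OF _ _ _ _ _ _ q])
        show "(\<integral>\<^sup>+y. ennreal ((norm (F y) * indicator (ball x \<rho>) y) powr q1) \<partial>lborel) \<le> ennreal ((A * ?V powr (1 / q1 - 1 / p1)) powr q1)"
          using morrey_leD(3)[OF F \<rho>, of x] unfolding ind .
        show "(\<integral>\<^sup>+y. ennreal ((norm (G y) * indicator (ball x \<rho>) y) powr q2) \<partial>lborel) \<le> ennreal ((B * ?V powr (1 / q2 - 1 / p2)) powr q2)"
          using morrey_leD(3)[OF G \<rho>, of x] unfolding ind .
      qed (use pos V in auto)
      moreover have "(A * ?V powr (1 / q1 - 1 / p1)) * (B * ?V powr (1 / q2 - 1 / p2)) = A * B * ?V powr (1 / q - 1 / p)"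
      proof -
        have "?V powr (1 / q1 - 1 / p1) * ?V powr (1 / q2 - 1 / p2) = ?V powr (1 / q - 1 / p)"
          unfolding powr_add[symmetric] q(4) p by (simp add: algebra_simps)
        then show ?thesis by (simp add: mult_ac)
      qed
      moreover have "((norm (F y) * indicator (ball x \<rho>) y) * (norm (G y) * indicator (ball x \<rho>) y)) powr q =
          (norm (F y * G y) * indicator (ball x \<rho>) y) powr q" for y
        by (simp add: norm_mult indicator_def)
      ultimately show "(\<integral>\<^sup>+y. ennreal (norm (F y * G y) powr q) * indicator (ball x \<rho>) y \<partial>lborel)
        \<le> ennreal ((A * B * ?V powr (1 / q - 1 / p)) powr q)"
        unfolding ind[where E = "\<lambda>y. F y * G y" and e = q] by simp
    qed (use nn in auto)
  qed
qed

text \<open>The convex function h^q lies above its tangent at s; both sides are multiplied by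
  s^(1-q). Integrating this linear bound with a good choice of s gives Jensen's inequality,
  uniformly in q including q = 1.\<close>

lemma tangent_powr:
  fixes h s q :: real
  assumes "q \<ge> 1" "s > 0" "h \<ge> 0"
  shows "q * h \<le> s powr (1 - q) * h powr q + (q - 1) * s"
proof (cases "q = 1 \<or> h = 0")
  case True
  then show ?thesis using assms by auto
next
  case False
  then have q: "q > 1" and h: "h > 0" using assms by auto
  have "(s powr (1 - q) * h powr q) powr (1 / q) * s powr (1 - 1 / q) \<le> (1 / q) * (s powr (1 - q) * h powr q) + (1 - 1 / q) * s"
    using q h assms(2) by (intro Youngs_inequality_0) auto
  moreover have "(s powr (1 - q) * h powr q) powr (1 / q) * s powr (1 - 1 / q) = h"
  proof -
    have "(s powr (1 - q) * h powr q) powr (1 / q) = s powr ((1 - q) / q) * h"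
      using q h assms(2) by (simp add: powr_mult powr_powr)
    moreover have "s powr ((1 - q) / q) * s powr (1 - 1 / q) = 1"
      using q assms(2) by (simp add: powr_add[symmetric] diff_divide_distrib)
    ultimately show ?thesis by (simp add: mult_ac)
  qed
  ultimately have "h \<le> (1 / q) * (s powr (1 - q) * h powr q) + (1 - 1 / q) * s" by simp
  then have "q * h \<le> q * ((1 / q) * (s powr (1 - q) * h powr q) + (1 - 1 / q) * s)"
    using q by (intro mult_left_mono) auto
  also have "\<dots> = s powr (1 - q) * h powr q + (q - 1) * s"
    using q by (simp add: field_simps)
  finally show ?thesis .
qed

text \<open>Jensen's inequality from the tangent at the mean \<open>t / W\<close>. Only a lower bound \<open>t\<close> for the
  integral appears, so nothing needs to be finite.\<close>

lemma jensen_powr: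
  fixes w h :: "'a \<Rightarrow> real"
  assumes [measurable]: "w \<in> borel_measurable N" "h \<in> borel_measurable N"
    and nn: "\<And>y. w y \<ge> 0" "\<And>y. h y \<ge> 0" and q: "q \<ge> 1" and W: "W > 0"
    and wW: "(\<integral>\<^sup>+y. ennreal (w y) \<partial>N) \<le> ennreal W"
    and t: "t \<ge> 0" "ennreal t \<le> (\<integral>\<^sup>+y. ennreal (w y * h y) \<partial>N)"
  shows "ennreal (t powr q) \<le> ennreal (W powr (q - 1)) * (\<integral>\<^sup>+y. ennreal (w y * h y powr q) \<partial>N)"
proof (cases "t = 0")
  case False
  let ?J = "\<integral>\<^sup>+y. ennreal (w y * h y powr q) \<partial>N"
  define s where "s = t / W"
  have s: "s > 0" using False t W by (simp add: s_def)
  show ?thesis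
  proof (cases ?J)
    case (real J)
    have "ennreal (q * t) \<le> ennreal q * (\<integral>\<^sup>+y. ennreal (w y * h y) \<partial>N)"
      using q t by (simp add: ennreal_mult' mult_left_mono)
    also have "\<dots> = (\<integral>\<^sup>+y. ennreal q * ennreal (w y * h y) \<partial>N)"
      by (rule nn_integral_cmult[symmetric]) measurable
    also have "\<dots> \<le> (\<integral>\<^sup>+y. ennreal (s powr (1 - q)) * ennreal (w y * h y powr q) + ennreal ((q - 1) * s) * ennreal (w y) \<partial>N)"
    proof (rule nn_integral_mono)
      fix y
      have "w y * (q * h y) \<le> w y * (s powr (1 - q) * h y powr q + (q - 1) * s)"
        by (intro mult_left_mono tangent_powr q s nn)
      then have "q * (w y * h y) \<le> s powr (1 - q) * (w y * h y powr q) + ((q - 1) * s) * w y"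
        by (simp add: algebra_simps)
      then have "ennreal (q * (w y * h y)) \<le> ennreal (s powr (1 - q) * (w y * h y powr q) + ((q - 1) * s) * w y)"
        by (rule ennreal_leI)
      then show "ennreal q * ennreal (w y * h y) \<le> ennreal (s powr (1 - q)) * ennreal (w y * h y powr q) + ennreal ((q - 1) * s) * ennreal (w y)"
        using q s nn by (simp add: ennreal_mult' ennreal_plus)
    qed
    also have "\<dots> = ennreal (s powr (1 - q)) * ?J + ennreal ((q - 1) * s) * (\<integral>\<^sup>+y. ennreal (w y) \<partial>N)"
      by (subst nn_integral_add) (auto simp: nn_integral_cmult)
    also have "\<dots> \<le> ennreal (s powr (1 - q)) * ennreal J + ennreal ((q - 1) * s) * ennreal W"
      using real by (intro add_mono mult_left_mono wW) auto
    also have "\<dots> = ennreal (s powr (1 - q) * J + (q - 1) * s * W)"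
      using real q s W by (simp add: ennreal_mult' ennreal_plus)
    finally have "q * t \<le> s powr (1 - q) * J + (q - 1) * s * W"
      using real q s W by (subst (asm) ennreal_le_iff) auto
    moreover have "(q - 1) * s * W = (q - 1) * t"
      using W by (simp add: s_def)
    ultimately have "t \<le> s powr (1 - q) * J"
      by (simp add: algebra_simps)
    then have "s powr (q - 1) * t \<le> s powr (q - 1) * (s powr (1 - q) * J)"
      by (intro mult_left_mono) auto
    also have "\<dots> = J"
      using s by (simp add: powr_add[symmetric] mult.assoc[symmetric])
    finally have "W powr (q - 1) * (s powr (q - 1) * t) \<le> W powr (q - 1) * J"
      by (intro mult_left_mono) auto
    moreover have "W powr (q - 1) * (s powr (q - 1) * t) = t powr q"
    proof -
      have "W powr (q - 1) * s powr (q - 1) = t powr (q - 1)"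
        using W t by (simp add: s_def powr_divide)
      moreover have "t powr (q - 1) * t = t powr q"
        using False t by (simp add: powr_diff)
      ultimately show ?thesis by (simp add: mult.assoc[symmetric])
    qed
    ultimately have "ennreal (t powr q) \<le> ennreal (W powr (q - 1) * J)"
      by (intro ennreal_leI) simp
    then show ?thesis
      using real by (simp add: ennreal_mult')
  next
    case top
    then show ?thesis using W by (simp add: ennreal_mult_top)
  qed
qed simp

section \<open>Morrey functions are tame\<close>

lemma powr_le_one_plus:
  fixes V e :: real
  assumes "V > 0" "0 \<le> e" "e \<le> 1"
  shows "V powr e \<le> 1 + V"
proof (cases "V \<le> 1")
  case True
  then have "V powr e \<le> 1" using assms by (intro powr_le1) auto
  then show ?thesis using assms by simp
next
  case False
  then have "V powr e \<le> V powr 1" using assms by (intro powr_mono) auto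
  then show ?thesis using assms by simp
qed

text \<open>The sharp growth of the integral is V^(1 - 1/p) in the volume V. It is weakened to 1 +
  V, since the exponent lies between 0 and 1, because growth like the volume is all that the weight
  has to beat.\<close>

lemma morrey_le_ball_integral:
  fixes F :: "real^'n::finite \<Rightarrow> complex"
  assumes F: "morrey_le p q F A" and q: "1 \<le> q" "q \<le> p" and A: "A > 0" and \<rho>: "\<rho> > 0"
  shows "(\<integral>\<^sup>+z. ennreal (norm (F z)) * indicator (ball x \<rho>) z \<partial>lborel)
    \<le> ennreal ((1 + q) * A * (1 + measure lborel (ball x \<rho>)))"
proof -
  note [measurable] = morrey_leD(1)[OF F]
  have [measurable]: "ball x \<rho> \<in> sets borel" by simp
  define V where "V = measure lborel (ball x \<rho>)"
  have V: "V > 0" using \<rho> by (simp add: V_def)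
  have emV: "emeasure lborel (ball x \<rho>) = ennreal V"
    unfolding V_def using emeasure_lborel_ball_finite[of x \<rho>] by (simp add: emeasure_eq_ennreal_measure)
  \<comment> \<open>The mean size on the ball that the Morrey bound permits. The tangent at this
    point makes both terms of the estimate multiples of
    \<open>A * V powr (1 - 1 / p)\<close>.\<close>
  define s where "s = A * V powr (- 1 / p)"
  have s: "s > 0" using A V by (simp add: s_def)
  have p: "p > 0" using q by simp
  have "ennreal (norm (F z)) * indicator (ball x \<rho>) z
      \<le> ennreal (s powr (1 - q)) * (ennreal (norm (F z) powr q) * indicator (ball x \<rho>) z) + ennreal (q * s) * indicator (ball x \<rho>) z" for z
  proof -
    have "norm (F z) \<le> q * norm (F z)" using q(1) by (simp add: mult_le_cancel_right1)
    also have "\<dots> \<le> s powr (1 - q) * norm (F z) powr q + (q - 1) * s"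
      by (rule tangent_powr[OF q(1) s]) simp
    also have "\<dots> \<le> s powr (1 - q) * norm (F z) powr q + q * s"
      using s by (simp add: algebra_simps)
    finally have "ennreal (norm (F z)) \<le> ennreal (s powr (1 - q)) * ennreal (norm (F z) powr q) + ennreal (q * s)"
      using s q by (simp add: ennreal_mult'[symmetric] ennreal_plus[symmetric] ennreal_leI del: ennreal_plus)
    then show ?thesis by (simp add: indicator_def)
  qed
  then have "(\<integral>\<^sup>+z. ennreal (norm (F z)) * indicator (ball x \<rho>) z \<partial>lborel)
    \<le> (\<integral>\<^sup>+z. ennreal (s powr (1 - q)) * (ennreal (norm (F z) powr q) * indicator (ball x \<rho>) z) + ennreal (q * s) * indicator (ball x \<rho>) z \<partial>lborel)"
    by (intro nn_integral_mono)
  also have "\<dots> = ennreal (s powr (1 - q)) * (\<integral>\<^sup>+z. ennreal (norm (F z) powr q) * indicator (ball x \<rho>) z \<partial>lborel) + ennreal (q * s) * ennreal V"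
    by (subst nn_integral_add) (auto simp: nn_integral_cmult emV)
  also have "\<dots> \<le> ennreal (s powr (1 - q)) * ennreal ((A * V powr (1 / q - 1 / p)) powr q) + ennreal (q * s) * ennreal V"
    unfolding V_def by (intro add_mono mult_left_mono morrey_leD(3)[OF F \<rho>]) auto
  also have "\<dots> = ennreal (s powr (1 - q) * (A * V powr (1 / q - 1 / p)) powr q + q * s * V)"
    using s q V by (simp add: ennreal_mult'[symmetric] ennreal_plus[symmetric] del: ennreal_plus)
  also have "s powr (1 - q) * (A * V powr (1 / q - 1 / p)) powr q + q * s * V = (1 + q) * A * V powr (1 - 1 / p)"
  proof -
    have "s powr (1 - q) * (A * V powr (1 / q - 1 / p)) powr q =
        (A powr (1 - q) * A powr q) * (V powr ((q - 1) / p) * V powr ((1 / q - 1 / p) * q))"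
    proof -
      have e: "- ((1 - q) / p) = (q - 1) / p"
        unfolding minus_divide_left by simp
      show ?thesis
        using A V by (simp add: s_def powr_mult powr_powr mult_ac e)
    qed
    also have "A powr (1 - q) * A powr q = A"
      using A by (simp add: powr_add[symmetric])
    also have "V powr ((q - 1) / p) * V powr ((1 / q - 1 / p) * q) = V powr (1 - 1 / p)"
    proof -
      have "q \<noteq> 0" using q by simp
      then have "(q - 1) / p + (1 / q - 1 / p) * q = 1 - 1 / p"
        by (simp add: left_diff_distrib diff_divide_distrib)
      then show ?thesis
        unfolding powr_add[symmetric] by simp
    qed
    finally have 1: "s powr (1 - q) * (A * V powr (1 / q - 1 / p)) powr q = A * V powr (1 - 1 / p)" .
    have "V powr (- 1 / p) * V powr 1 = V powr (1 - 1 / p)"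
      unfolding powr_add[symmetric] by (simp add: add.commute)
    then have 2: "s * V = A * V powr (1 - 1 / p)"
      using V by (simp add: s_def mult.assoc)
    show ?thesis unfolding 1 mult.assoc 2 by (simp add: algebra_simps)
  qed
  also have "ennreal ((1 + q) * A * V powr (1 - 1 / p)) \<le> ennreal ((1 + q) * A * (1 + V))"
    using A V q p by (intro ennreal_leI mult_left_mono powr_le_one_plus) auto
  finally show ?thesis by (simp add: V_def)
qed

text \<open>\<open>K\<close> depends on the exponents and the dimension but not on \<open>F\<close>,
  so that the bounds for infinitely many dyadic pieces can be added up.\<close>

lemma morrey_le_weighted:
  fixes p q :: real
  assumes q: "1 \<le> q" "q \<le> p"
  obtains K where "K > 0"
    "\<And>F A y. morrey_le p q (F :: real^'n::finite \<Rightarrow> complex) A \<Longrightarrow>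
       (\<integral>\<^sup>+z. ennreal (norm (F z)) * ennreal (weight (z - y)) \<partial>lborel) \<le> ennreal (K * A)"
proof -
  define \<omega> where "\<omega> = unit_ball_vol (real CARD('n))"
  have \<omega>: "\<omega> \<ge> 0" by (simp add: \<omega>_def)
  define K where "K = 2 ^ Suc (Suc CARD('n)) * ((1 + q) * (1 + \<omega>))"
  have K: "K > 0" using q \<omega> by (simp add: K_def)
  show ?thesis
  proof (rule that[OF K])
    fix F :: "real^'n \<Rightarrow> complex" and A y assume F: "morrey_le p q F A"
    note [measurable] = morrey_leD(1)[OF F]
    show "(\<integral>\<^sup>+z. ennreal (norm (F z)) * ennreal (weight (z - y)) \<partial>lborel) \<le> ennreal (K * A)"
    proof (cases "A = 0")
      case True
      then have "AE x in lborel. F x = 0" using morrey_le_zero[of p q F] F q by simp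
      then have "(\<integral>\<^sup>+z. ennreal (norm (F z)) * ennreal (weight (z - y)) \<partial>lborel) = (\<integral>\<^sup>+z. 0 \<partial>(lborel :: (real^'n) measure))"
      proof (intro nn_integral_cong_AE)
        assume "AE x in lborel. F x = 0"
        then show "AE z in lborel. ennreal (norm (F z)) * ennreal (weight (z - y)) = 0"
          by eventually_elim simp
      qed
      then show ?thesis by simp
    next
      case False
      then have A: "A > 0" using morrey_leD(2)[OF F] by simp
      have "(\<integral>\<^sup>+z. ennreal (norm (F z)) * ennreal (weight (z - y)) \<partial>lborel)
          \<le> ennreal (2 ^ Suc (Suc CARD('n)) * ((1 + q) * (1 + \<omega>) * A))"
      proof (rule nn_integral_weight_le)
        fix k :: nat
        have "measure lborel (ball y (2 ^ k)) = \<omega> * 2 ^ (k * CARD('n))"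
          by (simp add: content_ball \<omega>_def power_mult)
        then have "1 + measure lborel (ball y (2 ^ k)) \<le> (1 + \<omega>) * 2 ^ (k * CARD('n))"
          by (simp add: distrib_right)
        then have "(1 + q) * A * (1 + measure lborel (ball y (2 ^ k))) \<le> (1 + q) * A * ((1 + \<omega>) * 2 ^ (k * CARD('n)))"
          using A q by (intro mult_left_mono) auto
        then show "(\<integral>\<^sup>+z. ennreal (norm (F z)) * indicator (ball y (2 ^ k)) z \<partial>lborel)
            \<le> ennreal ((1 + q) * (1 + \<omega>) * A * 2 ^ (k * CARD('n)))"
          by (intro order_trans[OF morrey_le_ball_integral[OF F q A]] ennreal_leI) (simp_all add: mult_ac)
      qed (use A q \<omega> in auto)
      then show ?thesis by (simp add: K_def mult_ac)
    qed
  qed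
qed

lemma morrey_le_tame:
  fixes F :: "real^'n::finite \<Rightarrow> complex"
  assumes "morrey_le p q F A" "1 \<le> q" "q \<le> p"
  shows "tame F"
proof -
  obtain K where K: "K > 0" and bound: "\<And>F A y. morrey_le p q (F :: real^'n \<Rightarrow> complex) A \<Longrightarrow>
       (\<integral>\<^sup>+z. ennreal (norm (F z)) * ennreal (weight (z - y)) \<partial>lborel) \<le> ennreal (K * A)"
    by (rule morrey_le_weighted[OF assms(2,3)]) (rule that)
  have "K * A \<ge> 0" using K morrey_leD(2)[OF assms(1)] by simp
  then show ?thesis
    unfolding tame_def using bound[OF assms(1)] morrey_leD(1)[OF assms(1)] by blast
qed

text \<open>Minkowski's inequality for infinitely many terms, from Jensen's inequality for the
  counting measure with weights \<open>b k\<close> applied to \<open>norm (Fk k x) / b k\<close>.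
  The hypothesis is domination by the series of norms, so the same lemma serves for limits, tails
  and finite sums.\<close>

lemma morrey_le_sum:
  fixes Fk :: "nat \<Rightarrow> real^'n::finite \<Rightarrow> complex"
  assumes Fk: "\<And>k. morrey_le p q (Fk k) (b k)" and b: "summable b" and q: "q \<ge> 1"
    and [measurable]: "F \<in> borel_measurable borel"
    and le: "AE x in lborel. ennreal (norm (F x)) \<le> (\<Sum>k. ennreal (norm (Fk k x)))"
  shows "morrey_le p q F (suminf b)"
proof -
  define B where "B = suminf b"
  have b0: "b k \<ge> 0" for k using morrey_leD(2)[OF Fk] .
  have B0: "B \<ge> 0" unfolding B_def by (rule suminf_nonneg[OF b b0])
  note [measurable] = morrey_leD(1)[OF Fk]
  \<comment> \<open>A term with \<open>b k = 0\<close> would be lost in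
    \<open>b k * (norm (Fk k x) / b k)\<close>, since division by 0 gives 0. Almost everywhere such
    a term is 0 itself.\<close>
  have z: "AE x in lborel. \<forall>k. b k = 0 \<longrightarrow> Fk k x = 0"
  proof (subst AE_all_countable, rule allI)
    fix k
    show "AE x in lborel. b k = 0 \<longrightarrow> Fk k x = 0"
    proof (cases "b k = 0")
      case True
      then have "AE x in lborel. Fk k x = 0"
        using morrey_le_zero[of p q "Fk k"] Fk[of k] q by simp
      then show ?thesis by eventually_elim simp
    qed simp
  qed
  show ?thesis
    unfolding B_def[symmetric]
  proof (cases "B = 0")
    case True
    have "b k = 0" for k
      using sum_le_suminf[OF b, of "{k}"] b0 True by (simp add: B_def order_antisym)
    then have "AE x in lborel. F x = 0"
      using z le by (auto elim!: AE_mp)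
    then show "morrey_le p q F B"
      using B0 q by (intro morrey_le_AE_zero) auto
  next
    case False
    then have B: "B > 0" using B0 by simp
    have sumb: "(\<Sum>k. ennreal (b k)) = ennreal B"
      unfolding B_def by (rule suminf_ennreal2[OF b0 b])
    have pt: "AE x in lborel. ennreal (norm (F x) powr q) \<le>
        ennreal (B powr (q - 1)) * (\<Sum>k. ennreal (b k * (norm (Fk k x) / b k) powr q))"
      using z le
    proof eventually_elim
      case (elim x)
      have "ennreal (norm (F x) powr q) \<le> ennreal (B powr (q - 1)) *
          (\<integral>\<^sup>+k. ennreal (b k * (norm (Fk k x) / b k) powr q) \<partial>count_space UNIV)"
      proof (rule jensen_powr[OF _ _ b0 _ q B])
        show "(\<integral>\<^sup>+k. ennreal (b k) \<partial>count_space UNIV) \<le> ennreal B"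
          by (simp add: nn_integral_count_space_nat sumb)
        have "b k * (norm (Fk k x) / b k) = norm (Fk k x)" for k
          using elim(1) by (cases "b k = 0") auto
        then show "ennreal (norm (F x)) \<le> (\<integral>\<^sup>+k. ennreal (b k * (norm (Fk k x) / b k)) \<partial>count_space UNIV)"
          using elim(2) by (simp add: nn_integral_count_space_nat)
      qed (use b0 in auto)
      then show ?case by (simp add: nn_integral_count_space_nat)
    qed
    show "morrey_le p q F B"
    proof (rule morrey_leI[OF assms(4) B0])
      fix x :: "real^'n" and \<rho> :: real assume \<rho>: "\<rho> > 0"
      have [measurable]: "ball x \<rho> \<in> sets borel" by simp
      define W where "W = measure lborel (ball x \<rho>) powr (1 / q - 1 / p)"
      have W: "W \<ge> 0" by (simp add: W_def)
      let ?I = "indicator (ball x \<rho>) :: real^'n \<Rightarrow> ennreal"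
      have "(\<integral>\<^sup>+y. ennreal (norm (F y) powr q) * ?I y \<partial>lborel)
        \<le> (\<integral>\<^sup>+y. ennreal (B powr (q - 1)) * (\<Sum>k. ennreal (b k * (norm (Fk k y) / b k) powr q) * ?I y) \<partial>lborel)"
      proof (rule nn_integral_mono_AE, use pt in eventually_elim)
        case (elim y)
        then show ?case by (simp add: indicator_def)
      qed
      also have "\<dots> = ennreal (B powr (q - 1)) * (\<Sum>k. \<integral>\<^sup>+y. ennreal (b k * (norm (Fk k y) / b k) powr q) * ?I y \<partial>lborel)"
        by (subst nn_integral_cmult, measurable, subst nn_integral_suminf, measurable)
      also have "\<dots> \<le> ennreal (B powr (q - 1)) * (\<Sum>k. ennreal (W powr q) * ennreal (b k))"
      proof (intro mult_left_mono suminf_le)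
        fix k
        show "(\<integral>\<^sup>+y. ennreal (b k * (norm (Fk k y) / b k) powr q) * ?I y \<partial>lborel) \<le> ennreal (W powr q) * ennreal (b k)"
        proof (cases "b k = 0")
          case False
          then have bk: "b k > 0" using b0[of k] by simp
          have "(\<integral>\<^sup>+y. ennreal (b k * (norm (Fk k y) / b k) powr q) * ?I y \<partial>lborel)
             = (\<integral>\<^sup>+y. ennreal (b k / b k powr q) * (ennreal (norm (Fk k y) powr q) * ?I y) \<partial>lborel)"
            using bk by (intro nn_integral_cong) (simp add: powr_divide ennreal_mult'[symmetric] mult.assoc[symmetric])
          also have "\<dots> = ennreal (b k / b k powr q) * (\<integral>\<^sup>+y. ennreal (norm (Fk k y) powr q) * ?I y \<partial>lborel)"
            by (rule nn_integral_cmult) measurable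
          also have "\<dots> \<le> ennreal (b k / b k powr q) * ennreal ((b k * W) powr q)"
            unfolding W_def by (intro mult_left_mono morrey_leD(3)[OF Fk \<rho>]) simp
          also have "\<dots> = ennreal (W powr q) * ennreal (b k)"
            using bk W by (simp add: ennreal_mult'[symmetric] powr_mult)
          finally show ?thesis .
        qed simp
      qed auto
      also have "\<dots> = ennreal (B powr (q - 1)) * (ennreal (W powr q) * ennreal B)"
        by (simp add: ennreal_suminf_cmult sumb)
      also have "\<dots> = ennreal ((B * W) powr q)"
      proof -
        have "B powr (q - 1) * (W powr q * B) = (B * W) powr q"
          using B W by (simp add: powr_mult powr_diff)
        then show ?thesis using B by (simp add: ennreal_mult'[symmetric])
      qed
      finally show "(\<integral>\<^sup>+y. ennreal (norm (F y) powr q) * ?I y \<partial>lborel)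
          \<le> ennreal ((B * measure lborel (ball x \<rho>) powr (1 / q - 1 / p)) powr q)"
        by (simp add: W_def)
    qed
  qed
qed

lemma morrey_le_add:
  fixes F G :: "real^'n::finite \<Rightarrow> complex"
  assumes F: "morrey_le p q F A" and G: "morrey_le p q G B" and q: "q \<ge> 1"
  shows "morrey_le p q (\<lambda>x. F x + G x) (A + B)"
proof -
  note [measurable] = morrey_leD(1)[OF F] morrey_leD(1)[OF G]
  define Fk where "Fk k = (if k = 0 then F else if k = 1 then G else (\<lambda>x. 0))" for k :: nat
  define b where "b k = (if k = 0 then A else if k = 1 then B else 0)" for k :: nat
  have b: "b sums (A + B)"
    using sums_finite[of "{0, 1}" b] by (simp add: b_def)
  have "morrey_le p q (\<lambda>x. F x + G x) (suminf b)"
  proof (rule morrey_le_sum[where Fk = Fk, OF _ sums_summable[OF b] q])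
    show "morrey_le p q (Fk k) (b k)" for k
      using F G q by (auto simp: Fk_def b_def intro: morrey_le_0_function)
    show "AE x in lborel. ennreal (norm (F x + G x)) \<le> (\<Sum>k. ennreal (norm (Fk k x)))"
    proof (rule AE_I2)
      fix x
      have "ennreal (norm (F x + G x)) \<le> ennreal (norm (F x)) + ennreal (norm (G x))"
        by (simp add: ennreal_plus[symmetric] ennreal_leI norm_triangle_ineq del: ennreal_plus)
      also have "\<dots> = (\<Sum>k\<in>{0, 1}. ennreal (norm (Fk k x)))"
        by (simp add: Fk_def)
      also have "\<dots> \<le> (\<Sum>k. ennreal (norm (Fk k x)))"
        by (rule sum_le_suminf) auto
      finally show "ennreal (norm (F x + G x)) \<le> (\<Sum>k. ennreal (norm (Fk k x)))" .
    qed
  qed measurable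
  then show ?thesis using b by (simp add: sums_iff)
qed

lemma morrey_le_finite_sum:
  fixes Fk :: "nat \<Rightarrow> real^'n::finite \<Rightarrow> complex"
  assumes Fk: "\<And>k. morrey_le p q (Fk k) (b k)" and q: "q \<ge> 1"
  shows "morrey_le p q (\<lambda>x. \<Sum>k\<le>m. Fk k x) (\<Sum>k\<le>m. b k)"
  by (induction m) (auto simp: Fk intro!: morrey_le_add[OF _ _ q])

lemma lborel_nn_integral_translation:
  fixes f :: "'a::euclidean_space \<Rightarrow> ennreal"
  assumes "f \<in> borel_measurable borel"
  shows "(\<integral>\<^sup>+x. f (t + x) \<partial>lborel) = (\<integral>\<^sup>+x. f x \<partial>lborel)"
  using lborel_nn_integral_affine[OF assms, of 1 t] by simp

text \<open>Young's inequality in Morrey spaces. Jensen's inequality with weight |\<kappa>| is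
  applied at each point; after exchanging the integrals, the inner one is an integral of
  \<open>F\<close> over a translated ball of the same volume, and the Morrey bound is uniform in the
  centre.\<close>

lemma morrey_le_conv:
  fixes F \<kappa> :: "real^'n::finite \<Rightarrow> complex"
  assumes F: "morrey_le p q F A" and q: "1 \<le> q"
    and \<kappa> [measurable]: "\<kappa> \<in> borel_measurable borel" and m: "conv \<kappa> F \<in> borel_measurable borel"
    and W: "W > 0" "(\<integral>\<^sup>+u. ennreal (norm (\<kappa> u)) \<partial>lborel) \<le> ennreal W"
  shows "morrey_le p q (conv \<kappa> F) (W * A)"
proof (rule morrey_leI[OF m])
  note [measurable] = morrey_leD(1)[OF F]
  have A: "A \<ge> 0" by (rule morrey_leD(2)[OF F])
  then show "0 \<le> W * A" using W by simp
  have pt: "ennreal (norm (conv \<kappa> F y) powr q) \<le> ennreal (W powr (q - 1)) *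
      (\<integral>\<^sup>+u. ennreal (norm (\<kappa> u) * norm (F (y + u)) powr q) \<partial>lborel)" for y
  proof (rule jensen_powr[OF _ _ _ _ q W])
    have "ennreal (norm (conv \<kappa> F y)) \<le> (\<integral>\<^sup>+z. ennreal (norm (F z * \<kappa> (z - y))) \<partial>lborel)"
    proof (cases "integrable lborel (\<lambda>z. F z * \<kappa> (z - y))")
      case True
      then show ?thesis unfolding conv_def by (rule integral_norm_bound_ennreal)
    next
      \<comment> \<open>A Bochner integral that does not exist has the value 0, so the bound holds
        trivially.\<close>
      case False
      then show ?thesis by (simp add: conv_def not_integrable_integral_eq)
    qed
    also have "\<dots> = (\<integral>\<^sup>+u. ennreal (norm (F (y + u) * \<kappa> (y + u - y))) \<partial>lborel)"
      by (rule lborel_nn_integral_translation[symmetric]) measurable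
    also have "\<dots> = (\<integral>\<^sup>+u. ennreal (norm (\<kappa> u) * norm (F (y + u))) \<partial>lborel)"
      by (simp add: norm_mult mult.commute)
    finally show "ennreal (norm (conv \<kappa> F y)) \<le> (\<integral>\<^sup>+u. ennreal (norm (\<kappa> u) * norm (F (y + u))) \<partial>lborel)" .
  qed auto
  fix x :: "real^'n" and \<rho> :: real assume \<rho>: "\<rho> > 0"
  let ?I = "\<lambda>x. indicator (ball x \<rho>) :: real^'n \<Rightarrow> ennreal"
  have [measurable]: "ball x \<rho> \<in> sets borel" for x :: "real^'n" by simp
  define V where "V = measure lborel (ball x \<rho>) powr (1 / q - 1 / p)"
  have V: "V \<ge> 0" by (simp add: V_def)
  define Z where "Z = (\<integral>\<^sup>+y. (\<integral>\<^sup>+u. ennreal (norm (\<kappa> u)) * (ennreal (norm (F (y + u)) powr q) * ?I x y) \<partial>lborel) \<partial>lborel)"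
  have "(\<integral>\<^sup>+y. ennreal (norm (conv \<kappa> F y) powr q) * ?I x y \<partial>lborel)
    \<le> (\<integral>\<^sup>+y. ennreal (W powr (q - 1)) * (\<integral>\<^sup>+u. ennreal (norm (\<kappa> u)) * (ennreal (norm (F (y + u)) powr q) * ?I x y) \<partial>lborel) \<partial>lborel)"
  proof (rule nn_integral_mono)
    fix y
    show "ennreal (norm (conv \<kappa> F y) powr q) * ?I x y
      \<le> ennreal (W powr (q - 1)) * (\<integral>\<^sup>+u. ennreal (norm (\<kappa> u)) * (ennreal (norm (F (y + u)) powr q) * ?I x y) \<partial>lborel)"
      using pt[of y] by (cases "y \<in> ball x \<rho>") (auto simp: ennreal_mult')
  qed
  also have "\<dots> = ennreal (W powr (q - 1)) * Z"
    unfolding Z_def by (rule nn_integral_cmult) measurable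
  finally have 1: "(\<integral>\<^sup>+y. ennreal (norm (conv \<kappa> F y) powr q) * ?I x y \<partial>lborel) \<le> ennreal (W powr (q - 1)) * Z" .
  have "Z = (\<integral>\<^sup>+u. (\<integral>\<^sup>+y. ennreal (norm (\<kappa> u)) * (ennreal (norm (F (y + u)) powr q) * ?I x y) \<partial>lborel) \<partial>lborel)"
    unfolding Z_def by (rule lborel_pair.Fubini'[symmetric]) measurable
  also have "\<dots> = (\<integral>\<^sup>+u. ennreal (norm (\<kappa> u)) * (\<integral>\<^sup>+y. ennreal (norm (F (y + u)) powr q) * ?I x y \<partial>lborel) \<partial>lborel)"
    by (intro nn_integral_cong nn_integral_cmult) measurable
  also have "\<dots> \<le> (\<integral>\<^sup>+u. ennreal (norm (\<kappa> u)) * ennreal ((A * V) powr q) \<partial>lborel)"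
  proof (intro nn_integral_mono mult_left_mono)
    fix u
    have "(\<integral>\<^sup>+y. ennreal (norm (F (y + u)) powr q) * ?I x y \<partial>lborel)
        = (\<integral>\<^sup>+y. ennreal (norm (F (u + y)) powr q) * ?I (x + u) (u + y) \<partial>lborel)"
      by (intro nn_integral_cong) (simp add: add.commute indicator_def dist_norm)
    also have "\<dots> = (\<integral>\<^sup>+y. ennreal (norm (F y) powr q) * ?I (x + u) y \<partial>lborel)"
      by (rule lborel_nn_integral_translation) measurable
    also have "\<dots> \<le> ennreal ((A * V) powr q)"
      using morrey_leD(3)[OF F \<rho>, of "x + u"] \<rho> by (simp add: V_def content_ball)
    finally show "(\<integral>\<^sup>+y. ennreal (norm (F (y + u)) powr q) * ?I x y \<partial>lborel) \<le> ennreal ((A * V) powr q)" .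
  qed simp
  also have "\<dots> = (\<integral>\<^sup>+u. ennreal (norm (\<kappa> u)) \<partial>lborel) * ennreal ((A * V) powr q)"
    by (rule nn_integral_multc) measurable
  also have "\<dots> \<le> ennreal W * ennreal ((A * V) powr q)"
    by (intro mult_right_mono W(2)) auto
  finally have "ennreal (W powr (q - 1)) * Z \<le> ennreal (W powr (q - 1)) * (ennreal W * ennreal ((A * V) powr q))"
    by (rule mult_left_mono) simp
  also have "\<dots> = ennreal ((W * A * V) powr q)"
  proof -
    have "W powr (q - 1) * (W * (A * V) powr q) = (W * A * V) powr q"
      using W A V by (simp add: powr_mult powr_diff)
    then show ?thesis using W by (simp add: ennreal_mult'[symmetric])
  qed
  finally show "(\<integral>\<^sup>+y. ennreal (norm (conv \<kappa> F y) powr q) * ?I x y \<partial>lborel)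
      \<le> ennreal ((W * A * measure lborel (ball x \<rho>) powr (1 / q - 1 / p)) powr q)"
    unfolding V_def by (rule order_trans[OF 1])
qed

section \<open>Kernels of the dyadic multipliers\<close>

lemma low_pass_schwartz: "cutoff \<psi> \<Longrightarrow> low_pass \<psi> m \<in> schwartz"
  using low_pass_test_function test_functions_schwartz by blast

lemma dyadic_schwartz: "cutoff \<psi> \<Longrightarrow> (\<lambda>\<xi>. complex_of_real (dyadic \<psi> j \<xi>)) \<in> schwartz"
  using dyadic_test_function test_functions_schwartz by blast

text \<open>Dilating the multiplier by 2^-m dilates the kernel by 2^m and multiplies it by 2^(mn),
  which preserves the L^1 norm. This is why one constant bounds the dyadic multipliers for all
  j.\<close>

lemma nn_integral_kernel_low_pass:
  fixes \<psi> :: "real^'n::finite \<Rightarrow> real"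
  assumes \<psi>: "cutoff \<psi>"
  shows "(\<integral>\<^sup>+x. ennreal (norm (multiplier_kernel (low_pass \<psi> m) x)) \<partial>lborel) = (\<integral>\<^sup>+x. ennreal (norm (multiplier_kernel (low_pass \<psi> 0) x)) \<partial>lborel)"
proof -
  let ?a = "1 / 2 ^ m :: real"
  note [measurable] = schwartz_measurable[OF low_pass_schwartz[OF \<psi>]] schwartz_measurable[OF kernel_schwartz[OF low_pass_schwartz[OF \<psi>]]]
  have lp: "low_pass \<psi> m = (\<lambda>x. low_pass \<psi> 0 (?a *\<^sub>R x))"
    by (simp add: low_pass_def[abs_def])
  have a: "?a \<noteq> 0" "1 / ?a = 2 ^ m" "1 / complex_of_real (\<bar>?a\<bar> ^ CARD('n)) = complex_of_real ((2 ^ m) ^ CARD('n))"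
    by (simp_all add: power_one_over)
  have k: "multiplier_kernel (low_pass \<psi> m) x = complex_of_real ((2 ^ m) ^ CARD('n)) * multiplier_kernel (low_pass \<psi> 0) (0 + 2 ^ m *\<^sub>R x)" for x
  proof -
    have "multiplier_kernel (low_pass \<psi> m) x = complex_of_real (fourier_const TYPE('n)) *
        (fourier (low_pass \<psi> 0) ((1 / ?a) *\<^sub>R x) * (1 / complex_of_real (\<bar>?a\<bar> ^ CARD('n))))"
      unfolding multiplier_kernel_def lp
      by (subst fourier_dilation[OF schwartz_measurable[OF low_pass_schwartz[OF \<psi>, of 0]] a(1)]) simp
    then show ?thesis
      unfolding a multiplier_kernel_def by (simp only: mult_ac add_0)
  qed
  have "(\<integral>\<^sup>+x. ennreal (norm (multiplier_kernel (low_pass \<psi> m) x)) \<partial>lborel)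
      = (\<integral>\<^sup>+x. ennreal (\<bar>2 ^ m\<bar> ^ DIM(real^'n)) * ennreal (norm (multiplier_kernel (low_pass \<psi> 0) (0 + 2 ^ m *\<^sub>R x))) \<partial>lborel)"
    unfolding k by (simp add: norm_mult ennreal_mult' norm_power)
  also have "\<dots> = ennreal (\<bar>2 ^ m\<bar> ^ DIM(real^'n)) * (\<integral>\<^sup>+x. ennreal (norm (multiplier_kernel (low_pass \<psi> 0) (0 + 2 ^ m *\<^sub>R x))) \<partial>lborel)"
    by (rule nn_integral_cmult) measurable
  also have "\<dots> = (\<integral>\<^sup>+x. ennreal (norm (multiplier_kernel (low_pass \<psi> 0) x)) \<partial>lborel)"
    using lborel_nn_integral_affine[of "\<lambda>x. ennreal (norm (multiplier_kernel (low_pass \<psi> 0) x))" "2 ^ m" 0] by simp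
  finally show ?thesis .
qed

lemma kernel_dyadic_bound:
  fixes \<psi> :: "real^'n::finite \<Rightarrow> real"
  assumes \<psi>: "cutoff \<psi>"
  obtains L where "L > 0"
    "\<And>j. (\<integral>\<^sup>+x. ennreal (norm (multiplier_kernel (\<lambda>\<xi>. complex_of_real (dyadic \<psi> j \<xi>)) x)) \<partial>lborel) \<le> ennreal L"
proof -
  note S = low_pass_schwartz[OF \<psi>]
  note [measurable] = schwartz_measurable[OF kernel_schwartz[OF S]]
  obtain L where L: "L \<ge> 0" "(\<integral>\<^sup>+x. ennreal (norm (multiplier_kernel (low_pass \<psi> 0) x)) \<partial>lborel) = ennreal L"
    using nn_integral_norm_finite[OF schwartz_integrable[OF kernel_schwartz[OF S[of 0]]]]
    by (cases "\<integral>\<^sup>+x. ennreal (norm (multiplier_kernel (low_pass \<psi> 0) x)) \<partial>lborel") auto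
  have l: "(\<integral>\<^sup>+x. ennreal (norm (multiplier_kernel (low_pass \<psi> m) x)) \<partial>lborel) = ennreal L" for m
    by (rule trans[OF nn_integral_kernel_low_pass[OF \<psi>] L(2)])
  \<comment> \<open>A dyadic kernel with positive index is a difference of two low-pass kernels of
    norm \<open>L\<close>; the added 1 makes the constant positive without a discussion of
    \<open>L\<close>.\<close>
  have "(\<integral>\<^sup>+x. ennreal (norm (multiplier_kernel (\<lambda>\<xi>. complex_of_real (dyadic \<psi> j \<xi>)) x)) \<partial>lborel) \<le> ennreal (2 * L + 1)" for j
  proof (cases j)
    case 0
    have "(\<integral>\<^sup>+x. ennreal (norm (multiplier_kernel (low_pass \<psi> 0) x)) \<partial>lborel) \<le> ennreal (2 * L + 1)"
      unfolding l using L(1) by (intro ennreal_leI) simp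
    then show ?thesis by (simp add: 0 low_pass_0)
  next
    case (Suc i)
    have k: "multiplier_kernel (\<lambda>\<xi>. complex_of_real (dyadic \<psi> j \<xi>)) x = multiplier_kernel (low_pass \<psi> (Suc i)) x - multiplier_kernel (low_pass \<psi> i) x" for x
      unfolding Suc dyadic_Suc multiplier_kernel_def fourier_diff[OF schwartz_integrable[OF S] schwartz_integrable[OF S]]
      by (rule right_diff_distrib)
    have "(\<integral>\<^sup>+x. ennreal (norm (multiplier_kernel (\<lambda>\<xi>. complex_of_real (dyadic \<psi> j \<xi>)) x)) \<partial>lborel)
      \<le> (\<integral>\<^sup>+x. ennreal (norm (multiplier_kernel (low_pass \<psi> (Suc i)) x)) + ennreal (norm (multiplier_kernel (low_pass \<psi> i) x)) \<partial>lborel)"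
      unfolding k by (intro nn_integral_mono)
        (simp add: ennreal_plus[symmetric] ennreal_leI norm_triangle_ineq4 del: ennreal_plus)
    also have "\<dots> = ennreal L + ennreal L"
      by (subst nn_integral_add) (simp_all add: l)
    also have "\<dots> \<le> ennreal (2 * L + 1)"
      using L(1) by (simp add: ennreal_plus[symmetric] ennreal_leI del: ennreal_plus)
    finally show ?thesis .
  qed
  then show ?thesis using that[of "2 * L + 1"] L(1) by simp
qed

section \<open>Sequence norms\<close>

text \<open>The sequence norm inside \<open>besov_morrey_norm\<close>, isolated so that it can be
  estimated for arbitrary sequences.\<close>

definition lr_norm :: "ennreal \<Rightarrow> (nat \<Rightarrow> ennreal) \<Rightarrow> ennreal" where
  "lr_norm r a = (if r = \<infinity> then (SUP j. a j)
     else ennreal_powr (\<Sum>j. ennreal_powr (a j) (enn2real r)) (1 / enn2real r))"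

definition lr_le :: "ennreal \<Rightarrow> (nat \<Rightarrow> real) \<Rightarrow> real \<Rightarrow> bool" where
  "lr_le r a N \<longleftrightarrow> (\<forall>j. 0 \<le> a j) \<and> 0 \<le> N \<and> lr_norm r (\<lambda>j. ennreal (a j)) \<le> ennreal N"

lemma besov_morrey_norm_eq_lr_norm:
  "besov_morrey_norm \<psi> s p q r u = lr_norm r (\<lambda>j. ennreal (2 powr (real j * s)) *
     morrey_norm_dist p q (fourier_multiplier (\<lambda>\<xi>. complex_of_real (dyadic \<psi> j \<xi>)) u))"
  by (simp add: besov_morrey_norm_def lr_norm_def Let_def)

lemma ennreal_powr_mono: "x \<le> y \<Longrightarrow> a \<ge> 0 \<Longrightarrow> ennreal_powr x a \<le> ennreal_powr y a"
  unfolding ennreal_powr_def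
  by (auto simp: top_unique less_top intro!: ennreal_leI powr_mono2 enn2real_mono)

lemma enn2real_ge_1:
  assumes "1 \<le> r" "r \<noteq> \<infinity>"
  shows "1 \<le> enn2real r"
  using enn2real_mono[OF assms(1)] assms(2) by (simp add: less_top)

lemma lr_norm_mono: "(\<And>j. a j \<le> b j) \<Longrightarrow> lr_norm r a \<le> lr_norm r b"
  unfolding lr_norm_def by (auto intro!: SUP_mono' ennreal_powr_mono suminf_le)

lemma lr_le_infinity_iff: "lr_le \<top> a N \<longleftrightarrow> (\<forall>j. 0 \<le> a j) \<and> 0 \<le> N \<and> (\<forall>j. a j \<le> N)"
  by (auto simp: lr_le_def lr_norm_def SUP_le_iff ennreal_le_iff)

lemma lr_le_finite_iff:
  assumes "1 \<le> r" "r \<noteq> \<infinity>"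
  shows "lr_le r a N \<longleftrightarrow> (\<forall>j. 0 \<le> a j) \<and> 0 \<le> N \<and> (\<Sum>j. ennreal (a j powr enn2real r)) \<le> ennreal (N powr enn2real r)"
proof -
  have r: "enn2real r > 0" using enn2real_ge_1[OF assms] by simp
  have "lr_norm r (\<lambda>j. ennreal (a j)) \<le> ennreal N \<longleftrightarrow> (\<Sum>j. ennreal (a j powr enn2real r)) \<le> ennreal (N powr enn2real r)"
    if "\<forall>j. 0 \<le> a j" "0 \<le> N"
  proof -
    have "ennreal_powr (ennreal (a j)) (enn2real r) = ennreal (a j powr enn2real r)" for j
      using that by (simp add: ennreal_powr_def)
    then show ?thesis
      using ennreal_powr_le_iff[of 1 N "enn2real r" 0] that(2) r assms(2) by (simp add: lr_norm_def)
  qed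
  then show ?thesis unfolding lr_le_def by blast
qed

lemma term_le_suminf_ennreal:
  fixes f :: "nat \<Rightarrow> ennreal"
  shows "f j \<le> (\<Sum>j. f j)"
  using sum_le_suminf[of f "{j}"] by simp

lemma lr_le_term:
  assumes "lr_le r a N" "1 \<le> r"
  shows "a j \<le> N"
proof (cases "r = \<infinity>")
  case True
  then show ?thesis using assms by (simp add: lr_le_infinity_iff)
next
  case False
  have a: "0 \<le> a j" "0 \<le> N" "(\<Sum>j. ennreal (a j powr enn2real r)) \<le> ennreal (N powr enn2real r)"
    using iffD1[OF lr_le_finite_iff[OF assms(2) False] assms(1)] by blast+
  have "ennreal (a j powr enn2real r) \<le> (\<Sum>j. ennreal (a j powr enn2real r))"
    by (rule term_le_suminf_ennreal)
  then have "ennreal (a j powr enn2real r) \<le> ennreal (N powr enn2real r)"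
    using a(3) by (rule order_trans)
  then have "a j powr enn2real r \<le> N powr enn2real r"
    by (simp add: ennreal_le_iff)
  then show ?thesis
    using powr_less_mono2[of "enn2real r" N "a j"] enn2real_ge_1[OF assms(2) False] a(2) by force
qed

lemma lr_le_mono:
  assumes "lr_le r a N" "\<And>j. 0 \<le> b j" "\<And>j. b j \<le> a j" "N \<le> M"
  shows "lr_le r b M"
proof -
  have "lr_norm r (\<lambda>j. ennreal (b j)) \<le> lr_norm r (\<lambda>j. ennreal (a j))"
    by (intro lr_norm_mono ennreal_leI assms(3))
  also have "\<dots> \<le> ennreal M"
    using assms(1,4) unfolding lr_le_def by (meson ennreal_leI order_trans)
  finally show ?thesis
    using assms unfolding lr_le_def by auto
qed

lemma lr_le_cmult:
  assumes "lr_le r a N" "1 \<le> r" "c \<ge> 0"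
  shows "lr_le r (\<lambda>j. c * a j) (c * N)"
proof (cases "r = \<infinity>")
  case True
  then show ?thesis using assms by (simp add: lr_le_infinity_iff mult_left_mono)
next
  case False
  note iff = lr_le_finite_iff[OF assms(2) False]
  have a: "\<And>j. 0 \<le> a j" "0 \<le> N" "(\<Sum>j. ennreal (a j powr enn2real r)) \<le> ennreal (N powr enn2real r)"
    using iffD1[OF iff assms(1)] by blast+
  have "(\<Sum>j. ennreal ((c * a j) powr enn2real r)) = (\<Sum>j. ennreal (c powr enn2real r) * ennreal (a j powr enn2real r))"
    using a assms(3) by (simp add: powr_mult ennreal_mult')
  also have "\<dots> = ennreal (c powr enn2real r) * (\<Sum>j. ennreal (a j powr enn2real r))"
    by (rule ennreal_suminf_cmult)
  also have "\<dots> \<le> ennreal (c powr enn2real r) * ennreal (N powr enn2real r)"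
    by (intro mult_left_mono a) simp
  also have "\<dots> = ennreal ((c * N) powr enn2real r)"
    using a assms(3) by (simp add: powr_mult ennreal_mult')
  finally show ?thesis
    using a assms(3) by (simp add: iff)
qed

lemma powr_add_le:
  fixes x y e :: real
  assumes "x \<ge> 0" "y \<ge> 0" "e \<ge> 0"
  shows "(x + y) powr e \<le> 2 powr e * (x powr e + y powr e)"
proof -
  have "(x + y) powr e \<le> (2 * max x y) powr e"
    using assms by (intro powr_mono2) auto
  also have "\<dots> = 2 powr e * (max x y) powr e"
    using assms by (simp add: powr_mult)
  also have "\<dots> \<le> 2 powr e * (x powr e + y powr e)"
    by (intro mult_left_mono) (auto simp: max_def)
  finally show ?thesis .
qed

text \<open>A crude triangle inequality. One factor 2 comes from \<open>powr_add_le\<close>, the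
  other from adding two e-th powers, where \<open>2 \<le> 2 powr e\<close>; the constant 4 also
  covers the supremum norm.\<close>

lemma lr_le_add:
  assumes a: "lr_le r a N" and b: "lr_le r b M" and r: "1 \<le> r"
  shows "lr_le r (\<lambda>j. a j + b j) (4 * (N + M))"
proof (cases "r = \<infinity>")
  case True
  then have "0 \<le> a j" "0 \<le> b j" "0 \<le> N" "0 \<le> M" "a j \<le> N" "b j \<le> M" for j
    using a b by (auto simp: lr_le_infinity_iff)
  then show ?thesis
    unfolding True infinity_ennreal_def lr_le_infinity_iff by (smt (verit))
next
  case False
  define e where "e = enn2real r"
  have e: "e \<ge> 1" unfolding e_def by (rule enn2real_ge_1[OF r False])
  note iff = lr_le_finite_iff[OF r False, folded e_def]
  have a': "\<And>j. 0 \<le> a j" "0 \<le> N" "(\<Sum>j. ennreal (a j powr e)) \<le> ennreal (N powr e)"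
    and b': "\<And>j. 0 \<le> b j" "0 \<le> M" "(\<Sum>j. ennreal (b j powr e)) \<le> ennreal (M powr e)"
    using iffD1[OF iff a] iffD1[OF iff b] by blast+
  have "(\<Sum>j. ennreal ((a j + b j) powr e)) \<le> (\<Sum>j. ennreal (2 powr e) * (ennreal (a j powr e) + ennreal (b j powr e)))"
  proof (intro suminf_le allI)
    fix j
    have "ennreal ((a j + b j) powr e) \<le> ennreal (2 powr e * (a j powr e + b j powr e))"
      using powr_add_le[of "a j" "b j" e] a' b' e by (intro ennreal_leI) auto
    then show "ennreal ((a j + b j) powr e) \<le> ennreal (2 powr e) * (ennreal (a j powr e) + ennreal (b j powr e))"
      by (simp add: ennreal_mult' ennreal_plus)
  qed auto
  also have "\<dots> = ennreal (2 powr e) * ((\<Sum>j. ennreal (a j powr e)) + (\<Sum>j. ennreal (b j powr e)))"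
    by (simp add: ennreal_suminf_cmult suminf_add)
  also have "\<dots> \<le> ennreal (2 powr e) * (ennreal (N powr e) + ennreal (M powr e))"
    by (intro mult_left_mono add_mono a' b') auto
  also have "\<dots> = ennreal (2 powr e * (N powr e + M powr e))"
    by (simp add: ennreal_mult' ennreal_plus)
  also have "\<dots> \<le> ennreal ((4 * (N + M)) powr e)"
  proof (rule ennreal_leI)
    have "N powr e \<le> (N + M) powr e" "M powr e \<le> (N + M) powr e"
      using a' b' e by (auto intro!: powr_mono2)
    then have "2 powr e * (N powr e + M powr e) \<le> 2 powr e * (2 * (N + M) powr e)"
      by (intro mult_left_mono) auto
    also have "2 * (N + M) powr e \<le> 2 powr e * (N + M) powr e"
      using powr_mono[of 1 e 2] e by (intro mult_right_mono) auto
    also have "2 powr e * (2 powr e * (N + M) powr e) = (4 * (N + M)) powr e"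
    proof -
      have "4 * (N + M) = 2 * (2 * (N + M))" by simp
      then show ?thesis using a' b' by (simp only: powr_mult) 
    qed
    finally show "2 powr e * (N powr e + M powr e) \<le> (4 * (N + M)) powr e" by simp
  qed
  finally show ?thesis
    unfolding iff using a' b' by simp
qed

text \<open>The truncated difference \<open>j - 2\<close> is 0 for j = 0, 1, 2, so
  \<open>g i\<close> occurs three times and every later term once.\<close>

lemma suminf_shift_le:
  fixes g :: "nat \<Rightarrow> ennreal"
  shows "(\<Sum>j. g (i + (j - 2))) \<le> 3 * (\<Sum>k. g k)"
proof -
  have off: "(\<Sum>k. g (i + k)) \<le> (\<Sum>k. g k)"
    using suminf_offset[of g i] by (simp add: add.commute)
  have one: "g i \<le> (\<Sum>k. g k)"
    by (rule term_le_suminf_ennreal)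
  have "(\<Sum>j. g (i + (j - 2))) = (\<Sum>j. g (i + j)) + (\<Sum>j<2. g (i + (j - 2)))"
    using suminf_offset[of "\<lambda>j. g (i + (j - 2))" 2] by simp
  also have "(\<Sum>j<2. g (i + (j - 2))) = g i + g i"
    by (simp add: numeral_2_eq_2 mult_2)
  also have "(\<Sum>j. g (i + j)) + (g i + g i) \<le> (\<Sum>k. g k) + ((\<Sum>k. g k) + (\<Sum>k. g k))"
    by (intro add_mono off one)
  also have "\<dots> = 3 * (\<Sum>k. g k)"
  proof -
    have "(3::ennreal) = 1 + (1 + 1)" by simp
    then show ?thesis by (simp only: distrib_right mult_1)
  qed
  finally show ?thesis .
qed

lemma suminf_swap_ennreal:
  fixes h :: "nat \<Rightarrow> nat \<Rightarrow> ennreal"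
  shows "(\<Sum>j. \<Sum>i. h i j) = (\<Sum>i. \<Sum>j. h i j)"
proof -
  have "(\<integral>\<^sup>+j. (\<Sum>i. h i j) \<partial>count_space UNIV) = (\<Sum>i. \<integral>\<^sup>+j. h i j \<partial>count_space UNIV)"
    by (rule nn_integral_suminf) simp
  then show ?thesis by (simp only: nn_integral_count_space_nat)
qed

text \<open>Young's inequality for the action of summable weights on \<ell>^r, in the one-sided form
  in which tails appear: Jensen's inequality in \<open>i\<close> with weights \<open>w i\<close>,
  then an exchange of the sums. The factor 3 is the price of the truncation in
  \<open>j - 2\<close>.\<close>

lemma lr_le_shift_convolution:
  assumes a: "lr_le r a N" and r: "1 \<le> r" and w: "\<And>i. w i \<ge> 0" "w sums W" and W: "W > 0"
  shows "lr_le r (\<lambda>j. \<Sum>i. w i * a (i + (j - 2))) (3 * W * N)"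
proof -
  have a0: "\<And>j. 0 \<le> a j" and N: "0 \<le> N" using a by (auto simp: lr_le_def)
  have aN: "a j \<le> N" for j by (rule lr_le_term[OF a r])
  have sW: "summable (\<lambda>i. w i * N)" "(\<Sum>i. w i * N) = W * N"
    using sums_mult2[OF w(2), of N] by (auto simp: sums_iff)
  have sm: "summable (\<lambda>i. w i * a (i + (j - 2)))" for j
    by (rule summable_comparison_test'[OF sW(1), of 0])
      (use w(1) a0 aN in \<open>simp add: abs_mult mult_left_mono\<close>)
  define t where "t j = (\<Sum>i. w i * a (i + (j - 2)))" for j
  have t0: "t j \<ge> 0" for j
    unfolding t_def by (intro suminf_nonneg sm mult_nonneg_nonneg w(1) a0)
  have tN: "t j \<le> W * N" for j
    unfolding t_def sW(2)[symmetric] by (intro suminf_le sm sW(1) mult_left_mono aN w(1))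
  show ?thesis
    unfolding t_def[symmetric]
  proof (cases "r = \<infinity>")
    case True
    have "W * N \<le> 3 * W * N" using W N by simp
    then show "lr_le r t (3 * W * N)"
      unfolding \<open>r = \<infinity>\<close> infinity_ennreal_def lr_le_infinity_iff using t0 order_trans[OF tN] W N by simp
  next
    case False
    define e where "e = enn2real r"
    have e: "e \<ge> 1" unfolding e_def by (rule enn2real_ge_1[OF r False])
    note iff = lr_le_finite_iff[OF r False, folded e_def]
    have aS: "(\<Sum>j. ennreal (a j powr e)) \<le> ennreal (N powr e)"
      using iffD1[OF iff a] by blast
    have sw: "(\<Sum>i. ennreal (w i)) = ennreal W"
      using suminf_ennreal2[OF w(1) sums_summable[OF w(2)]] sums_unique[OF w(2)] by simp
    have "ennreal (t j powr e) \<le> ennreal (W powr (e - 1)) * (\<Sum>i. ennreal (w i) * ennreal (a (i + (j - 2)) powr e))" for j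
    proof -
      have "ennreal (t j powr e) \<le> ennreal (W powr (e - 1)) * (\<integral>\<^sup>+i. ennreal (w i * a (i + (j - 2)) powr e) \<partial>count_space UNIV)"
      proof (rule jensen_powr[OF _ _ w(1) a0 e W _ t0])
        show "(\<integral>\<^sup>+i. ennreal (w i) \<partial>count_space UNIV) \<le> ennreal W"
          by (simp add: nn_integral_count_space_nat sw)
        have "ennreal (t j) = (\<Sum>i. ennreal (w i * a (i + (j - 2))))"
          unfolding t_def by (rule suminf_ennreal2[symmetric]) (use sm w(1) a0 in auto)
        then show "ennreal (t j) \<le> (\<integral>\<^sup>+i. ennreal (w i * a (i + (j - 2))) \<partial>count_space UNIV)"
          by (simp add: nn_integral_count_space_nat)
      qed auto
      then show ?thesis
        using w(1) by (simp add: nn_integral_count_space_nat ennreal_mult')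
    qed
    then have 1: "(\<Sum>j. ennreal (t j powr e)) \<le> (\<Sum>j. ennreal (W powr (e - 1)) * (\<Sum>i. ennreal (w i) * ennreal (a (i + (j - 2)) powr e)))"
      by (intro suminf_le) auto
    define S where "S = (\<Sum>j. \<Sum>i. ennreal (w i) * ennreal (a (i + (j - 2)) powr e))"
    have 2: "(\<Sum>j. ennreal (W powr (e - 1)) * (\<Sum>i. ennreal (w i) * ennreal (a (i + (j - 2)) powr e))) = ennreal (W powr (e - 1)) * S"
      unfolding S_def by (rule ennreal_suminf_cmult)
    have "S = (\<Sum>i. \<Sum>j. ennreal (w i) * ennreal (a (i + (j - 2)) powr e))"
      unfolding S_def by (rule suminf_swap_ennreal)
    also have "\<dots> \<le> (\<Sum>i. ennreal (w i) * ennreal (3 * N powr e))"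
    proof (intro suminf_le allI)
      fix i
      have "(\<Sum>j. ennreal (w i) * ennreal (a (i + (j - 2)) powr e)) = ennreal (w i) * (\<Sum>j. ennreal (a (i + (j - 2)) powr e))"
        by (rule ennreal_suminf_cmult)
      also have "\<dots> \<le> ennreal (w i) * (3 * (\<Sum>j. ennreal (a j powr e)))"
        by (rule mult_left_mono[OF suminf_shift_le]) simp
      also have "\<dots> \<le> ennreal (w i) * (3 * ennreal (N powr e))"
        by (rule mult_left_mono[OF mult_left_mono[OF aS]]) simp_all
      also have "3 * ennreal (N powr e) = ennreal (3 * N powr e)"
        by (subst ennreal_mult') simp_all
      finally show "(\<Sum>j. ennreal (w i) * ennreal (a (i + (j - 2)) powr e)) \<le> ennreal (w i) * ennreal (3 * N powr e)" .
    qed auto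
    also have "\<dots> = ennreal W * ennreal (3 * N powr e)"
      unfolding ennreal_suminf_multc sw by (rule refl)
    also have "\<dots> = ennreal (W * (3 * N powr e))"
      by (rule ennreal_mult'[symmetric]) (use W in simp)
    finally have "ennreal (W powr (e - 1)) * S \<le> ennreal (W powr (e - 1)) * ennreal (W * (3 * N powr e))"
      by (rule mult_left_mono) simp
    also have "\<dots> = ennreal (W powr (e - 1) * (W * (3 * N powr e)))"
      by (rule ennreal_mult'[symmetric]) simp
    also have "\<dots> \<le> ennreal ((3 * W * N) powr e)"
    proof (rule ennreal_leI)
      have "W powr (e - 1) * W powr 1 = W powr e"
        unfolding powr_add[symmetric] by simp
      then have "W powr (e - 1) * W = W powr e"
        using W by simp
      then have "3 * (W powr e * N powr e) = 3 * ((W powr (e - 1) * W) * N powr e)" by simp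
      also have "\<dots> = W powr (e - 1) * (W * (3 * N powr e))" by (simp only: mult_ac)
      finally have "W powr (e - 1) * (W * (3 * N powr e)) = 3 * (W powr e * N powr e)" ..
      also have "\<dots> \<le> 3 powr e * (W powr e * N powr e)"
      proof (rule mult_right_mono)
        show "3 \<le> 3 powr e" using powr_mono[of 1 e 3] e by simp
      qed simp
      also have "\<dots> = (3 * W * N) powr e"
        using W N by (simp add: powr_mult mult.assoc)
      finally show "W powr (e - 1) * (W * (3 * N powr e)) \<le> (3 * W * N) powr e" .
    qed
    finally have "(\<Sum>j. ennreal (t j powr e)) \<le> ennreal ((3 * W * N) powr e)"
      by (rule order_trans[OF ord_le_eq_trans[OF 1 2]])
    then show "lr_le r t (3 * W * N)"
      unfolding iff using t0 W N by simp
  qed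
qed

section \<open>Littlewood--Paley decomposition in Besov--Morrey spaces\<close>

lemma summable_geometric_powr:
  fixes s :: real
  assumes "s > 0"
  shows "summable (\<lambda>k::nat. 2 powr (- (real k * s)))"
    and "(\<lambda>k::nat. 2 powr (- (real k * s))) sums (1 / (1 - 2 powr (- s)))"
    and "1 / (1 - 2 powr (- s)) > 0"
proof -
  have c: "2 powr (- s) < (1::real)"
    using powr_less_mono[of "- s" 0 2] assms by simp
  have eq: "2 powr (- (real k * s)) = (2 powr (- s)) ^ k" for k
    by (simp add: powr_power mult.commute)
  show S: "(\<lambda>k::nat. 2 powr (- (real k * s))) sums (1 / (1 - 2 powr (- s)))"
    unfolding eq by (rule geometric_sums) (use c in simp)
  show "summable (\<lambda>k::nat. 2 powr (- (real k * s)))"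
    using S by (rule sums_summable)
  show "1 / (1 - 2 powr (- s)) > 0" using c by simp
qed

lemma norm_suminf_le_ennreal:
  fixes f :: "nat \<Rightarrow> 'a::banach"
  assumes "summable (\<lambda>k. norm (f k))"
  shows "ennreal (norm (\<Sum>k. f k)) \<le> (\<Sum>k. ennreal (norm (f k)))"
proof -
  have "ennreal (norm (\<Sum>k. f k)) \<le> ennreal (\<Sum>k. norm (f k))"
    by (rule ennreal_leI[OF summable_norm[OF assms]])
  then show ?thesis
    by (simp only: suminf_ennreal2[OF norm_ge_zero assms])
qed

lemma low_pass_representation:
  fixes \<psi> :: "real^'n::finite \<Rightarrow> real" and Fk :: "nat \<Rightarrow> real^'n \<Rightarrow> complex"
  assumes \<psi>: "cutoff \<psi>" and u: "u \<in> tempered_distributions"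
    and Fk: "\<And>k. represents (Fk k) (fourier_multiplier (\<lambda>\<xi>. complex_of_real (dyadic \<psi> k \<xi>)) u)"
    and tame: "\<And>k. tame (Fk k)" and \<phi>: "\<phi> \<in> test_functions"
  shows "u (fourier (\<lambda>\<xi>. low_pass \<psi> m \<xi> * inv_fourier \<phi> \<xi>)) = (\<integral>x. (\<Sum>k\<le>m. Fk k x) * \<phi> x \<partial>lborel)"
proof -
  have \<phi>S: "\<phi> \<in> schwartz" using \<phi> test_functions_schwartz by blast
  have "u (fourier (\<lambda>\<xi>. low_pass \<psi> m \<xi> * inv_fourier \<phi> \<xi>)) =
      (\<Sum>k\<le>m. fourier_multiplier (\<lambda>\<xi>. complex_of_real (dyadic \<psi> k \<xi>)) u \<phi>)"
    by (rule sum_dyadic_multipliers[OF \<psi> u \<phi>S, symmetric])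
  also have "\<dots> = (\<Sum>k\<le>m. \<integral>x. Fk k x * \<phi> x \<partial>lborel)"
    using Fk \<phi> unfolding represents_tame[OF tame] by (intro sum.cong refl) blast
  also have "\<dots> = (\<integral>x. (\<Sum>k\<le>m. Fk k x * \<phi> x) \<partial>lborel)"
    by (rule Bochner_Integration.integral_sum[symmetric]) (rule tame_schwartz_integrable[OF tame \<phi>S])
  finally show ?thesis
    by (simp only: sum_distrib_right)
qed

text \<open>Finiteness of the norm is what makes every block a function: without a representative
  the infimum in \<open>morrey_norm_dist\<close> is \<infinity>, and the positive factor in front
  carries this over to the whole sequence norm.\<close>

lemma besov_morrey_pieces:
  fixes \<psi> :: "real^'n::finite \<Rightarrow> real"
  assumes \<psi>: "cutoff \<psi>" and q: "1 \<le> q" and r: "1 \<le> r"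
    and u: "u \<in> besov_morrey \<psi> s p q r"
  obtains Fk b where
    "\<And>k. represents (Fk k) (fourier_multiplier (\<lambda>\<xi>. complex_of_real (dyadic \<psi> k \<xi>)) u)"
    "\<And>k. morrey_le p q (Fk k) (b k)"
    "lr_le r (\<lambda>k. 2 powr (real k * s) * b k) (enn2real (besov_morrey_norm \<psi> s p q r u))"
proof -
  let ?u = "\<lambda>k. fourier_multiplier (\<lambda>\<xi>. complex_of_real (dyadic \<psi> k \<xi>)) u"
  let ?N = "besov_morrey_norm \<psi> s p q r u"
  have N: "?N < \<infinity>" using u by (simp add: besov_morrey_def)
  have Nle: "lr_norm r (\<lambda>k. ennreal (2 powr (real k * s)) * morrey_norm_dist p q (?u k)) = ?N"
    by (simp add: besov_morrey_norm_eq_lr_norm)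
  have fin: "morrey_norm_dist p q (?u k) < \<infinity>" for k
  proof (rule ccontr)
    assume "\<not> morrey_norm_dist p q (?u k) < \<infinity>"
    then have "morrey_norm_dist p q (?u k) = \<infinity>" by (simp add: less_top[symmetric])
    then have inf: "ennreal (2 powr (real k * s)) * morrey_norm_dist p q (?u k) = \<infinity>"
      by (simp add: ennreal_mult_top)
    define a where "a k = ennreal (2 powr (real k * s)) * morrey_norm_dist p q (?u k)" for k
    have ak: "a k = \<infinity>" using inf by (simp add: a_def)
    have "lr_norm r a = \<infinity>"
    proof (cases "r = \<infinity>")
      case True
      have "a k \<le> (SUP j. a j)" by (rule SUP_upper) simp
      then show ?thesis using True ak by (simp add: lr_norm_def top_unique)
    next
      case False
      have "ennreal_powr (a k) (enn2real r) \<le> (\<Sum>j. ennreal_powr (a j) (enn2real r))"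
        by (rule term_le_suminf_ennreal)
      then have "(\<Sum>j. ennreal_powr (a j) (enn2real r)) = \<infinity>"
        using ak by (simp add: ennreal_powr_def top_unique)
      then show ?thesis using False by (simp add: lr_norm_def ennreal_powr_def)
    qed
    then show False using Nle N by (simp add: a_def[abs_def])
  qed
  have "\<exists>F. represents F (?u k)" for k
  proof (rule ccontr)
    assume "\<nexists>F. represents F (?u k)"
    then have "{F. represents F (?u k)} = {}" by blast
    then have "morrey_norm_dist p q (?u k) = \<infinity>"
      unfolding morrey_norm_dist_def by simp
    then show False using fin[of k] by simp
  qed
  then have "\<exists>F. \<forall>k. represents (F k) (?u k)" by (intro choice allI)
  then obtain F0 where F0: "\<And>k. represents (F0 k) (?u k)" by blast
  have "\<exists>F. \<forall>k. represents (F k) (?u k) \<and> F k \<in> borel_measurable borel"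
    by (intro choice allI) (use represents_borel_version[OF F0] in metis)
  then obtain Fk where Fk: "\<And>k. represents (Fk k) (?u k)" "\<And>k. Fk k \<in> borel_measurable borel" by blast
  define b where "b k = enn2real (morrey_norm p q (Fk k))" for k
  have b: "morrey_norm_dist p q (?u k) = ennreal (b k)" for k
    using fin[of k] unfolding morrey_norm_dist_eq[OF \<psi> Fk(1)] by (simp add: b_def)
  have b0: "b k \<ge> 0" for k by (simp add: b_def)
  show ?thesis
  proof (rule that[OF Fk(1)])
    show "morrey_le p q (Fk k) (b k)" for k
      using b[of k] b0[of k] q unfolding morrey_norm_dist_eq[OF \<psi> Fk(1)]
      by (subst morrey_le_iff[symmetric, OF Fk(2)]) auto
    show "lr_le r (\<lambda>k. 2 powr (real k * s) * b k) (enn2real ?N)"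
      unfolding lr_le_def using b0 N Nle by (simp add: b ennreal_mult')
  qed
qed

text \<open>The positivity of \<open>s\<close> enters here: each \<open>b k\<close> is at most
  2^(-ks) times the norm, so \<open>b\<close> is summable, and the weighted integral bounds of the
  pieces add up to almost everywhere absolute convergence. The sum is identified with
  \<open>u\<close> by letting the low-pass parts converge on both sides of the pairing with test
  functions.\<close>

lemma besov_morrey_decomposition:
  fixes \<psi> :: "real^'n::finite \<Rightarrow> real"
  assumes \<psi>: "cutoff \<psi>" and q: "1 \<le> q" "q \<le> p" and r: "1 \<le> r" and s: "s > 0"
    and u: "u \<in> besov_morrey \<psi> s p q r"
  obtains F Fk b where
    "represents F u" "tame F"
    "\<And>k. morrey_le p q (Fk k) (b k)" "summable b"
    "lr_le r (\<lambda>k. 2 powr (real k * s) * b k) (enn2real (besov_morrey_norm \<psi> s p q r u))"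
    "AE x in lborel. summable (\<lambda>k. norm (Fk k x)) \<and> F x = (\<Sum>k. Fk k x)"
    "\<And>m. AE x in lborel. conv (multiplier_kernel (low_pass \<psi> m)) F x = (\<Sum>k\<le>m. Fk k x)"
proof -
  have uT: "u \<in> tempered_distributions" using u by (simp add: besov_morrey_def)
  obtain Fk b where Fk: "\<And>k. represents (Fk k) (fourier_multiplier (\<lambda>\<xi>. complex_of_real (dyadic \<psi> k \<xi>)) u)"
    and M: "\<And>k. morrey_le p q (Fk k) (b k)"
    and lr: "lr_le r (\<lambda>k. 2 powr (real k * s) * b k) (enn2real (besov_morrey_norm \<psi> s p q r u))"
    using besov_morrey_pieces[OF \<psi> q(1) r u] by blast
  define N where "N = enn2real (besov_morrey_norm \<psi> s p q r u)"
  note [measurable] = morrey_leD(1)[OF M]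
  have tame: "tame (Fk k)" for k by (rule morrey_le_tame[OF M q])
  have b0: "b k \<ge> 0" for k by (rule morrey_leD(2)[OF M])
  have sb: "summable b"
  proof (rule summable_comparison_test')
    show "summable (\<lambda>k::nat. 2 powr (- (real k * s)) * N)"
      by (intro summable_mult2 summable_geometric_powr s)
    show "norm (b k) \<le> 2 powr (- (real k * s)) * N" if "k \<ge> 0" for k
    proof -
      have "2 powr (real k * s) * b k \<le> N"
        using lr_le_term[OF lr r] by (simp add: N_def)
      then show ?thesis
        using b0[of k] by (simp add: powr_minus field_simps)
    qed
  qed
  define F where "F x = (\<Sum>k. Fk k x)" for x
  have Fm [measurable]: "F \<in> borel_measurable borel"
    unfolding F_def[abs_def] by measurable
  obtain K where K: "K > 0" and Kb: "\<And>F A y. morrey_le p q (F :: real^'n \<Rightarrow> complex) A \<Longrightarrow>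
       (\<integral>\<^sup>+z. ennreal (norm (F z)) * ennreal (weight (z - y)) \<partial>lborel) \<le> ennreal (K * A)"
    by (rule morrey_le_weighted[OF q]) (rule that)
  \<comment> \<open>The weighted integral of \<open>S\<close> is finite. This yields absolute
    convergence almost everywhere, and the majorant for all partial sums in the limit below.\<close>
  define S where "S x = (\<Sum>k. ennreal (norm (Fk k x)))" for x
  have Sm [measurable]: "S \<in> borel_measurable borel"
    unfolding S_def[abs_def] by measurable
  have Sint: "(\<integral>\<^sup>+x. S x * ennreal (weight x) \<partial>lborel) < \<infinity>"
  proof -
    have "(\<integral>\<^sup>+x. S x * ennreal (weight x) \<partial>lborel) = (\<integral>\<^sup>+x. (\<Sum>k. ennreal (norm (Fk k x)) * ennreal (weight (x - 0))) \<partial>lborel)"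
      by (simp add: S_def)
    also have "\<dots> = (\<Sum>k. \<integral>\<^sup>+x. ennreal (norm (Fk k x)) * ennreal (weight (x - 0)) \<partial>lborel)"
      by (rule nn_integral_suminf) measurable
    also have "\<dots> \<le> (\<Sum>k. ennreal (K * b k))"
      by (intro suminf_le Kb M) auto
    also have "\<dots> = ennreal (\<Sum>k. K * b k)"
      by (rule suminf_ennreal2) (use K b0 sb in \<open>auto intro: summable_mult\<close>)
    finally show ?thesis by (simp add: order_le_less_trans)
  qed
  have "AE x in lborel. S x * ennreal (weight x) \<noteq> \<infinity>"
    by (rule nn_integral_noteq_infinite) (use Sint in auto)
  then have AES: "AE x in lborel. S x \<noteq> \<infinity>"
  proof eventually_elim
    case (elim x)
    then show ?case using weight_pos[of x] by (auto simp: ennreal_top_mult)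
  qed
  have summ: "summable (\<lambda>k. norm (Fk k x))" if "S x \<noteq> \<infinity>" for x
    using that unfolding S_def by (intro summable_suminf_not_top) auto
  have AE1: "AE x in lborel. summable (\<lambda>k. norm (Fk k x)) \<and> F x = (\<Sum>k. Fk k x)"
    using AES by eventually_elim (simp add: summ F_def)
  have "morrey_le p q F (suminf b)"
  proof (rule morrey_le_sum[OF M sb q(1) Fm], use AES in eventually_elim)
    case (elim x)
    show ?case
      unfolding F_def by (rule norm_suminf_le_ennreal[OF summ[OF elim]])
  qed
  then have tameF: "tame F" by (rule morrey_le_tame[OF _ q])
  have pair: "u \<phi> = (\<integral>x. F x * \<phi> x \<partial>lborel)" if \<phi>: "\<phi> \<in> test_functions" for \<phi> :: "real^'n \<Rightarrow> complex"
  proof -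
    have \<phi>S: "\<phi> \<in> schwartz" using \<phi> test_functions_schwartz by blast
    note [measurable] = schwartz_measurable[OF \<phi>S]
    obtain C where C: "C \<ge> 0" "\<And>x. norm (\<phi> x) \<le> C * weight x"
      using schwartz_weight0[OF \<phi>S] by blast
    have lim1: "(\<lambda>m. u (fourier (\<lambda>\<xi>. low_pass \<psi> m \<xi> * inv_fourier \<phi> \<xi>))) \<longlonglongrightarrow> u \<phi>"
      by (rule low_pass_tendsto[OF \<psi> uT \<phi>S])
    \<comment> \<open>\<open>enn2real\<close> sends \<infinity> to 0, so the majorant built from
      \<open>S\<close> is valid only where \<open>S\<close> is finite, which is almost
      everywhere.\<close>
    have lim2: "(\<lambda>m. \<integral>x. (\<Sum>k\<le>m. Fk k x) * \<phi> x \<partial>lborel) \<longlonglongrightarrow> (\<integral>x. F x * \<phi> x \<partial>lborel)"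
    proof (rule integral_dominated_convergence[where w = "\<lambda>x. enn2real (S x) * (C * weight x)"])
      show "integrable lborel (\<lambda>x. enn2real (S x) * (C * weight x))"
      proof (rule integrableI_bounded)
        have "(\<integral>\<^sup>+x. ennreal (norm (enn2real (S x) * (C * weight x))) \<partial>lborel)
           \<le> (\<integral>\<^sup>+x. ennreal C * (S x * ennreal (weight x)) \<partial>lborel)"
        proof (rule nn_integral_mono)
          fix x
          have "ennreal (norm (enn2real (S x) * (C * weight x))) = ennreal C * (ennreal (enn2real (S x)) * ennreal (weight x))"
            using C(1) by (simp add: ennreal_mult'[symmetric] abs_mult mult.left_commute)
          also have "\<dots> \<le> ennreal C * (S x * ennreal (weight x))"
            by (intro mult_left_mono mult_right_mono) (auto simp: ennreal_enn2real_if)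
          finally show "ennreal (norm (enn2real (S x) * (C * weight x))) \<le> ennreal C * (S x * ennreal (weight x))" .
        qed
        also have "\<dots> = ennreal C * (\<integral>\<^sup>+x. S x * ennreal (weight x) \<partial>lborel)"
          by (rule nn_integral_cmult) measurable
        also have "\<dots> < \<infinity>" using Sint by (simp add: ennreal_mult_less_top)
        finally show "(\<integral>\<^sup>+x. ennreal (norm (enn2real (S x) * (C * weight x))) \<partial>lborel) < \<infinity>" .
      qed measurable
      show "AE x in lborel. (\<lambda>m. (\<Sum>k\<le>m. Fk k x) * \<phi> x) \<longlonglongrightarrow> F x * \<phi> x"
        using AE1
      proof eventually_elim
        case (elim x)
        then have "(\<lambda>m. \<Sum>k\<le>m. Fk k x) \<longlonglongrightarrow> F x"
          using summable_LIMSEQ'[OF summable_norm_cancel, of "\<lambda>k. Fk k x"] by simp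
        then show ?case by (intro tendsto_intros)
      qed
      show "AE x in lborel. norm ((\<Sum>k\<le>m. Fk k x) * \<phi> x) \<le> enn2real (S x) * (C * weight x)" for m
        using AES
      proof eventually_elim
        case (elim x)
        have "norm (\<Sum>k\<le>m. Fk k x) \<le> (\<Sum>k\<le>m. norm (Fk k x))" by (rule norm_sum)
        also have "\<dots> \<le> (\<Sum>k. norm (Fk k x))"
          by (rule sum_le_suminf[OF summ[OF elim]]) auto
        also have "\<dots> = enn2real (S x)"
          unfolding S_def by (subst suminf_ennreal2) (use summ[OF elim] suminf_nonneg[OF summ[OF elim]] in auto)
        finally show ?case
          using C by (simp add: norm_mult mult_mono)
      qed
    qed measurable
    show ?thesis
      using LIMSEQ_unique[OF lim1 lim2[folded low_pass_representation[OF \<psi> uT Fk tame \<phi>]]] .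
  qed
  have repF: "represents F u"
    unfolding represents_tame[OF tameF] using pair by blast
  \<comment> \<open>The convolution formula for multipliers needs the pairing with all Schwartz
    functions. It extends from test functions by density, since both sides are tempered.\<close>
  have pairS: "u \<eta> = (\<integral>x. F x * \<eta> x \<partial>lborel)" if "\<eta> \<in> schwartz" for \<eta> :: "real^'n \<Rightarrow> complex"
  proof -
    have "u \<eta> = dist_of F \<eta>"
    proof (rule tempered_eq_on_schwartz[OF \<psi> uT dist_of_tempered[OF tameF] _ that])
      fix \<phi> :: "real^'n \<Rightarrow> complex" assume "\<phi> \<in> test_functions"
      then show "u \<phi> = dist_of F \<phi>"
        using pair test_functions_schwartz by (subst dist_of_apply) auto
    qed
    then show ?thesis by (simp add: dist_of_apply[OF that])
  qed
  \<comment> \<open>The convolution and the partial sum represent the same distribution, the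
    low-pass part of \<open>u\<close>, hence agree almost everywhere.\<close>
  have AE2: "AE x in lborel. conv (multiplier_kernel (low_pass \<psi> m)) F x = (\<Sum>k\<le>m. Fk k x)" for m
  proof (rule represents_unique[OF \<psi>])
    note lp = low_pass_test_function[OF \<psi>, of m]
    show "represents (conv (multiplier_kernel (low_pass \<psi> m)) F) (fourier_multiplier (low_pass \<psi> m) u)"
      by (rule represents_fourier_multiplier[OF tameF pairS lp])
    have t: "tame (\<lambda>x. \<Sum>k\<le>m. Fk k x)"
      by (rule morrey_le_tame[OF morrey_le_finite_sum[OF M q(1)] q])
    show "represents (\<lambda>x. \<Sum>k\<le>m. Fk k x) (fourier_multiplier (low_pass \<psi> m) u)"
      unfolding represents_tame[OF t]
    proof
      fix \<phi> :: "real^'n \<Rightarrow> complex" assume \<phi>: "\<phi> \<in> test_functions"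
      then have "fourier_multiplier (low_pass \<psi> m) u \<phi> = u (fourier (\<lambda>\<xi>. low_pass \<psi> m \<xi> * inv_fourier \<phi> \<xi>))"
        using test_functions_schwartz by (intro fourier_multiplier_apply[OF lp]) blast
      then show "fourier_multiplier (low_pass \<psi> m) u \<phi> = (\<integral>x. (\<Sum>k\<le>m. Fk k x) * \<phi> x \<partial>lborel)"
        using low_pass_representation[OF \<psi> uT Fk tame \<phi>] by simp
    qed
  qed
  show ?thesis
    by (rule that[OF repF tameF M sb lr AE1 AE2])
qed

text \<open>The bound comes from the partial sum of the pieces and not from the L^1 norm of the
  kernel, so the low-pass part satisfies the same bound \<open>suminf b\<close> as the full
  function.\<close>

lemma morrey_le_low_pass:
  fixes \<psi> :: "real^'n::finite \<Rightarrow> real"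
  assumes \<psi>: "cutoff \<psi>" and F: "tame F" and M: "\<And>k. morrey_le p q (Fk k) (b k)" and q: "1 \<le> q" and b: "summable b"
    and lp: "AE x in lborel. conv (multiplier_kernel (low_pass \<psi> m)) F x = (\<Sum>k\<le>m. Fk k x)"
  shows "morrey_le p q (conv (multiplier_kernel (low_pass \<psi> m)) F) (suminf b)"
proof -
  have "morrey_le p q (\<lambda>x. \<Sum>k\<le>m. Fk k x) (suminf b)"
    using q by (intro morrey_le_mono[OF morrey_le_finite_sum[OF M q]] sum_le_suminf b)
      (auto intro: morrey_leD(2)[OF M])
  then show ?thesis
    by (rule morrey_le_cong_AE[OF _ conv_measurable[OF F kernel_schwartz[OF low_pass_schwartz[OF \<psi>]]]])
      (use lp in eventually_elim, simp)
qed

text \<open>The low-pass part contains the blocks up to and including m, so the remaining series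
  starts at \<open>Suc m\<close>.\<close>

lemma morrey_le_tail:
  fixes \<psi> :: "real^'n::finite \<Rightarrow> real"
  assumes \<psi>: "cutoff \<psi>" and F: "tame F" and M: "\<And>k. morrey_le p q (Fk k) (b k)" and q: "1 \<le> q" and b: "summable b"
    and sum: "AE x in lborel. summable (\<lambda>k. norm (Fk k x)) \<and> F x = (\<Sum>k. Fk k x)"
    and lp: "AE x in lborel. conv (multiplier_kernel (low_pass \<psi> m)) F x = (\<Sum>k\<le>m. Fk k x)"
  shows "morrey_le p q (\<lambda>x. F x - conv (multiplier_kernel (low_pass \<psi> m)) F x) (\<Sum>k. b (k + Suc m))"
proof (rule morrey_le_sum[where Fk = "\<lambda>k. Fk (k + Suc m)"])
  show "morrey_le p q (Fk (k + Suc m)) (b (k + Suc m))" for k by (rule M)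
  show "summable (\<lambda>k. b (k + Suc m))" using b by (rule summable_ignore_initial_segment)
  show "(\<lambda>x. F x - conv (multiplier_kernel (low_pass \<psi> m)) F x) \<in> borel_measurable borel"
    using tame_measurable[OF F] conv_measurable[OF F kernel_schwartz[OF low_pass_schwartz[OF \<psi>]]] by measurable
  show "AE x in lborel. ennreal (norm (F x - conv (multiplier_kernel (low_pass \<psi> m)) F x)) \<le> (\<Sum>k. ennreal (norm (Fk (k + Suc m) x)))"
    using sum lp
  proof eventually_elim
    case (elim x)
    have s: "summable (\<lambda>k. norm (Fk (k + Suc m) x))"
      using elim(1) summable_ignore_initial_segment by blast
    have "F x - conv (multiplier_kernel (low_pass \<psi> m)) F x = (\<Sum>k. Fk (k + Suc m) x)"
      using elim suminf_minus_initial_segment[of "\<lambda>k. Fk k x" "Suc m"]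
      by (simp add: summable_norm_cancel lessThan_Suc_atMost)
    then show ?case
      using norm_suminf_le_ennreal[OF s] by simp
  qed
qed (rule q)

text \<open>Two frequencies of norm below 3/2 * 2^m have a sum of norm below 3 * 2^m, hence below
  2^(m+2), and both cutoffs in the block m + 3 equal 1 there and cancel. The shift 3 is the smallest
  that the radii 6/5 and 3/2 guarantee: the inner cutoff of the block m + 2 is known to be 1 only
  below 2.4 * 2^m.\<close>

lemma low_pass_dyadic_zero:
  fixes \<psi> :: "real^'n::finite \<Rightarrow> real"
  assumes \<psi>: "cutoff \<psi>"
  shows "low_pass \<psi> m \<xi> * low_pass \<psi> m \<eta> * complex_of_real (dyadic \<psi> (m + 3) (\<xi> + \<eta>)) = 0"
proof (cases "norm \<xi> < 3/2 * 2 ^ m \<and> norm \<eta> < 3/2 * 2 ^ m")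
  case True
  then have "norm (\<xi> + \<eta>) < 3 * 2 ^ m"
    using norm_triangle_ineq[of \<xi> \<eta>] by linarith
  moreover have "(0::real) < 2 ^ m" by simp
  ultimately have "norm (\<xi> + \<eta>) < 2 ^ m * 8" "norm (\<xi> + \<eta>) < 2 ^ m * 4" by linarith+
  then have "norm ((1 / 2 ^ (m + 3)) *\<^sub>R (\<xi> + \<eta>)) < 1" "norm ((1 / 2 ^ (m + 2)) *\<^sub>R (\<xi> + \<eta>)) < 1"
    by (simp_all add: divide_less_eq power_add)
  then have "norm ((1 / 2 ^ (m + 3)) *\<^sub>R (\<xi> + \<eta>)) < 6/5" "norm ((1 / 2 ^ (m + 2)) *\<^sub>R (\<xi> + \<eta>)) < 6/5"
    by linarith+
  then have "\<psi> ((1 / 2 ^ (m + 3)) *\<^sub>R (\<xi> + \<eta>)) = 1" "\<psi> ((1 / 2 ^ (m + 2)) *\<^sub>R (\<xi> + \<eta>)) = 1"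
    by (simp_all only: cutoffD(4)[OF \<psi>])
  then have "dyadic \<psi> (Suc (m + 2)) (\<xi> + \<eta>) = 0"
    by (simp add: numeral_3_eq_3 numeral_2_eq_2)
  then show ?thesis by (simp add: numeral_3_eq_3 numeral_2_eq_2)
next
  case False
  have "low_pass \<psi> m \<zeta> = 0" if "\<not> norm \<zeta> < 3/2 * 2 ^ m" for \<zeta>
  proof -
    have "norm ((1 / 2 ^ m) *\<^sub>R \<zeta>) \<ge> 3/2"
      using that by (simp add: field_simps)
    then show ?thesis using cutoffD(5)[OF \<psi>] by (simp add: low_pass_def)
  qed
  then show ?thesis using False by auto
qed

lemma product_piece_bound:
  fixes \<psi> :: "real^'n::finite \<Rightarrow> real"
  assumes \<psi>: "cutoff \<psi>"
    and e: "1 \<le> q1" "q1 \<le> p1" "1 \<le> q2" "q2 \<le> p2" "1 \<le> q" "q \<le> p" "1 / p = 1 / p1 + 1 / p2" "1 / q = 1 / q1 + 1 / q2"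
    and F: "tame F" "\<And>k. morrey_le p1 q1 (Fk k) (b k)" "summable b"
      "AE x in lborel. summable (\<lambda>k. norm (Fk k x)) \<and> F x = (\<Sum>k. Fk k x)"
      "\<And>m. AE x in lborel. conv (multiplier_kernel (low_pass \<psi> m)) F x = (\<Sum>k\<le>m. Fk k x)"
    and MF: "morrey_le p1 q1 F (suminf b)"
    and G: "tame G" "\<And>k. morrey_le p2 q2 (Gk k) (d k)" "summable d"
      "AE x in lborel. summable (\<lambda>k. norm (Gk k x)) \<and> G x = (\<Sum>k. Gk k x)"
      "\<And>m. AE x in lborel. conv (multiplier_kernel (low_pass \<psi> m)) G x = (\<Sum>k\<le>m. Gk k x)"
    and MG: "morrey_le p2 q2 G (suminf d)"
    and L: "L > 0" "(\<integral>\<^sup>+x. ennreal (norm (multiplier_kernel (\<lambda>\<xi>. complex_of_real (dyadic \<psi> j \<xi>)) x)) \<partial>lborel) \<le> ennreal L"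
  shows "morrey_le p q (conv (multiplier_kernel (\<lambda>\<xi>. complex_of_real (dyadic \<psi> j \<xi>))) (\<lambda>x. F x * G x))
     (L * (suminf d * (\<Sum>k. b (k + (j - 2))) + suminf b * (\<Sum>k. d (k + (j - 2)))))"
proof -
  let ?K = "multiplier_kernel (\<lambda>\<xi>. complex_of_real (dyadic \<psi> j \<xi>))"
  note KS = kernel_schwartz[OF dyadic_schwartz[OF \<psi>, of j]]
  have pos: "q > 0" "q1 > 0" "q2 > 0" using e by auto
  note mult = morrey_le_mult[OF _ _ pos e(8) e(7)]
  have B0: "suminf b \<ge> 0" and D0: "suminf d \<ge> 0"
    using morrey_leD(2) MF MG by blast+
  have FG: "morrey_le p q (\<lambda>x. F x * G x) (suminf b * suminf d)"
    by (rule mult[OF MF MG])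
  have conv_le: "morrey_le p q (conv ?K R) (L * A)" if "morrey_le p q R A" for R A
    by (rule morrey_le_conv[OF that e(5) schwartz_measurable[OF KS] conv_measurable[OF morrey_le_tame[OF that e(5,6)] KS] L])
  show ?thesis
  proof (cases "j \<ge> 3")
    case True
    define m where "m = j - 3"
    \<comment> \<open>\<open>j - 2\<close> is the first block that the low-pass filter at m does not
      contain.\<close>
    have j: "j = m + 3" "j - 2 = Suc m" using True by (auto simp: m_def)
    let ?SF = "conv (multiplier_kernel (low_pass \<psi> m)) F" and ?SG = "conv (multiplier_kernel (low_pass \<psi> m)) G"
    let ?R = "\<lambda>x. (F x - ?SF x) * G x + ?SF x * (G x - ?SG x)"
    have SF: "morrey_le p1 q1 ?SF (suminf b)"
      by (rule morrey_le_low_pass[OF \<psi> F(1,2) e(1) F(3,5)])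
    have SG: "morrey_le p2 q2 ?SG (suminf d)"
      by (rule morrey_le_low_pass[OF \<psi> G(1,2) e(3) G(3,5)])
    have TF: "morrey_le p1 q1 (\<lambda>x. F x - ?SF x) (\<Sum>k. b (k + Suc m))"
      by (rule morrey_le_tail[OF \<psi> F(1,2) e(1) F(3,4,5)])
    have TG: "morrey_le p2 q2 (\<lambda>x. G x - ?SG x) (\<Sum>k. d (k + Suc m))"
      by (rule morrey_le_tail[OF \<psi> G(1,2) e(3) G(3,4,5)])
    have R: "morrey_le p q ?R ((\<Sum>k. b (k + Suc m)) * suminf d + suminf b * (\<Sum>k. d (k + Suc m)))"
      by (rule morrey_le_add[OF mult[OF TF MG] mult[OF SF TG] e(5)])
    have tR: "tame ?R" by (rule morrey_le_tame[OF R e(5,6)])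
    have tS: "tame (\<lambda>x. ?SF x * ?SG x)" by (rule morrey_le_tame[OF mult[OF SF SG] e(5,6)])
    have int: "integrable lborel (\<lambda>z. H z * ?K (z - y))" if "tame H" for H y
    proof -
      have "(\<lambda>z. ?K (1 *\<^sub>R z + (- y))) \<in> schwartz" by (rule schwartz_affine[OF KS]) simp
      then show ?thesis using tame_schwartz_integrable[OF that] by simp
    qed
    have "conv ?K (\<lambda>x. F x * G x) = conv ?K ?R"
    proof
      fix y
      have "conv ?K (\<lambda>x. F x * G x) y = (\<integral>z. ?SF z * ?SG z * ?K (z - y) + ?R z * ?K (z - y) \<partial>lborel)"
        unfolding conv_def[of ?K] by (intro Bochner_Integration.integral_cong refl) (simp add: algebra_simps)
      also have "\<dots> = conv ?K (\<lambda>x. ?SF x * ?SG x) y + conv ?K ?R y"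
        unfolding conv_def[of ?K] by (rule Bochner_Integration.integral_add[OF int[OF tS] int[OF tR]])
      also have "conv ?K (\<lambda>x. ?SF x * ?SG x) y = 0"
        unfolding j(1)
        by (rule conv_product_zero[OF dyadic_schwartz[OF \<psi>] low_pass_schwartz[OF \<psi>] low_pass_schwartz[OF \<psi>] low_pass_dyadic_zero[OF \<psi>] F(1) G(1)])
      finally show "conv ?K (\<lambda>x. F x * G x) y = conv ?K ?R y" by simp
    qed
    then show ?thesis
      using conv_le[OF R] by (simp only: j(2) mult.commute[of "suminf d"])
  next
    case False
    \<comment> \<open>For the first three blocks there is no filter to subtract. Truncated
      subtraction turns both tails into the full sums, and the plain product bound is half of the
      claimed one.\<close>
    then have j: "j - 2 = 0" by simp
    have "L * (suminf b * suminf d) \<le> L * (suminf d * (\<Sum>k. b (k + 0)) + suminf b * (\<Sum>k. d (k + 0)))"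
      using L(1) B0 D0 by (intro mult_left_mono) (auto simp: mult.commute)
    then show ?thesis
      unfolding j by (rule morrey_le_mono[OF conv_le[OF FG] _ pos(1)])
  qed
qed

text \<open>Distributing the weight over the tail writes it as a convolution of the weighted
  sequence 2^(ks) \<open>b k\<close> with the summable weights 2^(-is), ready for Young's
  inequality. The factor \<open>2 powr (2 * s)\<close> pays for the shift by two;
  \<open>real j \<le> 2 + real (j - 2)\<close> survives the truncation for small j.\<close>

lemma weighted_tail_le:
  fixes b :: "nat \<Rightarrow> real"
  assumes b: "summable b" "\<And>k. b k \<ge> 0" and s: "s > 0"
  shows "2 powr (real j * s) * (\<Sum>k. b (k + (j - 2)))
    \<le> 2 powr (2 * s) * (\<Sum>i. 2 powr (- (real i * s)) * (2 powr (real (i + (j - 2)) * s) * b (i + (j - 2))))"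
proof -
  have eq: "2 powr (- (real i * s)) * (2 powr (real (i + (j - 2)) * s) * b (i + (j - 2))) = 2 powr (real (j - 2) * s) * b (i + (j - 2))" for i
  proof -
    have "2 powr (- (real i * s)) * 2 powr (real (i + (j - 2)) * s) = 2 powr (real (j - 2) * s)"
      unfolding powr_add[symmetric] by (simp only: of_nat_add distrib_right) simp
    then show ?thesis by (simp only: mult.assoc[symmetric])
  qed
  have sm: "summable (\<lambda>k. b (k + (j - 2)))"
    using b(1) by (rule summable_ignore_initial_segment)
  have "2 powr (real j * s) \<le> (2 powr (2 * s) * 2 powr (real (j - 2) * s) :: real)"
  proof -
    have "real j \<le> 2 + real (j - 2)" by simp
    then have "real j * s \<le> (2 + real (j - 2)) * s"
      using s by (intro mult_right_mono) auto
    then show ?thesis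
      by (simp add: powr_add[symmetric] distrib_right)
  qed
  then have "2 powr (real j * s) * (\<Sum>k. b (k + (j - 2))) \<le> (2 powr (2 * s) * 2 powr (real (j - 2) * s)) * (\<Sum>k. b (k + (j - 2)))"
    by (rule mult_right_mono) (intro suminf_nonneg sm b(2))
  also have "\<dots> = 2 powr (2 * s) * (\<Sum>i. 2 powr (real (j - 2) * s) * b (i + (j - 2)))"
    by (simp add: suminf_mult[OF sm] mult.assoc)
  finally show ?thesis unfolding eq .
qed

text \<open>Only the bound on single terms enters, that is, the embedding of \<ell>^r into
  \<ell>^\<infinity>; the rest is a geometric series.\<close>

lemma suminf_le_weighted:
  fixes b :: "nat \<Rightarrow> real"
  assumes b: "summable b" and le: "\<And>k. 2 powr (real k * s) * b k \<le> N" and s: "s > 0"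
  shows "suminf b \<le> 1 / (1 - 2 powr (- s)) * N"
proof -
  note geo = summable_geometric_powr[OF s]
  have "b k \<le> 2 powr (- (real k * s)) * N" for k
    using le[of k] by (simp add: powr_minus field_simps)
  then have "suminf b \<le> (\<Sum>k. 2 powr (- (real k * s)) * N)"
    by (intro suminf_le b summable_mult2 geo(1))
  also have "\<dots> = 1 / (1 - 2 powr (- s)) * N"
    using sums_mult2[OF geo(2), of N] by (simp add: sums_iff)
  finally show ?thesis .
qed

text \<open>The product is formed from arbitrary representatives of the two factors, so its
  independence of their choice is part of the claim. \<open>h\<close> is the distribution that the
  pointwise product defines, and the constant is fixed before the factors.\<close>

theorem theorem1p1:
  fixes \<psi> :: "real^'n::finite \<Rightarrow> real"
    and p q p\<^sub>1 q\<^sub>1 p\<^sub>2 q\<^sub>2 s :: real and r :: ennreal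
  assumes "cutoff \<psi>"
    and "1 \<le> q\<^sub>1" "q\<^sub>1 \<le> p\<^sub>1"
    and "1 \<le> q\<^sub>2" "q\<^sub>2 \<le> p\<^sub>2"
    and "1 \<le> q" "q \<le> p"
    and "1 \<le> r"
    and "s > 0"
    and "1 / p = 1 / p\<^sub>1 + 1 / p\<^sub>2"
    and "1 / q = 1 / q\<^sub>1 + 1 / q\<^sub>2"
  shows "\<exists>C::real. C > 0 \<and>
    (\<forall>f \<in> besov_morrey \<psi> s p\<^sub>1 q\<^sub>1 r. \<forall>g \<in> besov_morrey \<psi> s p\<^sub>2 q\<^sub>2 r.
       (\<exists>F. represents F f) \<and> (\<exists>G. represents G g) \<and>
       (\<forall>F G. represents F f \<longrightarrow> represents G g \<longrightarrow>
          (\<exists>h \<in> besov_morrey \<psi> s p q r.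
             represents (\<lambda>x. F x * G x) h \<and>
             besov_morrey_norm \<psi> s p q r h
               \<le> ennreal C * besov_morrey_norm \<psi> s p\<^sub>1 q\<^sub>1 r f * besov_morrey_norm \<psi> s p\<^sub>2 q\<^sub>2 r g)))"
proof -
  note \<psi> = assms(1) and r = assms(8) and s = assms(9)
  obtain L where L: "L > 0" and Lb: "\<And>j. (\<integral>\<^sup>+x. ennreal (norm (multiplier_kernel (\<lambda>\<xi>. complex_of_real (dyadic \<psi> j \<xi>)) x)) \<partial>lborel) \<le> ennreal L"
    by (rule kernel_dyadic_bound[OF \<psi>]) (rule that)
  define W where "W = 1 / (1 - 2 powr (- s))"
  have W: "W > 0" unfolding W_def by (rule summable_geometric_powr(3)[OF s])
  have wsums: "(\<lambda>i. 2 powr (- (real i * s))) sums W"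
    unfolding W_def by (rule summable_geometric_powr(2)[OF s])
  \<comment> \<open>\<open>L\<close> bounds the dyadic kernels, \<open>2 powr (2 * s)\<close> comes
    from the shift by two in the tails, and 4 from \<open>lr_le_add\<close>. Each of the two terms
    pairs a full sum, which costs \<open>W\<close>, with a tail in the sequence norm, which costs
    \<open>3 * W\<close>; together they give \<open>6 * W\<^sup>2\<close>.\<close>
  define C where "C = L * 2 powr (2 * s) * (4 * (6 * W\<^sup>2))"
  have C: "C > 0" using L W by (simp add: C_def)
  have main: "(\<exists>F. represents F f) \<and> (\<exists>G. represents G g) \<and>
       (\<forall>F G. represents F f \<longrightarrow> represents G g \<longrightarrow>
          (\<exists>h \<in> besov_morrey \<psi> s p q r.
             represents (\<lambda>x. F x * G x) h \<and>
             besov_morrey_norm \<psi> s p q r h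
               \<le> ennreal C * besov_morrey_norm \<psi> s p\<^sub>1 q\<^sub>1 r f * besov_morrey_norm \<psi> s p\<^sub>2 q\<^sub>2 r g))"
    if f: "f \<in> besov_morrey \<psi> s p\<^sub>1 q\<^sub>1 r" and g: "g \<in> besov_morrey \<psi> s p\<^sub>2 q\<^sub>2 r" for f g
  proof -
    define Nf where "Nf = enn2real (besov_morrey_norm \<psi> s p\<^sub>1 q\<^sub>1 r f)"
    define Ng where "Ng = enn2real (besov_morrey_norm \<psi> s p\<^sub>2 q\<^sub>2 r g)"
    have N: "besov_morrey_norm \<psi> s p\<^sub>1 q\<^sub>1 r f = ennreal Nf" "besov_morrey_norm \<psi> s p\<^sub>2 q\<^sub>2 r g = ennreal Ng"
      using f g by (auto simp: besov_morrey_def Nf_def Ng_def less_top)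
    have N0: "Nf \<ge> 0" "Ng \<ge> 0" by (simp_all add: Nf_def Ng_def)
    obtain F Fk b where F: "represents F f" "tame F"
      "\<And>k. morrey_le p\<^sub>1 q\<^sub>1 (Fk k) (b k)" "summable b"
      "lr_le r (\<lambda>k. 2 powr (real k * s) * b k) Nf"
      "AE x in lborel. summable (\<lambda>k. norm (Fk k x)) \<and> F x = (\<Sum>k. Fk k x)"
      "\<And>m. AE x in lborel. conv (multiplier_kernel (low_pass \<psi> m)) F x = (\<Sum>k\<le>m. Fk k x)"
      by (rule besov_morrey_decomposition[OF \<psi> assms(2,3) r s f, folded Nf_def]) (rule that)
    obtain G Gk d where G: "represents G g" "tame G"
      "\<And>k. morrey_le p\<^sub>2 q\<^sub>2 (Gk k) (d k)" "summable d"
      "lr_le r (\<lambda>k. 2 powr (real k * s) * d k) Ng"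
      "AE x in lborel. summable (\<lambda>k. norm (Gk k x)) \<and> G x = (\<Sum>k. Gk k x)"
      "\<And>m. AE x in lborel. conv (multiplier_kernel (low_pass \<psi> m)) G x = (\<Sum>k\<le>m. Gk k x)"
      by (rule besov_morrey_decomposition[OF \<psi> assms(4,5) r s g, folded Ng_def]) (rule that)
    have abs_sum: "morrey_le p' q' H (suminf c)"
      if "\<And>k. morrey_le p' q' (Hk k) (c k)" "summable c" "1 \<le> q'" "tame H"
        "AE x in lborel. summable (\<lambda>k. norm (Hk k x)) \<and> H x = (\<Sum>k. Hk k x)"
      for p' q' and H :: "real^'n \<Rightarrow> complex" and Hk c
    proof (rule morrey_le_sum[OF that(1,2,3) tame_measurable[OF that(4)]], use that(5) in eventually_elim)
      case (elim x)
      then show ?case using norm_suminf_le_ennreal by metis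
    qed
    have MF: "morrey_le p\<^sub>1 q\<^sub>1 F (suminf b)" by (rule abs_sum[OF F(3,4) assms(2) F(2,6)])
    have MG: "morrey_le p\<^sub>2 q\<^sub>2 G (suminf d)" by (rule abs_sum[OF G(3,4) assms(4) G(2,6)])
    \<comment> \<open>Up to the factor \<open>2 powr (2 * s)\<close>, \<open>X\<close> and
      \<open>Y\<close> majorise the weighted tails of \<open>b\<close> and \<open>d\<close>; they
      have the shape that \<open>lr_le_shift_convolution\<close> bounds.\<close>
    define X where "X j = (\<Sum>i. 2 powr (- (real i * s)) * (2 powr (real (i + (j - 2)) * s) * b (i + (j - 2))))" for j
    define Y where "Y j = (\<Sum>i. 2 powr (- (real i * s)) * (2 powr (real (i + (j - 2)) * s) * d (i + (j - 2))))" for j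
    have X: "lr_le r X (3 * W * Nf)"
      unfolding X_def[abs_def] by (rule lr_le_shift_convolution[OF F(5) r _ wsums W]) simp
    have Y: "lr_le r Y (3 * W * Ng)"
      unfolding Y_def[abs_def] by (rule lr_le_shift_convolution[OF G(5) r _ wsums W]) simp
    have b0: "b k \<ge> 0" and d0: "d k \<ge> 0" for k
      using morrey_leD(2) F(3) G(3) by blast+
    have B: "0 \<le> suminf b" "suminf b \<le> W * Nf" and D: "0 \<le> suminf d" "suminf d \<le> W * Ng"
      using suminf_le_weighted[OF F(4) lr_le_term[OF F(5) r] s] suminf_le_weighted[OF G(4) lr_le_term[OF G(5) r] s]
        suminf_nonneg[OF F(4) b0] suminf_nonneg[OF G(4) d0] by (auto simp: W_def)
    \<comment> \<open>The representatives from the decomposition are tame with tame product, so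
      integration against the product is a tempered distribution.\<close>
    define h where "h = dist_of (\<lambda>x. F x * G x)"
    have FG: "morrey_le p q (\<lambda>x. F x * G x) (suminf b * suminf d)"
      by (rule morrey_le_mult[OF MF MG]) (use assms in auto)
    have tFG: "tame (\<lambda>x. F x * G x)" by (rule morrey_le_tame[OF FG assms(6,7)])
    define c where "c j = L * (suminf d * (\<Sum>k. b (k + (j - 2))) + suminf b * (\<Sum>k. d (k + (j - 2))))" for j
    have c: "morrey_norm_dist p q (fourier_multiplier (\<lambda>\<xi>. complex_of_real (dyadic \<psi> j \<xi>)) h) \<le> ennreal (c j)" for j
    proof -
      let ?H = "conv (multiplier_kernel (\<lambda>\<xi>. complex_of_real (dyadic \<psi> j \<xi>))) (\<lambda>x. F x * G x)"
      have rep: "represents ?H (fourier_multiplier (\<lambda>\<xi>. complex_of_real (dyadic \<psi> j \<xi>)) h)"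
        by (rule represents_fourier_multiplier[OF tFG _ dyadic_test_function[OF \<psi>]])
          (simp add: h_def dist_of_apply)
      have m: "morrey_le p q ?H (c j)"
        unfolding c_def
        by (rule product_piece_bound[OF \<psi> assms(2-7,10,11) F(2,3,4,6,7) MF G(2,3,4,6,7) MG L Lb])
      have "morrey_norm p q ?H \<le> ennreal (c j)"
        using m assms(6) by (subst morrey_le_iff[OF morrey_leD(1,2)[OF m]]) auto
      then show ?thesis
        using rep by (simp only: morrey_norm_dist_eq[OF \<psi> rep])
    qed
    have c0: "c j \<ge> 0" for j
      unfolding c_def using L B(1) D(1) b0 d0
      by (intro mult_nonneg_nonneg add_nonneg_nonneg suminf_nonneg summable_ignore_initial_segment F(4) G(4)) auto
    \<comment> \<open>The full sums are replaced by their bounds, which are free of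
      \<open>j\<close>. What still depends on \<open>j\<close> is linear in \<open>X\<close> and
      \<open>Y\<close>, and each term carries both norms once \<open>X\<close> and \<open>Y\<close>
      are estimated.\<close>
    have cle: "2 powr (real j * s) * c j \<le> L * 2 powr (2 * s) * (W * Ng * X j + W * Nf * Y j)" for j
    proof -
      have X0: "X j \<ge> 0" "Y j \<ge> 0" using X Y by (auto simp: lr_le_def)
      have "2 powr (real j * s) * c j = L * (suminf d * (2 powr (real j * s) * (\<Sum>k. b (k + (j - 2))))
          + suminf b * (2 powr (real j * s) * (\<Sum>k. d (k + (j - 2)))))"
        by (simp add: c_def algebra_simps)
      also have "\<dots> \<le> L * (suminf d * (2 powr (2 * s) * X j) + suminf b * (2 powr (2 * s) * Y j))"
        unfolding X_def Y_def using L B(1) D(1)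
        by (intro mult_left_mono add_mono weighted_tail_le F(4) G(4) b0 d0 s) auto
      also have "\<dots> \<le> L * (W * Ng * (2 powr (2 * s) * X j) + W * Nf * (2 powr (2 * s) * Y j))"
        using L B(2) D(2) X0 by (intro mult_left_mono add_mono mult_right_mono) auto
      also have "\<dots> = L * 2 powr (2 * s) * (W * Ng * X j + W * Nf * Y j)"
        by (simp add: algebra_simps)
      finally show ?thesis .
    qed
    have "lr_le r (\<lambda>j. L * 2 powr (2 * s) * (W * Ng * X j + W * Nf * Y j))
        (L * 2 powr (2 * s) * (4 * (W * Ng * (3 * W * Nf) + W * Nf * (3 * W * Ng))))"
      using L W N0 by (intro lr_le_cmult lr_le_add X Y r) auto
    moreover have "L * 2 powr (2 * s) * (4 * (W * Ng * (3 * W * Nf) + W * Nf * (3 * W * Ng))) = C * Nf * Ng"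
      by (simp add: C_def power2_eq_square algebra_simps)
    ultimately have "lr_le r (\<lambda>j. L * 2 powr (2 * s) * (W * Ng * X j + W * Nf * Y j)) (C * Nf * Ng)"
      by (simp only:)
    then have "lr_le r (\<lambda>j. 2 powr (real j * s) * c j) (C * Nf * Ng)"
      by (rule lr_le_mono) (use c0 cle in auto)
    then have lr: "lr_norm r (\<lambda>j. ennreal (2 powr (real j * s) * c j)) \<le> ennreal (C * Nf * Ng)"
      by (simp add: lr_le_def)
    have "besov_morrey_norm \<psi> s p q r h \<le> lr_norm r (\<lambda>j. ennreal (2 powr (real j * s) * c j))"
      unfolding besov_morrey_norm_eq_lr_norm
      by (intro lr_norm_mono) (use c in \<open>simp add: ennreal_mult' mult_left_mono\<close>)
    then have hle: "besov_morrey_norm \<psi> s p q r h \<le> ennreal (C * Nf * Ng)"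
      using lr by (rule order_trans)
    then have hle': "besov_morrey_norm \<psi> s p q r h
        \<le> ennreal C * besov_morrey_norm \<psi> s p\<^sub>1 q\<^sub>1 r f * besov_morrey_norm \<psi> s p\<^sub>2 q\<^sub>2 r g"
      unfolding N using C N0 by (simp add: ennreal_mult')
    have hB: "h \<in> besov_morrey \<psi> s p q r"
      using dist_of_tempered[OF tFG] hle by (auto simp: besov_morrey_def h_def intro: order_le_less_trans)
    \<comment> \<open>Other representatives agree with \<open>F\<close> and \<open>G\<close> almost
      everywhere, so their product defines the same \<open>h\<close>.\<close>
    have "represents (\<lambda>x. F0 x * G0 x) h" if "represents F0 f" "represents G0 g" for F0 G0
    proof (rule represents_cong_AE[OF represents_dist_of[OF tFG], folded h_def])
      show "(\<lambda>x. F0 x * G0 x) \<in> borel_measurable lebesgue"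
        using that[THEN represents_measurable] by measurable
      show "AE x in lborel. F x * G x = F0 x * G0 x"
        using represents_unique[OF \<psi> F(1) that(1)] represents_unique[OF \<psi> G(1) that(2)]
        by eventually_elim simp
    qed
    then show ?thesis
      using F(1) G(1) hB hle' by blast
  qed
  show ?thesis
    using C main by blast
qed

end
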